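(* Let $G=(V,E_G,\mathbf{w}^G,\boldsymbol{\mu})$ be a weighted hypergraph equipped with monotone submodular cut functions $\{\delta_h\}_{h\in E_G}$, $\delta_h(S)=\min\{F_h(S),F_h(h\setminus S)\}$. Given a hypergraph flow $\mathbf{Y}$ over $G$, there is an algorithm that, in time $\tilde O(\mathrm{sparsity}(G))$, computes a weighted graph $H=(V,E_H,\mathbf{w}^H)$ such that $H\preceq_{\mathrm{cong}_G(\mathbf{Y})}G$. Furthermore: (1) $H$ is bipartite over the partition $\big(\{i\in V:\mathrm{dem}_i(\mathbf{Y})\ge0\},\{i\in V:\mathrm{dem}_i(\mathbf{Y})<0\}\big)$; (2) the weighted degree of each vertex $i$ in $H$ equals $|\mathrm{dem}_i(\mathbf{Y})|$.
   Context: Each $F_h:2^h\to\mathbb{R}$ is non-decreasing submodular with $F_h(\emptyset)=0$ and $F_h(\{i\})>0$ for $i\in h$. $\mathrm{sparsity}(G)=\sum_{h\in E_G}|h|$. $\|\mathbf{x}\|_{F}=\bar F(|\mathbf{x}|)$ with $\bar F$ the Lovász extension of $F$, and $\|\mathbf{y}\|_{*,F}=\max\{\langle\mathbf{y},\mathbf{x}\rangle:\|\mathbf{x}\|_F\le1\}$. A hypergraph flow is $\mathbf{Y}=(\mathbf{y}_h)_{h\in E_G}$ with $\mathbf{y}_h\in\mathbb{R}^h$, $\langle\mathbf{y}_h,\mathbf{1}\rangle=0$; $\mathrm{dem}_i(\mathbf{Y})=\sum_{h\ni i}(\mathbf{y}_h)_i$. Congestion: $\mathrm{cong}_h(\mathbf{Y})=\|\mathbf{y}_h\|_{*,F_h}/w^G_h$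 and $\mathrm{cong}_G(\mathbf{Y})=\max_{h\in E_G}\mathrm{cong}_h(\mathbf{Y})$. $H\preceq_\rho G$ means there are hypergraph flows $\{\mathbf{Y}^e\}_{e\in E_H}$ with (1) $|\mathrm{dem}(\mathbf{Y}^e)|=w^H_e(\mathbf{1}_i+\mathbf{1}_j)$ for each $e=\{i,j\}\in E_H$, and (2) $\big\|\sum_{e\in E_H}|\mathbf{y}^e_h|\big\|_{*,F_h}\le\rho\,w^G_h$ for each $h\in E_G$. *)

theory Defs
  imports Complex_Main "HOL-Library.Landau_Symbols" "HOL-Library.Indicator_Function"
begin

section \<open>Submodular hypergraphs\<close>

text \<open>The vertex set is \<open>{..<nverts G}\<close>, and hyperedges are subsets of it. A vector
  in \<open>\<real>\<^sup>h\<close> is a function \<open>nat \<Rightarrow> real\<close> of which only the values on \<open>h\<close> are used.\<close>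

record hypergraph =
  nverts  :: nat
  hedges  :: "nat set set"
  hweight :: "nat set \<Rightarrow> real"
  vweight :: "nat \<Rightarrow> real"

abbreviation verts :: "hypergraph \<Rightarrow> nat set" where
  "verts G \<equiv> {..<nverts G}"

definition weighted_hypergraph :: "hypergraph \<Rightarrow> bool" where
  "weighted_hypergraph G \<longleftrightarrow>
     hedges G \<subseteq> Pow (verts G) \<and>
     (\<forall>h\<in>hedges G. hweight G h > 0) \<and>
     (\<forall>i\<in>verts G. vweight G i \<ge> 0)"

definition sparsity :: "hypergraph \<Rightarrow> nat" where
  "sparsity G = (\<Sum>h\<in>hedges G. card h)"

definition monotone_submodular :: "nat set \<Rightarrow> (nat set \<Rightarrow> real) \<Rightarrow> bool" where
  "monotone_submodular h F \<longleftrightarrow>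
     F {} = 0 \<and>
     (\<forall>i\<in>h. F {i} > 0) \<and>
     (\<forall>A B. A \<subseteq> B \<and> B \<subseteq> h \<longrightarrow> F A \<le> F B) \<and>
     (\<forall>A B. A \<subseteq> h \<and> B \<subseteq> h \<longrightarrow> F (A \<union> B) + F (A \<inter> B) \<le> F A + F B)"

definition monotone_submodular_cuts ::
  "hypergraph \<Rightarrow> (nat set \<Rightarrow> nat set \<Rightarrow> real) \<Rightarrow> (nat set \<Rightarrow> nat set \<Rightarrow> real) \<Rightarrow> bool" where
  "monotone_submodular_cuts G F \<delta> \<longleftrightarrow>
     (\<forall>h\<in>hedges G. monotone_submodular h (F h) \<and>
        (\<forall>S. S \<subseteq> h \<longrightarrow> \<delta> h S = min (F h S) (F h (h - S))))"

section \<open>Norms\<close>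

text \<open>The Lovasz extension by the greedy formula: list \<open>h\<close> in order of decreasing
  \<open>x\<close>-value as \<open>i\<^sub>1, \<dots>, i\<^sub>n\<close> and take the sum of
  \<open>x i\<^sub>k * (F {i\<^sub>1, \<dots>, i\<^sub>k} - F {i\<^sub>1, \<dots>, i\<^sub>k\<^sub>-\<^sub>1})\<close>. The value does not depend on how
  ties are broken.\<close>

definition lovasz_extension :: "nat set \<Rightarrow> (nat set \<Rightarrow> real) \<Rightarrow> (nat \<Rightarrow> real) \<Rightarrow> real" where
  "lovasz_extension h F x =
     (let xs = sort_key (\<lambda>i. - x i) (sorted_list_of_set h)
      in \<Sum>k<length xs. x (xs ! k) * (F (set (take (Suc k) xs)) - F (set (take k xs))))"

definition submod_norm :: "nat set \<Rightarrow> (nat set \<Rightarrow> real) \<Rightarrow> (nat \<Rightarrow> real) \<Rightarrow> real" where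
  "submod_norm h F x = lovasz_extension h F (\<lambda>i. \<bar>x i\<bar>)"

text \<open>For \<open>F\<close> as in \<^const>\<open>monotone_submodular\<close> and finite \<open>h\<close> the unit ball is compact, so that
  the supremum is attained and is the maximum.\<close>

definition dual_norm :: "nat set \<Rightarrow> (nat set \<Rightarrow> real) \<Rightarrow> (nat \<Rightarrow> real) \<Rightarrow> real" where
  "dual_norm h F y = Sup {(\<Sum>i\<in>h. y i * x i) | x. submod_norm h F x \<le> 1}"

section \<open>Hypergraph flows and embeddings\<close>

type_synonym hflow = "nat set \<Rightarrow> nat \<Rightarrow> real"

definition hypergraph_flow :: "hypergraph \<Rightarrow> hflow \<Rightarrow> bool" where
  "hypergraph_flow G Y \<longleftrightarrow> (\<forall>h\<in>hedges G. (\<Sum>i\<in>h. Y h i) = 0)"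

definition dem :: "hypergraph \<Rightarrow> hflow \<Rightarrow> nat \<Rightarrow> real" where
  "dem G Y i = (\<Sum>h\<in>{h\<in>hedges G. i \<in> h}. Y h i)"

definition hedge_cong ::
  "hypergraph \<Rightarrow> (nat set \<Rightarrow> nat set \<Rightarrow> real) \<Rightarrow> hflow \<Rightarrow> nat set \<Rightarrow> real" where
  "hedge_cong G F Y h = dual_norm h (F h) (Y h) / hweight G h"

text \<open>Unspecified if \<open>G\<close> has no hyperedge, where \<open>embeds H \<rho> G F\<close> below does
  not depend on \<open>\<rho>\<close>.\<close>

definition congestion ::
  "hypergraph \<Rightarrow> (nat set \<Rightarrow> nat set \<Rightarrow> real) \<Rightarrow> hflow \<Rightarrow> real" where
  "congestion G F Y = Max (hedge_cong G F Y ` hedges G)"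

record wgraph =
  gedges  :: "nat set set"
  gweight :: "nat set \<Rightarrow> real"

definition weighted_graph_on :: "nat set \<Rightarrow> wgraph \<Rightarrow> bool" where
  "weighted_graph_on V H \<longleftrightarrow>
     (\<forall>e\<in>gedges H. (\<exists>i\<in>V. \<exists>j\<in>V. i \<noteq> j \<and> e = {i, j}) \<and> gweight H e > 0)"

definition wdegree :: "wgraph \<Rightarrow> nat \<Rightarrow> real" where
  "wdegree H i = (\<Sum>e\<in>{e\<in>gedges H. i \<in> e}. gweight H e)"

definition bipartite_over :: "wgraph \<Rightarrow> nat set \<Rightarrow> nat set \<Rightarrow> bool" where
  "bipartite_over H A B \<longleftrightarrow> (\<forall>e\<in>gedges H. \<exists>i\<in>A. \<exists>j\<in>B. e = {i, j})"

definition embeds ::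
  "wgraph \<Rightarrow> real \<Rightarrow> hypergraph \<Rightarrow> (nat set \<Rightarrow> nat set \<Rightarrow> real) \<Rightarrow> bool" where
  "embeds H \<rho> G F \<longleftrightarrow>
     (\<exists>Z :: nat set \<Rightarrow> hflow.
        (\<forall>e\<in>gedges H. hypergraph_flow G (Z e)) \<and>
        (\<forall>i j. {i, j} \<in> gedges H \<longrightarrow>
           (\<forall>v\<in>verts G. \<bar>dem G (Z {i, j}) v\<bar> =
              gweight H {i, j} * (indicator {i} v + indicator {j} v))) \<and>
        (\<forall>h\<in>hedges G.
           dual_norm h (F h) (\<lambda>i. \<Sum>e\<in>gedges H. \<bar>Z e h i\<bar>) \<le> \<rho> * hweight G h))"

section \<open>Algorithms over the reals and their running time\<close>

text \<open>Algorithms are programs in a first-order, purely functional language whose values are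
  natural numbers, real numbers and immutable pairs. Real arithmetic and comparison are exact
  and have unit cost. Every evaluation step can be carried out in constant time on a real RAM
  (with the value of a pair kept as a pointer to a cell), hence any running time here is also a
  running time on a real RAM. On natural numbers there is no multiplication and no division,
  and there is no rounding of reals to integers, so that large numbers cannot be used to get
  unbounded parallelism at unit cost. Constants in programs are natural numbers only.\<close>

datatype val = NatV nat | RealV real | PairV val val

datatype op1 = OfNat | Fst | Snd | IsPair

datatype op2 = Add | Sub | Mult | Divide | Less | MkPair

fun apply1 :: "op1 \<Rightarrow> val \<Rightarrow> val option" where
  "apply1 OfNat (NatV n) = Some (RealV (real n))"
| "apply1 Fst (PairV a b) = Some a"
| "apply1 Snd (PairV a b) = Some b"
| "apply1 IsPair v = Some (NatV (case v of PairV _ _ \<Rightarrow> 1 | _ \<Rightarrow> 0))"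
| "apply1 _ _ = None"

fun apply2 :: "op2 \<Rightarrow> val \<Rightarrow> val \<Rightarrow> val option" where
  "apply2 Add (NatV m) (NatV n) = Some (NatV (m + n))"
| "apply2 Sub (NatV m) (NatV n) = Some (NatV (m - n))"
| "apply2 Less (NatV m) (NatV n) = Some (NatV (if m < n then 1 else 0))"
| "apply2 Add (RealV x) (RealV y) = Some (RealV (x + y))"
| "apply2 Sub (RealV x) (RealV y) = Some (RealV (x - y))"
| "apply2 Mult (RealV x) (RealV y) = Some (RealV (x * y))"
| "apply2 Divide (RealV x) (RealV y) = (if y = 0 then None else Some (RealV (x / y)))"
| "apply2 Less (RealV x) (RealV y) = Some (NatV (if x < y then 1 else 0))"
| "apply2 MkPair a b = Some (PairV a b)"
| "apply2 _ _ _ = None"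

text \<open>Variables are de Bruijn indices; \<open>LetE a b\<close> binds the value of \<open>a\<close> to index 0 in \<open>b\<close>;
  \<open>CallE f a\<close> evaluates the body of function number \<open>f\<close> with the value of \<open>a\<close> as its only
  variable. A program is the list of its function bodies; number 0 is the entry point.\<close>

datatype expr =
    VarE nat
  | ConstE nat
  | Op1E op1 expr
  | Op2E op2 expr expr
  | IfE expr expr expr
  | LetE expr expr
  | CallE nat expr

type_synonym program = "expr list"

text \<open>\<open>evaluates p env e v t\<close>: under \<open>p\<close> and \<open>env\<close> the expression \<open>e\<close> evaluates to \<open>v\<close> in \<open>t\<close> steps.
  There is no derivation if the evaluation diverges or gets stuck on a run-time type error.\<close>

inductive evaluates :: "program \<Rightarrow> val list \<Rightarrow> expr \<Rightarrow> val \<Rightarrow> nat \<Rightarrow> bool" for p where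
  var: "i < length env \<Longrightarrow> evaluates p env (VarE i) (env ! i) 1"
| const: "evaluates p env (ConstE n) (NatV n) 1"
| op1: "\<lbrakk>evaluates p env a u s; apply1 f u = Some v\<rbrakk>
    \<Longrightarrow> evaluates p env (Op1E f a) v (s + 1)"
| op2: "\<lbrakk>evaluates p env a u s; evaluates p env b v t; apply2 f u v = Some w\<rbrakk>
    \<Longrightarrow> evaluates p env (Op2E f a b) w (s + t + 1)"
| if_true: "\<lbrakk>evaluates p env c (NatV n) s; n \<noteq> 0; evaluates p env a v t\<rbrakk>
    \<Longrightarrow> evaluates p env (IfE c a b) v (s + t + 1)"
| if_false: "\<lbrakk>evaluates p env c (NatV 0) s; evaluates p env b v t\<rbrakk>
    \<Longrightarrow> evaluates p env (IfE c a b) v (s + t + 1)"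
| let_in: "\<lbrakk>evaluates p env a u s; evaluates p (u # env) b v t\<rbrakk>
    \<Longrightarrow> evaluates p env (LetE a b) v (s + t + 1)"
| call: "\<lbrakk>f < length p; evaluates p env a u s; evaluates p [u] (p ! f) v t\<rbrakk>
    \<Longrightarrow> evaluates p env (CallE f a) v (s + t + 1)"

lemma evaluates_deterministic:
  "evaluates p env e v t \<Longrightarrow> evaluates p env e v' t' \<Longrightarrow> v' = v \<and> t' = t"
proof (induction arbitrary: v' t' rule: evaluates.induct)
  case (var i env)
  from var.prems show ?case by cases auto
next
  case (const env n)
  from const.prems show ?case by cases auto
next
  case (op1 env a u s f v)
  from op1.prems show ?case by cases (metis op1.IH op1.hyps(2) option.inject)
next
  case (op2 env a u s b v t f w)
  from op2.prems show ?case by cases (metis op2.IH op2.hyps(3) option.inject)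
next
  case (if_true env c n s a v t b)
  from if_true.prems show ?case
    by cases (metis if_true.IH if_true.hyps(2) val.inject(1))+
next
  case (if_false env c s b v t a)
  from if_false.prems show ?case by cases (metis if_false.IH val.inject(1))+
next
  case (let_in env a u s b v t)
  from let_in.prems show ?case by cases (metis let_in.IH)
next
  case (call f env a u s v t)
  from call.prems show ?case by cases (metis call.IH)
qed

definition computes :: "program \<Rightarrow> val \<Rightarrow> val \<Rightarrow> nat \<Rightarrow> bool" where
  "computes p input result t \<longleftrightarrow> evaluates p [input] (CallE 0 (VarE 0)) result t"

definition soft_linear :: "(nat \<Rightarrow> real) \<Rightarrow> bool" where
  "soft_linear T \<longleftrightarrow> (\<exists>k. T \<in> O(\<lambda>s. real s * ln (real s) ^ k))"

section \<open>Input and output encoding\<close>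

fun list_val :: "val list \<Rightarrow> val" where
  "list_val [] = NatV 0"
| "list_val (v # vs) = PairV v (list_val vs)"

text \<open>The hyperedges, and the vertices inside each hyperedge, are listed in an arbitrary order.\<close>

definition enumerates_hedges :: "hypergraph \<Rightarrow> nat list list \<Rightarrow> bool" where
  "enumerates_hedges G hs \<longleftrightarrow>
     (\<forall>xs\<in>set hs. distinct xs) \<and> distinct (map set hs) \<and> set (map set hs) = hedges G"

definition input_val :: "hypergraph \<Rightarrow> hflow \<Rightarrow> nat list list \<Rightarrow> val" where
  "input_val G Y hs =
     PairV (NatV (nverts G))
       (PairV (list_val (map (\<lambda>i. RealV (vweight G i)) [0..<nverts G]))
         (list_val (map (\<lambda>xs.
            PairV (RealV (hweight G (set xs)))
              (list_val (map (\<lambda>i. PairV (NatV i) (RealV (Y (set xs) i))) xs))) hs)))"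

text \<open>A weighted graph is output as a list of weighted edges without repetitions.\<close>

definition represents_graph :: "val \<Rightarrow> wgraph \<Rightarrow> bool" where
  "represents_graph v H \<longleftrightarrow>
     (\<exists>es :: (nat \<times> nat) list.
        distinct (map (\<lambda>(i, j). {i, j}) es) \<and>
        set (map (\<lambda>(i, j). {i, j}) es) = gedges H \<and>
        v = list_val (map (\<lambda>(i, j).
              PairV (NatV i) (PairV (NatV j) (RealV (gweight H {i, j})))) es))"

end

(* Regard the flow as living on the bipartite vertex-hyperedge incidence graph and bypass one node after
   another: pairing the flow into a node with the flow out of it by the north-west corner rule replaces
   its d arcs by at most d arcs, and every new arc is carried by flows whose absolute values add up to no
   more than before. What a vertex cannot pair is left at a terminal copy of it, as a pure source or a
   pure sink. Hyperedges are balanced and leave nothing. In the end all arcs run from sources to sinks,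
   and since every dual norm is monotone in absolute values they embed with the congestion of the flow.
   The number m of arcs never grows, but the degrees of the remaining vertices may. Hence the vertices
   are bypassed in phases: phase D = 1, 2, 4, ... scans the vertices in increasing order and skips those
   of degree above D. Bypassing other vertices never lowers the degree of a skipped one, so at most 2m/D
   vertices reach the phase 2D, which costs O(m) heap operations. *)

theory Submission
  imports Defs "HOL-Library.Multiset" "HOL-Library.Product_Lexorder"
begin

section \<open>Evaluation as a partial function\<close>

\<comment> \<open>The time bound involves the sparsity alone, while the number of vertices may be
  arbitrarily larger, and the language has no arrays: neither a pass over all vertices nor an
  adjacency table is available. A priority queue takes their place. Each arc waits under the smaller
  of those of its ends that the scan has yet to meet. When \<open>v\<close> is the least key, the
  arcs of that key are thus all the arcs at \<open>v\<close>, and only vertices that occur on arcs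
  are ever touched. Without a degree limit, bypassing could pile up arcs at later vertices and make
  the scan collect too many of them. With threshold \<open>D\<close> a bypass puts at most
  \<open>D\<close> arcs back into the queue, and at most \<open>4 * m / D\<close> vertices are
  charged for it. About \<open>log m\<close> phases of \<open>m\<close> heap operations of cost
  \<open>log m\<close> give the square of the logarithm. The flows that carry the arcs occur only in
  the correctness proof; the program handles arcs alone. The terminal copy of a vertex keeps its
  surplus out of later matchings, so that its side is decided once.\<close>
inductive_simps evaluates_VarE: "evaluates p env (VarE i) v t"
inductive_simps evaluates_ConstE: "evaluates p env (ConstE n) v t"
inductive_simps evaluates_Op1E: "evaluates p env (Op1E f a) v t"
inductive_simps evaluates_Op2E: "evaluates p env (Op2E f a b) v t"
inductive_simps evaluates_IfE: "evaluates p env (IfE c a b) v t"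
inductive_simps evaluates_LetE: "evaluates p env (LetE a b) v t"
inductive_simps evaluates_CallE: "evaluates p env (CallE f a) v t"

text \<open>Evaluation is deterministic, hence a partial function. In this form the simplifier
  executes a program body symbolically, and the values and running times below are obtained that
  way.\<close>

definition run :: "program \<Rightarrow> val list \<Rightarrow> expr \<Rightarrow> (val \<times> nat) option" where
  "run p env e = (if \<exists>r. evaluates p env e (fst r) (snd r)
     then Some (SOME r. evaluates p env e (fst r) (snd r)) else None)"

lemma run_eq_Some: "run p env e = Some (v, t) \<longleftrightarrow> evaluates p env e v t"
proof -
  have some: "(SOME r. evaluates p env e (fst r) (snd r)) = (v, t)" if "evaluates p env e v t" for v t
    using that evaluates_deterministic by (intro some_equality) (auto simp: prod_eq_iff)
  show ?thesis
  proof
    assume "run p env e = Some (v, t)"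
    then obtain r where "evaluates p env e (fst r) (snd r)"
      and "(SOME r. evaluates p env e (fst r) (snd r)) = (v, t)"
      unfolding run_def by (metis option.distinct(1) option.inject)
    with some show "evaluates p env e v t" by fastforce
  next
    assume "evaluates p env e v t"
    with some show "run p env e = Some (v, t)"
      unfolding run_def by (metis fst_conv snd_conv)
  qed
qed

lemma run_eqI:
  assumes "\<And>v t. evaluates p env e v t \<longleftrightarrow> r = Some (v, t)"
  shows "run p env e = r"
proof (cases r)
  case None
  then have "run p env e \<noteq> Some x" for x
    using assms run_eq_Some[of p env e "fst x" "snd x"] by auto
  then show ?thesis using None by (cases "run p env e") auto
next
  case (Some x)
  then show ?thesis
    using assms run_eq_Some[of p env e "fst x" "snd x"] by auto
qed

text \<open>Value and cost of a call are two opaque constants, so symbolic execution halts at each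
  call instead of unfolding a recursive body for ever; what a call does then comes from an induction
  hypothesis or an earlier lemma.\<close>

definition call_value :: "program \<Rightarrow> nat \<Rightarrow> val \<Rightarrow> val option" where
  "call_value p f u = (if f < length p then map_option fst (run p [u] (p ! f)) else None)"

definition call_time :: "program \<Rightarrow> nat \<Rightarrow> val \<Rightarrow> nat" where
  "call_time p f u = snd (the (run p [u] (p ! f)))"

lemma run_VarE: "run p env (VarE i) = (if i < length env then Some (env ! i, 1) else None)"
  by (rule run_eqI, unfold evaluates_VarE)
    (auto split: option.splits prod.splits val.splits if_splits)

lemma run_ConstE: "run p env (ConstE n) = Some (NatV n, 1)"
  by (rule run_eqI, unfold evaluates_ConstE)
    (auto split: option.splits prod.splits val.splits if_splits)

lemma run_Op1E: "run p env (Op1E f a) =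
    (case run p env a of None \<Rightarrow> None | Some (u, s) \<Rightarrow>
     (case apply1 f u of None \<Rightarrow> None | Some v \<Rightarrow> Some (v, s + 1)))"
  by (rule run_eqI, unfold evaluates_Op1E, unfold run_eq_Some[symmetric])
    (auto split: option.splits prod.splits val.splits if_splits)

lemma run_Op2E: "run p env (Op2E f a b) =
    (case run p env a of None \<Rightarrow> None | Some (u, s) \<Rightarrow>
     (case run p env b of None \<Rightarrow> None | Some (v, t) \<Rightarrow>
     (case apply2 f u v of None \<Rightarrow> None | Some w \<Rightarrow> Some (w, s + t + 1))))"
  by (rule run_eqI, unfold evaluates_Op2E, unfold run_eq_Some[symmetric])
    (auto split: option.splits prod.splits val.splits if_splits)

lemma run_IfE: "run p env (IfE c a b) =
    (case run p env c of Some (NatV n, s) \<Rightarrow>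
      (case run p env (if n = 0 then b else a) of None \<Rightarrow> None | Some (v, t) \<Rightarrow> Some (v, s + t + 1))
     | _ \<Rightarrow> None)"
  by (rule run_eqI, unfold evaluates_IfE, unfold run_eq_Some[symmetric])
    (auto split: option.splits prod.splits val.splits if_splits)

lemma run_LetE: "run p env (LetE a b) =
    (case run p env a of None \<Rightarrow> None | Some (u, s) \<Rightarrow>
     (case run p (u # env) b of None \<Rightarrow> None | Some (v, t) \<Rightarrow> Some (v, s + t + 1)))"
  by (rule run_eqI, unfold evaluates_LetE, unfold run_eq_Some[symmetric])
    (auto split: option.splits prod.splits val.splits if_splits)

lemma run_CallE: "run p env (CallE f a) =
    (case run p env a of None \<Rightarrow> None | Some (u, s) \<Rightarrow>
     (case call_value p f u of None \<Rightarrow> None | Some v \<Rightarrow> Some (v, s + call_time p f u + 1)))"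
  by (rule run_eqI, unfold evaluates_CallE, unfold run_eq_Some[symmetric])
    (auto simp: call_value_def call_time_def split: option.splits prod.splits val.splits if_splits)

lemmas run_simps = run_VarE run_ConstE run_Op1E run_Op2E run_IfE run_LetE run_CallE

section \<open>The program\<close>

abbreviation (input) "RANK \<equiv> Suc 0"
abbreviation (input) "MK \<equiv> 2 :: nat"
abbreviation (input) "LESS \<equiv> 3 :: nat"
abbreviation (input) "MERGE \<equiv> 4 :: nat"
abbreviation (input) "INSERT \<equiv> 5 :: nat"
abbreviation (input) "LATER \<equiv> 6 :: nat"
abbreviation (input) "KEYF \<equiv> 7 :: nat"
abbreviation (input) "PLACE \<equiv> 8 :: nat"
abbreviation (input) "COLLECT \<equiv> 9 :: nat"
abbreviation (input) "ISEQ \<equiv> 10 :: nat"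
abbreviation (input) "SPLIT \<equiv> 11 :: nat"
abbreviation (input) "MATCH \<equiv> 12 :: nat"
abbreviation (input) "LOOP \<equiv> 13 :: nat"
abbreviation (input) "PHASES \<equiv> 14 :: nat"
abbreviation (input) "SIGNS \<equiv> 15 :: nat"
abbreviation (input) "BUILD \<equiv> 16 :: nat"
abbreviation (input) "LOAD \<equiv> 17 :: nat"
abbreviation (input) "DRAIN \<equiv> 18 :: nat"

abbreviation (input) "arg \<equiv> VarE 0"
abbreviation (input) "lit \<equiv> ConstE"
abbreviation (input) "fstE \<equiv> Op1E Fst"
abbreviation (input) "sndE \<equiv> Op1E Snd"
abbreviation (input) "isE \<equiv> Op1E IsPair"
abbreviation (input) "pairE \<equiv> Op2E MkPair"
abbreviation (input) "lessE \<equiv> Op2E Less"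
abbreviation (input) "addE \<equiv> Op2E Add"
abbreviation (input) "subE \<equiv> Op2E Sub"
abbreviation (input) "entryE h \<equiv> fstE (sndE h)"
abbreviation (input) "keyE h \<equiv> fstE (entryE h)"
abbreviation (input) "leftE h \<equiv> fstE (sndE (sndE h))"
abbreviation (input) "rightE h \<equiv> sndE (sndE (sndE h))"

text \<open>Arguments are passed as right-nested pairs. A heap node is \<open>(rank, ((key, edge), (left, right)))\<close>
  and the empty heap, like the empty list, is a natural number, so that \<^const>\<open>IsPair\<close> tells them
  apart. An endpoint is a number for a vertex not yet bypassed and a pair for a terminal copy.\<close>

definition rank_body :: expr where
  "rank_body = IfE (isE arg) (fstE arg) (lit 0)"

definition mk_body :: expr where
  "mk_body = (let l = fstE (sndE arg); r = sndE (sndE arg) in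
    IfE (lessE (CallE RANK l) (CallE RANK r))
      (pairE (addE (CallE RANK l) (lit 1)) (pairE (fstE arg) (pairE r l)))
      (pairE (addE (CallE RANK r) (lit 1)) (pairE (fstE arg) (pairE l r))))"

definition less_body :: expr where
  "less_body = (let k = fstE arg; k' = sndE arg in
    IfE (lessE (fstE k) (fstE k')) (lit 1)
      (IfE (lessE (fstE k') (fstE k)) (lit 0) (lessE (sndE k) (sndE k'))))"

definition merge_body :: expr where
  "merge_body = (let h1 = fstE arg; h2 = sndE arg in
    IfE (isE h1) (IfE (isE h2)
      (IfE (CallE LESS (pairE (keyE h2) (keyE h1)))
        (CallE MK (pairE (entryE h2) (pairE (leftE h2) (CallE MERGE (pairE h1 (rightE h2))))))
        (CallE MK (pairE (entryE h1) (pairE (leftE h1) (CallE MERGE (pairE (rightE h1) h2))))))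
      h1) h2)"

definition insert_body :: expr where
  "insert_body = CallE MERGE (pairE
     (pairE (lit 1) (pairE (pairE (fstE arg) (fstE (sndE arg))) (pairE (lit 0) (lit 0))))
     (sndE (sndE arg)))"

definition later_body :: expr where
  "later_body = IfE (isE (sndE arg)) (lit 0) (IfE (lessE (sndE arg) (fstE arg)) (lit 0) (lit 1))"

definition keyf_body :: expr where
  "keyf_body = (let lo = fstE arg; a = fstE (sndE arg); b = fstE (sndE (sndE arg)) in
    IfE (CallE LATER (pairE lo a))
      (IfE (CallE LATER (pairE lo b))
        (IfE (lessE b a) (pairE b (lit 0)) (pairE a (lit 0)))
        (pairE a (lit 0)))
      (IfE (CallE LATER (pairE lo b)) (pairE b (lit 0)) (lit 0)))"

definition place_body :: expr where
  "place_body = IfE (isE (fstE (sndE arg)))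
     (LetE (CallE KEYF (pairE (fstE arg) (fstE (fstE (sndE arg)))))
       (let lo = fstE (VarE 1); es = fstE (sndE (VarE 1));
            h = fstE (sndE (sndE (VarE 1))); q = sndE (sndE (sndE (VarE 1))) in
        IfE (isE (VarE 0))
          (CallE PLACE (pairE lo (pairE (sndE es)
             (pairE (CallE INSERT (pairE (VarE 0) (pairE (fstE es) h))) q))))
          (CallE PLACE (pairE lo (pairE (sndE es) (pairE h (pairE (fstE es) q)))))))
     (sndE (sndE arg))"

definition collect_body :: expr where
  "collect_body = (let v = fstE arg; h = fstE (sndE arg);
      acc = fstE (sndE (sndE arg)); d = sndE (sndE (sndE arg));
      result = pairE acc (pairE d h) in
    IfE (isE h)
      (IfE (lessE v (fstE (keyE h))) result
        (CallE COLLECT (pairE v (pairE (CallE MERGE (pairE (leftE h) (rightE h)))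
          (pairE (pairE (sndE (entryE h)) acc) (subE d (lit 1)))))))
      result)"

definition iseq_body :: expr where
  "iseq_body = (let a = fstE arg; v = sndE arg in
    IfE (isE a) (lit 0) (IfE (lessE a v) (lit 0) (IfE (lessE v a) (lit 0) (lit 1))))"

definition split_body :: expr where
  "split_body = (let v = fstE arg; es = fstE (sndE arg);
      is = fstE (sndE (sndE arg)); os = sndE (sndE (sndE arg));
      a = fstE (fstE es); b = fstE (sndE (fstE es)); x = sndE (sndE (fstE es)) in
    IfE (isE es)
      (CallE SPLIT (pairE v (pairE (sndE es)
        (IfE (CallE ISEQ (pairE a v))
          (IfE (CallE ISEQ (pairE b v)) (pairE is os) (pairE is (pairE (pairE b x) os)))
          (pairE (pairE (pairE a x) is) os)))))
      (pairE is os))"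

definition match_body :: expr where
  "match_body = (let is = fstE arg; os = fstE (sndE arg);
      t = fstE (sndE (sndE arg)); acc = sndE (sndE (sndE arg));
      a = fstE (fstE is); x = sndE (fstE is); b = fstE (fstE os); y = sndE (fstE os);
      new = (\<lambda>a b x. pairE (pairE a (pairE b x)) acc);
      rec = (\<lambda>is os acc. CallE MATCH (pairE is (pairE os (pairE t acc)))) in
    IfE (isE is)
      (IfE (isE os)
        (IfE (lessE x y) (rec (sndE is) (pairE (pairE b (subE y x)) (sndE os)) (new a b x))
          (IfE (lessE y x) (rec (pairE (pairE a (subE x y)) (sndE is)) (sndE os) (new a b y))
            (rec (sndE is) (sndE os) (new a b x))))
        (rec (sndE is) os (new a t x)))
      (IfE (isE os) (rec is (sndE os) (new t b y)) acc))"

text \<open>One round of a phase; the argument is \<open>(heap, (pile, D))\<close>, where the pile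
  keeps the arcs with no end ahead of the scan. Around the final call the environment holds, from
  index 0 on: the new heap with the new pile, the vertex \<open>v\<close>, the result of collecting
  at \<open>v\<close>, and the argument.\<close>

definition loop_body :: expr where
  "loop_body = IfE (isE (fstE arg))
     (LetE (CallE COLLECT (pairE (fstE (keyE (fstE arg))) (pairE (fstE arg)
         (pairE (lit 0) (addE (sndE (sndE arg)) (lit 1))))))
       (LetE (fstE (keyE (fstE (VarE 1))))
         (LetE (CallE PLACE (pairE (addE (VarE 0) (lit 1)) (pairE
             (IfE (fstE (sndE (VarE 1)))
               (LetE (CallE SPLIT (pairE (VarE 0) (pairE (fstE (VarE 1)) (pairE (lit 0) (lit 0)))))
                 (CallE MATCH (pairE (fstE (VarE 0)) (pairE (sndE (VarE 0))
                   (pairE (pairE (VarE 1) (lit 0)) (lit 0))))))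
               (fstE (VarE 1)))
             (pairE (sndE (sndE (VarE 1))) (fstE (sndE (VarE 2)))))))
           (CallE LOOP (pairE (fstE (VarE 0)) (pairE (sndE (VarE 0)) (sndE (sndE (VarE 3)))))))))
     (fstE (sndE arg))"

text \<open>With \<open>lo = 0\<close> every vertex not yet bypassed supplies a key, so an empty
  queue means that only terminal copies are left. The threshold is doubled by addition because
  naturals have no multiplication.\<close>

definition phases_body :: expr where
  "phases_body = LetE (CallE PLACE (pairE (lit 0) (pairE (fstE arg) (pairE (lit 0) (lit 0)))))
     (IfE (isE (fstE (VarE 0)))
       (CallE PHASES (pairE
          (CallE LOOP (pairE (fstE (VarE 0)) (pairE (sndE (VarE 0)) (sndE (VarE 1)))))
          (addE (sndE (VarE 1)) (sndE (VarE 1)))))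
       (fstE (VarE 1)))"

text \<open>Constants are natural numbers, so the real zero has to be converted and
  \<open>- y\<close> is a difference. Zero entries are dropped; from here on every amount is
  positive.\<close>

definition signs_body :: expr where
  "signs_body = (let ys = fstE arg; is = fstE (sndE arg); os = sndE (sndE arg);
      i = fstE (fstE ys); y = sndE (fstE ys); z = Op1E OfNat (lit 0) in
    IfE (isE ys)
      (CallE SIGNS (pairE (sndE ys)
        (IfE (lessE z y) (pairE (pairE (pairE i y) is) os)
          (IfE (lessE y z) (pairE is (pairE (pairE i (subE z y)) os)) (pairE is os)))))
      (pairE is os))"

definition build_body :: expr where
  "build_body = IfE (isE (fstE arg))
     (LetE (CallE SIGNS (pairE (sndE (fstE (fstE arg))) (pairE (lit 0) (lit 0))))
       (CallE BUILD (pairE (sndE (fstE (VarE 1)))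
         (CallE MATCH (pairE (fstE (VarE 0)) (pairE (sndE (VarE 0))
           (pairE (pairE (lit 0) (lit 0)) (sndE (VarE 1)))))))))
     (sndE arg)"

definition load_body :: expr where
  "load_body = (let es = fstE arg; e = fstE es in
    IfE (isE es)
      (CallE LOAD (pairE (sndE es) (CallE INSERT
         (pairE (pairE (fstE (fstE e)) (fstE (fstE (sndE e)))) (pairE e (sndE arg))))))
      (sndE arg))"

definition drain_body :: expr where
  "drain_body = (let h = fstE arg; acc = sndE arg; k = keyE h; x = sndE (sndE (sndE (entryE h)));
      top = fstE acc; top_key = pairE (fstE top) (fstE (sndE top));
      rest = CallE MERGE (pairE (leftE h) (rightE h));
      new = pairE (pairE (fstE k) (pairE (sndE k) x)) acc in
    IfE (isE h)
      (CallE DRAIN (pairE rest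
        (IfE (isE acc)
          (IfE (CallE LESS (pairE top_key k)) new
            (pairE (pairE (fstE k) (pairE (sndE k) (addE (sndE (sndE top)) x))) (sndE acc)))
          new)))
      acc)"

definition main_body :: expr where
  "main_body = CallE DRAIN (pairE
     (CallE LOAD (pairE
       (CallE PHASES (pairE (CallE BUILD (pairE (sndE (sndE arg)) (lit 0))) (lit 1)))
       (lit 0)))
     (lit 0))"

definition demand_graph_program :: program where
  "demand_graph_program = [main_body, rank_body, mk_body, less_body, merge_body, insert_body,
     later_body, keyf_body, place_body, collect_body, iseq_body, split_body, match_body,
     loop_body, phases_body, signs_body, build_body, load_body, drain_body]"

abbreviation "fval \<equiv> call_value demand_graph_program"
abbreviation "ftime \<equiv> call_time demand_graph_program"
abbreviation "exec \<equiv> run demand_graph_program"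

lemma length_program: "length demand_graph_program = 19"
  by (simp add: demand_graph_program_def)

lemma fval_eq: "f < 19 \<Longrightarrow> fval f u = map_option fst (exec [u] (demand_graph_program ! f))"
  by (simp add: call_value_def length_program)

lemma ftime_eq: "ftime f u = snd (the (exec [u] (demand_graph_program ! f)))"
  by (simp add: call_time_def)

lemma body_nth:
  "demand_graph_program ! 0 = main_body"
  "demand_graph_program ! RANK = rank_body"
  "demand_graph_program ! MK = mk_body"
  "demand_graph_program ! LESS = less_body"
  "demand_graph_program ! MERGE = merge_body"
  "demand_graph_program ! INSERT = insert_body"
  "demand_graph_program ! LATER = later_body"
  "demand_graph_program ! KEYF = keyf_body"
  "demand_graph_program ! PLACE = place_body"
  "demand_graph_program ! COLLECT = collect_body"
  "demand_graph_program ! ISEQ = iseq_body"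
  "demand_graph_program ! SPLIT = split_body"
  "demand_graph_program ! MATCH = match_body"
  "demand_graph_program ! LOOP = loop_body"
  "demand_graph_program ! PHASES = phases_body"
  "demand_graph_program ! SIGNS = signs_body"
  "demand_graph_program ! BUILD = build_body"
  "demand_graph_program ! LOAD = load_body"
  "demand_graph_program ! DRAIN = drain_body"
  by (simp_all add: demand_graph_program_def)

text \<open>Only upper bounds on the cost are tracked. They compose through calls and leave room for
  generous round constants, which are not meant to be sharp.\<close>

definition returns :: "nat \<Rightarrow> val \<Rightarrow> val \<Rightarrow> nat \<Rightarrow> bool" where
  "returns f u v c \<longleftrightarrow> fval f u = Some v \<and> ftime f u \<le> c"

lemma returns_iff: "f < 19 \<Longrightarrow> returns f u v c \<longleftrightarrow>
    (case exec [u] (demand_graph_program ! f) of None \<Rightarrow> False | Some (w, t) \<Rightarrow> w = v \<and> t \<le> c)"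
  by (auto simp: returns_def fval_eq ftime_eq split: option.splits)

lemma returns_value: "returns f u v c \<Longrightarrow> fval f u = Some v"
  by (simp add: returns_def)

lemma returns_time: "returns f u v c \<Longrightarrow> ftime f u \<le> c"
  by (simp add: returns_def)

section \<open>Leftist heaps\<close>

datatype endpoint = Inner nat | Term nat

type_synonym edge = "endpoint \<times> endpoint \<times> real"

fun endpoint_val :: "endpoint \<Rightarrow> val" where
  "endpoint_val (Inner n) = NatV n"
| "endpoint_val (Term n) = PairV (NatV n) (NatV 0)"

fun edge_val :: "edge \<Rightarrow> val" where
  "edge_val (a, b, x) = PairV (endpoint_val a) (PairV (endpoint_val b) (RealV x))"

fun half_val :: "endpoint \<times> real \<Rightarrow> val" where
  "half_val (a, x) = PairV (endpoint_val a) (RealV x)"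

fun key_val :: "nat \<times> nat \<Rightarrow> val" where
  "key_val (i, j) = PairV (NatV i) (NatV j)"

abbreviation edges_val :: "edge list \<Rightarrow> val" where
  "edges_val es \<equiv> list_val (map edge_val es)"

abbreviation halves_val :: "(endpoint \<times> real) list \<Rightarrow> val" where
  "halves_val hs \<equiv> list_val (map half_val hs)"

type_synonym entry = "(nat \<times> nat) \<times> edge"

datatype heap = Leaf | Node nat entry heap heap

fun heap_val :: "heap \<Rightarrow> val" where
  "heap_val Leaf = NatV 0"
| "heap_val (Node n e l r) = PairV (NatV n)
     (PairV (PairV (key_val (fst e)) (edge_val (snd e))) (PairV (heap_val l) (heap_val r)))"

fun rank :: "heap \<Rightarrow> nat" where
  "rank Leaf = 0"
| "rank (Node n e l r) = n"

definition mk :: "entry \<Rightarrow> heap \<Rightarrow> heap \<Rightarrow> heap" where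
  "mk e l r = (if rank l < rank r then Node (rank l + 1) e r l else Node (rank r + 1) e l r)"

fun merge :: "heap \<Rightarrow> heap \<Rightarrow> heap" where
  "merge Leaf h = h"
| "merge h Leaf = h"
| "merge (Node n e l r) (Node n' e' l' r') =
    (if fst e' < fst e then mk e' l' (merge (Node n e l r) r')
     else mk e l (merge r (Node n' e' l' r')))"

lemma merge_Leaf [simp]: "merge h Leaf = h"
  by (cases h) auto

fun heap_mset :: "heap \<Rightarrow> entry multiset" where
  "heap_mset Leaf = {#}"
| "heap_mset (Node n e l r) = add_mset e (heap_mset l + heap_mset r)"

fun heap_ok :: "heap \<Rightarrow> bool" where
  "heap_ok Leaf \<longleftrightarrow> True"
| "heap_ok (Node n e l r) \<longleftrightarrow> heap_ok l \<and> heap_ok r \<and> rank r \<le> rank l \<and> n = rank r + 1 \<and>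
     (\<forall>e'\<in>#heap_mset l + heap_mset r. fst e \<le> fst e')"

lemma heap_mset_mk [simp]: "heap_mset (mk e l r) = add_mset e (heap_mset l + heap_mset r)"
  by (simp add: mk_def)

lemma heap_ok_mk [simp]:
  "heap_ok (mk e l r) \<longleftrightarrow> heap_ok l \<and> heap_ok r \<and> (\<forall>e'\<in>#heap_mset l + heap_mset r. fst e \<le> fst e')"
  by (auto simp: mk_def)

lemma heap_mset_merge [simp]: "heap_mset (merge h h') = heap_mset h + heap_mset h'"
  by (induction h h' rule: merge.induct) (auto simp: ac_simps)

lemma heap_ok_merge: "heap_ok h \<Longrightarrow> heap_ok h' \<Longrightarrow> heap_ok (merge h h')"
  by (induction h h' rule: merge.induct) force+

text \<open>The stored rank is the length of the right spine, and the left child has at least the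
  rank of the right one: both subtrees hold at least \<open>2 ^ rank r - 1\<close> entries.\<close>

lemma two_power_rank_le: "heap_ok h \<Longrightarrow> 2 ^ rank h \<le> size (heap_mset h) + 1"
proof (induction h)
  case (Node n e l r)
  then have "(2::nat) ^ rank r \<le> 2 ^ rank l"
    by (intro power_increasing) auto
  moreover have "2 ^ rank l \<le> size (heap_mset l) + 1" "2 ^ rank r \<le> size (heap_mset r) + 1"
    using Node by auto
  moreover have "(2::nat) ^ rank (Node n e l r) = 2 * 2 ^ rank r"
    using Node by simp
  ultimately show ?case
    unfolding heap_mset.simps size_add_mset size_union by linarith
qed auto

lemma rank_le:
  assumes "heap_ok h" "size (heap_mset h) < 2 ^ L"
  shows "rank h \<le> L"
proof -
  have "(2::nat) ^ rank h \<le> 2 ^ L"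
    using two_power_rank_le[OF assms(1)] assms(2) by linarith
  then show ?thesis by simp
qed

section \<open>Values and running times of the functions\<close>

lemma returns_RANK: "returns RANK (heap_val h) (NatV (rank h)) 5"
  by (cases h) (auto simp: returns_iff body_nth rank_body_def run_simps)

lemma returns_MK:
  "returns MK (PairV (PairV (key_val (fst e)) (edge_val (snd e))) (PairV (heap_val l) (heap_val r)))
     (heap_val (mk e l r)) 60"
  using returns_time[OF returns_RANK[of l]] returns_time[OF returns_RANK[of r]]
  by (simp add: returns_iff body_nth mk_body_def run_simps Let_def
      returns_RANK[THEN returns_value] mk_def)

lemma returns_LESS:
  "returns LESS (PairV (key_val k) (key_val k')) (NatV (if k < k' then 1 else 0)) 60"
  by (cases k; cases k') (auto simp: returns_iff body_nth less_body_def run_simps Let_def)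

text \<open>Each recursive call moves one step down one of the two right spines, so the sum of the
  ranks pays for it.\<close>

lemma returns_MERGE:
  "returns MERGE (PairV (heap_val h) (heap_val h')) (heap_val (merge h h')) 
    (200 * (rank h + rank h') + 20)"
  if "heap_ok h" "heap_ok h'"
  using that
proof (induction h h' rule: merge.induct)
  case (3 n e l r n' e' l' r')
  let ?h = "Node n e l r" and ?h' = "Node n' e' l' r'"
  note less = returns_LESS[of "fst e'" "fst e"]
  show ?case
  proof (cases "fst e' < fst e")
    case True
    have IH: "returns MERGE (PairV (heap_val ?h) (heap_val r')) (heap_val (merge ?h r'))
      (200 * (rank ?h + rank r') + 20)"
      using 3 True by auto
    note mk = returns_MK[of e' l' "merge ?h r'"]
    show ?thesis
      using True IH[unfolded returns_def] mk[unfolded returns_def] less[unfolded returns_def]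
        "3.prems"
      by (simp add: returns_iff body_nth merge_body_def run_simps Let_def)
  next
    case False
    have IH: "returns MERGE (PairV (heap_val r) (heap_val ?h')) (heap_val (merge r ?h'))
      (200 * (rank r + rank ?h') + 20)"
      using 3 False by auto
    note mk = returns_MK[of e l "merge r ?h'"]
    show ?thesis
      using False IH[unfolded returns_def] mk[unfolded returns_def] less[unfolded returns_def]
        "3.prems"
      by (simp add: returns_iff body_nth merge_body_def run_simps Let_def)
  qed
qed (simp_all add: returns_iff body_nth merge_body_def run_simps Let_def)


lemma returns_INSERT:
  assumes "heap_ok h" "rank h \<le> L"
  shows "returns INSERT (PairV (key_val k) (PairV (edge_val e) (heap_val h)))
    (heap_val (merge (Node 1 (k, e) Leaf Leaf) h)) (200 * L + 300)"
  using returns_MERGE[of "Node 1 (k, e) Leaf Leaf" h, unfolded returns_def] assms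
  by (simp add: returns_iff body_nth insert_body_def run_simps)

section \<open>Keys of the scan\<close>

fun later :: "nat \<Rightarrow> endpoint \<Rightarrow> bool" where
  "later lo (Inner n) \<longleftrightarrow> lo \<le> n"
| "later lo (Term n) \<longleftrightarrow> False"

fun endpoint_index :: "endpoint \<Rightarrow> nat" where
  "endpoint_index (Inner n) = n"
| "endpoint_index (Term n) = n"

text \<open>The key is the end at which the scan meets the arc next. \<open>None\<close> marks an
  arc with no end ahead; it is put aside until the next phase.\<close>

fun next_key :: "nat \<Rightarrow> edge \<Rightarrow> nat option" where
  "next_key lo (a, b, x) =
    (if later lo a
     then Some (if later lo b \<and> endpoint_index b < endpoint_index a
       then endpoint_index b else endpoint_index a)
     else if later lo b then Some (endpoint_index b) else None)"

text \<open>The second component of a scan key is always \<open>0\<close>. It makes the key a pair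
  of naturals, like the pairs of ends by which the result is sorted, so that one heap serves both
  purposes.\<close>

fun opt_key_val :: "nat option \<Rightarrow> val" where
  "opt_key_val None = NatV 0"
| "opt_key_val (Some k) = key_val (k, 0)"

lemma returns_LATER:
  "returns LATER (PairV (NatV lo) (endpoint_val a)) (NatV (if later lo a then 1 else 0)) 20"
  by (cases a) (auto simp: returns_iff body_nth later_body_def run_simps)

lemma returns_KEYF:
  "returns KEYF (PairV (NatV lo) (edge_val e)) (opt_key_val (next_key lo e)) 100"
proof (cases e)
  case (fields a b x)
  show ?thesis
    using returns_LATER[of lo a, unfolded returns_def] returns_LATER[of lo b, unfolded returns_def]
    unfolding fields
    by (cases a; cases b) (auto simp: returns_iff body_nth keyf_body_def run_simps Let_def)
qed

fun place :: "nat \<Rightarrow> edge list \<Rightarrow> heap \<Rightarrow> edge list \<Rightarrow> heap \<times> edge list" where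
  "place lo [] h q = (h, q)"
| "place lo (e # es) h q = (case next_key lo e of
      Some k \<Rightarrow> place lo es (merge (Node 1 ((k, 0), e) Leaf Leaf) h) q
    | None \<Rightarrow> place lo es h (e # q))"

lemma returns_PLACE:
  assumes "heap_ok h" "size (heap_mset h) + length es < 2 ^ L"
  shows "returns PLACE (PairV (NatV lo) (PairV (edges_val es) (PairV (heap_val h) (edges_val q))))
    (PairV (heap_val (fst (place lo es h q))) (edges_val (snd (place lo es h q))))
    ((200 * L + 500) * length es + 20)"
  using assms
proof (induction es arbitrary: h q)
  case Nil
  then show ?case by (simp add: returns_iff body_nth place_body_def run_simps Let_def)
next
  case (Cons e es)
  note kf = returns_KEYF[of lo e, unfolded returns_def]
  show ?case
  proof (cases "next_key lo e")
    case None
    have IH: "returns PLACE (PairV (NatV lo) (PairV (edges_val es) (PairV (heap_val h) (edges_val (e # q)))))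
      (PairV (heap_val (fst (place lo es h (e # q)))) (edges_val (snd (place lo es h (e # q)))))
      ((200 * L + 500) * length es + 20)"
      using Cons.prems by (intro Cons.IH) auto
    show ?thesis
      using None kf IH[unfolded returns_def]
      by (simp add: returns_iff body_nth place_body_def run_simps Let_def)
  next
    case (Some k)
    let ?h = "merge (Node 1 ((k, 0), e) Leaf Leaf) h"
    have IH: "returns PLACE (PairV (NatV lo) (PairV (edges_val es) (PairV (heap_val ?h) (edges_val q))))
      (PairV (heap_val (fst (place lo es ?h q))) (edges_val (snd (place lo es ?h q))))
      ((200 * L + 500) * length es + 20)"
      using Cons by (intro Cons.IH heap_ok_merge) auto
    have "rank h \<le> L" using Cons.prems by (intro rank_le) auto
    then have ins: "returns INSERT (PairV (key_val (k, 0)) (PairV (edge_val e) (heap_val h)))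
      (heap_val ?h) (200 * L + 300)"
      using Cons.prems by (intro returns_INSERT) auto
    show ?thesis
      using Some kf ins[unfolded returns_def] IH[unfolded returns_def]
      by (simp add: returns_iff body_nth place_body_def run_simps Let_def del: merge.simps)
  qed
qed

text \<open>The counter \<open>d\<close> is started at \<open>D + 1\<close>: truncated subtraction makes it \<open>0\<close> exactly if more
  than \<open>D\<close> edges have been collected.\<close>

function collect :: "nat \<Rightarrow> heap \<Rightarrow> edge list \<Rightarrow> nat \<Rightarrow> edge list \<times> nat \<times> heap" where
  "collect v Leaf acc d = (acc, d, Leaf)"
| "collect v (Node n e l r) acc d = (if v < fst (fst e) then (acc, d, Node n e l r)
     else collect v (merge l r) (snd e # acc) (d - 1))"
  by pat_completeness auto
termination
  by (relation "measure (\<lambda>(v, h, acc, d). size (heap_mset h))") auto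

fun collect_val :: "edge list \<times> nat \<times> heap \<Rightarrow> val" where
  "collect_val (acc, d, h) = PairV (edges_val acc) (PairV (NatV d) (heap_val h))"

text \<open>Removing the root merges two heaps of rank at most \<open>L\<close>, whence
  \<open>400 * L\<close> per collected arc. The second conjunct makes the truncated difference of
  lengths an exact count during the induction.\<close>

lemma returns_COLLECT:
  assumes "heap_ok h" "size (heap_mset h) < 2 ^ L"
  shows "returns COLLECT
    (PairV (NatV v) (PairV (heap_val h) (PairV (edges_val acc) (NatV d))))
    (collect_val (collect v h acc d))
    ((400 * L + 200) * (length (fst (collect v h acc d)) - length acc) + 100) \<and>
    length acc \<le> length (fst (collect v h acc d))"
  using assms
proof (induction v h acc d rule: collect.induct)
  case (1 v acc d)
  then show ?case by (simp add: returns_iff body_nth collect_body_def run_simps Let_def)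
next
  case (2 v n e l r acc d)
  show ?case
  proof (cases "v < fst (fst e)")
    case True
    then show ?thesis
      by (cases "fst e") (auto simp: returns_iff body_nth collect_body_def run_simps Let_def)
  next
    case False
    let ?c = "collect v (merge l r) (snd e # acc) (d - 1)"
    have IH: "returns COLLECT
      (PairV (NatV v) (PairV (heap_val (merge l r)) (PairV (edges_val (snd e # acc)) (NatV (d - 1)))))
      (collect_val ?c)
      ((400 * L + 200) * (length (fst ?c) - length (snd e # acc)) + 100)"
      and le: "length (snd e # acc) \<le> length (fst ?c)"
      using 2 False by (auto simp: heap_ok_merge)
    have "rank l \<le> L" "rank r \<le> L"
      using 2 by (auto intro!: rank_le)
    then have m: "returns MERGE (PairV (heap_val l) (heap_val r)) (heap_val (merge l r)) (400 * L + 20)"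
      using returns_MERGE[of l r] "2.prems" by (auto simp: returns_def)
    obtain t where t: "length (fst ?c) = length acc + 1 + t"
      using le by (metis Suc_eq_plus1 le_iff_add length_Cons)
    obtain i j ed where e: "e = ((i, j), ed)" by (metis surj_pair)
    show ?thesis
      using False IH[unfolded returns_def] m[unfolded returns_def] t unfolding e
      by (simp add: returns_iff body_nth collect_body_def run_simps Let_def algebra_simps)
  qed
qed

lemma returns_ISEQ:
  "returns ISEQ (PairV (endpoint_val a) (NatV v)) (NatV (if a = Inner v then 1 else 0)) 40"
  by (cases a) (auto simp: returns_iff body_nth iseq_body_def run_simps Let_def)

text \<open>Only the far ends are kept: tails of arcs into \<open>v\<close> in \<open>is\<close>,
  heads of arcs out of \<open>v\<close> in \<open>os\<close>. A loop at \<open>v\<close> has no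
  effect on any divergence and is dropped.\<close>

fun split :: "nat \<Rightarrow> edge list \<Rightarrow> (endpoint \<times> real) list \<Rightarrow> (endpoint \<times> real) list \<Rightarrow>
    (endpoint \<times> real) list \<times> (endpoint \<times> real) list" where
  "split v [] is os = (is, os)"
| "split v ((a, b, x) # es) is os =
    (if a = Inner v then if b = Inner v then split v es is os else split v es is ((b, x) # os)
     else split v es ((a, x) # is) os)"

lemma returns_SPLIT:
  "returns SPLIT (PairV (NatV v) (PairV (edges_val es) (PairV (halves_val is) (halves_val os))))
     (PairV (halves_val (fst (split v es is os))) (halves_val (snd (split v es is os))))
     (200 * length es + 40)"
proof (induction v es "is" os rule: split.induct)
  case (1 v "is" os)
  then show ?case by (simp add: returns_iff body_nth split_body_def run_simps Let_def)
next
  case (2 v a b x es "is" os)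
  show ?case
    using 2 returns_ISEQ[of a v, unfolded returns_def] returns_ISEQ[of b v, unfolded returns_def]
    by (cases "a = Inner v"; cases "b = Inner v")
      (simp_all add: returns_iff[of SPLIT] returns_def[of SPLIT "PairV _ (PairV (edges_val es) _)"]
        body_nth split_body_def run_simps Let_def)
qed

fun match :: "(endpoint \<times> real) list \<Rightarrow> (endpoint \<times> real) list \<Rightarrow> endpoint \<Rightarrow> edge list \<Rightarrow> edge list"
where
  "match ((a, x) # is) ((b, y) # os) t acc =
    (if x < y then match is ((b, y - x) # os) t ((a, b, x) # acc)
     else if y < x then match ((a, x - y) # is) os t ((a, b, y) # acc)
     else match is os t ((a, b, x) # acc))"
| "match ((a, x) # is) [] t acc = match is [] t ((a, t, x) # acc)"
| "match [] ((b, y) # os) t acc = match [] os t ((t, b, y) # acc)"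
| "match [] [] t acc = acc"

lemma returns_mono: "returns f u v c \<Longrightarrow> c \<le> c' \<Longrightarrow> returns f u v c'"
  by (simp add: returns_def)

lemma returns_MATCH:
  "returns MATCH (PairV (halves_val is) (PairV (halves_val os) (PairV (endpoint_val t) (edges_val acc))))
     (edges_val (match is os t acc)) (200 * (length is + length os) + 20)"
proof (induction "is" os t acc rule: match.induct)
  case (1 a x "is" b y os t acc)
  consider "x < y" | "y < x" | "x = y" by linarith
  then show ?case
  proof cases
    assume c: "x < y"
    show ?thesis
      using 1(1)[OF c, unfolded returns_def] c
      by (simp add: returns_iff body_nth match_body_def run_simps Let_def)
  next
    assume c: "y < x"
    show ?thesis
      using 1(2)[OF _ c, unfolded returns_def] c
      by (simp add: returns_iff body_nth match_body_def run_simps Let_def)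
  next
    assume c: "x = y"
    show ?thesis
      using 1(3)[unfolded returns_def] c
      by (simp add: returns_iff body_nth match_body_def run_simps Let_def)
  qed
next
  case (2 a x "is" t acc)
  show ?case
    using 2[unfolded returns_def]
    by (simp add: returns_iff body_nth match_body_def run_simps Let_def)
next
  case (3 b y os t acc)
  show ?case
    using 3[unfolded returns_def]
    by (simp add: returns_iff body_nth match_body_def run_simps Let_def)
next
  case (4 t acc)
  show ?case
    by (simp add: returns_iff body_nth match_body_def run_simps Let_def)
qed

text \<open>Each recursive call creates one arc and uses up at least one half-arc. This is why
  bypassing never increases the number of arcs.\<close>

lemma length_match: "length (match is os t acc) \<le> length is + length os + length acc"
  by (induction "is" os t acc rule: match.induct) auto

fun signs :: "(nat \<times> real) list \<Rightarrow> (endpoint \<times> real) list \<Rightarrow> (endpoint \<times> real) list \<Rightarrow>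
    (endpoint \<times> real) list \<times> (endpoint \<times> real) list" where
  "signs [] is os = (is, os)"
| "signs ((i, y) # ys) is os =
    (if 0 < y then signs ys ((Inner i, y) # is) os
     else if y < 0 then signs ys is ((Inner i, - y) # os) else signs ys is os)"

fun entry_val :: "nat \<times> real \<Rightarrow> val" where
  "entry_val (i, y) = PairV (NatV i) (RealV y)"

lemma returns_SIGNS:
  "returns SIGNS (PairV (list_val (map entry_val ys)) (PairV (halves_val is) (halves_val os)))
     (PairV (halves_val (fst (signs ys is os))) (halves_val (snd (signs ys is os))))
     (200 * length ys + 20)"
proof (induction ys "is" os rule: signs.induct)
  case (1 "is" os)
  show ?case
    by (simp add: returns_iff body_nth signs_body_def run_simps Let_def)
next
  case (2 i y ys "is" os)
  consider "0 < y" | "y < 0" | "y = 0" by linarith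
  then show ?case
  proof cases
    assume c: "0 < y"
    show ?thesis
      using 2(1)[OF c, unfolded returns_def] c
      by (simp add: returns_iff body_nth signs_body_def run_simps Let_def)
  next
    assume c: "y < 0"
    show ?thesis
      using 2(2)[OF _ c, unfolded returns_def] c
      by (simp add: returns_iff body_nth signs_body_def run_simps Let_def)
  next
    assume c: "y = 0"
    show ?thesis
      using 2(3)[unfolded returns_def] c
      by (simp add: returns_iff body_nth signs_body_def run_simps Let_def)
  qed
qed

lemma length_signs:
  "length (fst (signs ys is os)) + length (snd (signs ys is os)) \<le> length ys + length is + length os"
  by (induction ys "is" os rule: signs.induct) auto

fun build :: "(real \<times> (nat \<times> real) list) list \<Rightarrow> edge list \<Rightarrow> edge list" where
  "build [] acc = acc"
| "build ((w, ys) # hs) acc =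
    build hs (match (fst (signs ys [] [])) (snd (signs ys [] [])) (Term 0) acc)"

fun hedge_val :: "real \<times> (nat \<times> real) list \<Rightarrow> val" where
  "hedge_val (w, ys) = PairV (RealV w) (list_val (map entry_val ys))"

lemma returns_BUILD:
  "returns BUILD (PairV (list_val (map hedge_val hs)) (edges_val acc)) (edges_val (build hs acc))
    (400 * (\<Sum>h\<leftarrow>hs. length (snd h)) + 200 * length hs + 20)"
proof (induction hs acc rule: build.induct)
  case (1 acc)
  show ?case
    by (simp add: returns_iff body_nth build_body_def run_simps Let_def)
next
  case (2 w ys hs acc)
  show ?case
    using 2[unfolded returns_def] returns_SIGNS[of ys "[]" "[]", unfolded returns_def]
     returns_MATCH[of "fst (signs ys [] [])" "snd (signs ys [] [])" "Term 0" acc, unfolded returns_def]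
     length_signs[of ys "[]" "[]"]
    by (simp add: returns_iff body_nth build_body_def run_simps Let_def)
qed

lemma length_build: "length (build hs acc) \<le> (\<Sum>h\<leftarrow>hs. length (snd h)) + length acc"
proof (induction hs acc rule: build.induct)
  case (2 w ys hs acc)
  then show ?case
    using length_match[of "fst (signs ys [] [])" "snd (signs ys [] [])" "Term 0" acc]
      length_signs[of ys "[]" "[]"]
    by simp
qed simp

lemma returns_LOOP_Leaf:
  "returns LOOP (PairV (heap_val Leaf) (PairV (edges_val q) (NatV D))) (edges_val q) 20"
  by (simp add: returns_iff body_nth loop_body_def run_simps)

lemma length_split:
  "length (fst (split v es is os)) + length (snd (split v es is os)) \<le> length es + length is + length os"
  by (induction v es "is" os rule: split.induct) auto

definition bypass :: "nat \<Rightarrow> edge list \<Rightarrow> edge list" where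
  "bypass v es = match (fst (split v es [] [])) (snd (split v es [] [])) (Term v) []"

lemma length_bypass: "length (bypass v es) \<le> length es"
  using length_match[of "fst (split v es [] [])" "snd (split v es [] [])" "Term v" "[]"]
    length_split[of v es "[]" "[]"]
  by (simp add: bypass_def)

text \<open>All costs of a round except a constant are charged to the collected arcs:
  \<open>400 * L\<close> for taking an arc out of the heap and \<open>200 * L\<close> for putting
  one back, of which there are no more than were collected; splitting and matching are
  linear.\<close>

lemma returns_LOOP_Node:
  assumes h: "h = Node n ((v, j), e) l r"
    and ok: "heap_ok h" "size (heap_mset h) < 2 ^ L"
    and c: "collect v h [] (D + 1) = (acc, d, h')"
    and es: "es = (if d = 0 then acc else bypass v acc)"
    and p: "place (v + 1) es h' q = (h2, q2)"
    and h': "heap_ok h'" "size (heap_mset h') + length es < 2 ^ L"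
    and rec: "returns LOOP (PairV (heap_val h2) (PairV (edges_val q2) (NatV D))) w t"
  shows "returns LOOP (PairV (heap_val h) (PairV (edges_val q) (NatV D))) w
    ((600 * L + 1200) * length acc + 400 + t)"
proof -
  have col: "returns COLLECT (PairV (NatV v) (PairV (heap_val h) (PairV (NatV 0) (NatV (D + 1)))))
     (PairV (edges_val acc) (PairV (NatV d) (heap_val h'))) ((400 * L + 200) * length acc + 100)"
    using returns_COLLECT[OF ok, of v "[]" "D + 1"] c by simp
  have pl: "returns PLACE (PairV (NatV (v + 1)) (PairV (edges_val es) (PairV (heap_val h') (edges_val q))))
     (PairV (heap_val h2) (edges_val q2)) ((200 * L + 500) * length es + 20)"
    using returns_PLACE[OF h', of "v + 1" q] p by simp
  have len: "length es \<le> length acc"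
    using length_bypass by (simp add: es)
  then have pl: "returns PLACE (PairV (NatV (v + 1)) (PairV (edges_val es) (PairV (heap_val h') (edges_val q))))
     (PairV (heap_val h2) (edges_val q2)) ((200 * L + 500) * length acc + 20)"
    by (intro returns_mono[OF pl]) simp
  show ?thesis
  proof (cases "d = 0")
    case True
    show ?thesis
      using col[unfolded returns_def h] pl[unfolded returns_def es] rec[unfolded returns_def] True
      unfolding h
      by (simp add: returns_iff body_nth loop_body_def run_simps algebra_simps)
  next
    case False
    let ?s = "split v acc [] []"
    have "returns MATCH (PairV (halves_val (fst ?s)) (PairV (halves_val (snd ?s))
        (PairV (endpoint_val (Term v)) (edges_val [])))) (edges_val es) (200 * length acc + 20)"
      using returns_MATCH[of "fst ?s" "snd ?s" "Term v" "[]"] length_split[of v acc "[]" "[]"] False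
      by (auto simp: es bypass_def returns_def)
    then show ?thesis
      using returns_SPLIT[of v acc "[]" "[]", unfolded returns_def]
        col[unfolded returns_def h] pl[unfolded returns_def] rec[unfolded returns_def] False
      unfolding h
      by (simp add: returns_def[of MATCH] returns_iff body_nth loop_body_def run_simps algebra_simps)
  qed
qed

lemma returns_PHASES_Leaf:
  assumes "length es < 2 ^ L" "fst (place 0 es Leaf []) = Leaf"
  shows "returns PHASES (PairV (edges_val es) (NatV D)) (edges_val es) ((200 * L + 500) * length es + 100)"
  using returns_PLACE[of Leaf es L 0 "[]", unfolded returns_def] assms
  by (simp add: returns_iff body_nth phases_body_def run_simps)

lemma returns_PHASES_Node:
  assumes "length es < 2 ^ L" "place 0 es Leaf [] = (h, q)" "h \<noteq> Leaf"
    and loop: "returns LOOP (PairV (heap_val h) (PairV (edges_val q) (NatV D))) (edges_val es') t"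
    and rec: "returns PHASES (PairV (edges_val es') (NatV (D + D))) w t'"
  shows "returns PHASES (PairV (edges_val es) (NatV D)) w
    ((200 * L + 500) * length es + 100 + t + t')"
  using returns_PLACE[of Leaf es L 0 "[]", unfolded returns_def] assms(1-3)
    loop[unfolded returns_def] rec[unfolded returns_def]
  by (cases h) (simp_all add: returns_iff body_nth phases_body_def run_simps)

section \<open>Sorting the arcs and the whole program\<close>

fun load :: "edge list \<Rightarrow> heap \<Rightarrow> heap" where
  "load [] h = h"
| "load ((a, b, x) # es) h =
    load es (merge (Node 1 ((endpoint_index a, endpoint_index b), a, b, x) Leaf Leaf) h)"

text \<open>The third premise excludes a run-time type error: the program reads the vertex number
  out of the pair that encodes a terminal copy, and an \<open>Inner\<close> endpoint is not a
  pair.\<close>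

lemma returns_LOAD:
  assumes "heap_ok h" "size (heap_mset h) + length es < 2 ^ L"
    and "\<forall>(a, b, x)\<in>set es. (\<exists>i. a = Term i) \<and> (\<exists>j. b = Term j)"
  shows "returns LOAD (PairV (edges_val es) (heap_val h)) (heap_val (load es h))
    ((200 * L + 400) * length es + 20)"
  using assms
proof (induction es h rule: load.induct)
  case (1 h)
  show ?case by (simp add: returns_iff body_nth load_body_def run_simps Let_def)
next
  case (2 a b x es h)
  then obtain i j where ab: "a = Term i" "b = Term j" by auto
  let ?h = "merge (Node 1 ((endpoint_index a, endpoint_index b), a, b, x) Leaf Leaf) h"
  have IH: "returns LOAD (PairV (edges_val es) (heap_val ?h)) (heap_val (load es ?h))
    ((200 * L + 400) * length es + 20)"
    using "2.prems" by (intro "2.IH" heap_ok_merge) auto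
  have "rank h \<le> L" using "2.prems" by (intro rank_le) auto
  then have ins: "returns INSERT (PairV (key_val (i, j)) (PairV (edge_val (a, b, x)) (heap_val h)))
    (heap_val ?h) (200 * L + 300)"
    using "2.prems" ab returns_INSERT[of h L "(i, j)" "(a, b, x)"] by simp
  show ?case
    using ab ins[unfolded returns_def] IH[unfolded returns_def]
    by (simp add: returns_iff body_nth load_body_def run_simps Let_def algebra_simps del: merge.simps)
qed

text \<open>Keys leave the heap in nondecreasing order, so an arc can only be parallel to the one
  output last. Failing \<open>(i, j) < k\<close> then means \<open>k = (i, j)\<close>.\<close>

fun add_out :: "nat \<times> nat \<Rightarrow> real \<Rightarrow> (nat \<times> nat \<times> real) list \<Rightarrow> (nat \<times> nat \<times> real) list" where
  "add_out k x [] = [(fst k, snd k, x)]"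
| "add_out k x ((i, j, w) # acc) =
    (if (i, j) < k then (fst k, snd k, x) # (i, j, w) # acc else (fst k, snd k, w + x) # acc)"

function drain :: "heap \<Rightarrow> (nat \<times> nat \<times> real) list \<Rightarrow> (nat \<times> nat \<times> real) list" where
  "drain Leaf acc = acc"
| "drain (Node n (k, (a, b, x)) l r) acc = drain (merge l r) (add_out k x acc)"
  by pat_completeness auto
termination
  by (relation "measure (\<lambda>(h, acc). size (heap_mset h))") auto

fun out_val :: "nat \<times> nat \<times> real \<Rightarrow> val" where
  "out_val (i, j, w) = PairV (NatV i) (PairV (NatV j) (RealV w))"

lemma returns_DRAIN:
  assumes "heap_ok h" "size (heap_mset h) < 2 ^ L"
  shows "returns DRAIN (PairV (heap_val h) (list_val (map out_val acc)))
    (list_val (map out_val (drain h acc))) ((400 * L + 300) * size (heap_mset h) + 20)"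
  using assms
proof (induction h acc rule: drain.induct)
  case (1 acc)
  show ?case by (simp add: returns_iff body_nth drain_body_def run_simps Let_def)
next
  case (2 n k a b x l r acc)
  have "rank l \<le> L" "rank r \<le> L"
    using 2 by (auto intro!: rank_le)
  then have m: "returns MERGE (PairV (heap_val l) (heap_val r)) (heap_val (merge l r)) (400 * L + 20)"
    using returns_MERGE[of l r] "2.prems" by (auto simp: returns_def)
  have IH: "returns DRAIN (PairV (heap_val (merge l r)) (list_val (map out_val (add_out k x acc))))
    (list_val (map out_val (drain (merge l r) (add_out k x acc))))
    ((400 * L + 300) * size (heap_mset (merge l r)) + 20)"
    using 2 by (auto simp: heap_ok_merge)
  show ?case
  proof (cases acc)
    case Nil
    then show ?thesis
      using IH[unfolded returns_def] m[unfolded returns_def]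
      by (cases k) (simp add: returns_iff body_nth drain_body_def run_simps Let_def algebra_simps)
  next
    case (Cons o' acc')
    obtain i j w where o': "o' = (i, j, w)" by (metis surj_pair)
    obtain ki kj where k: "k = (ki, kj)" by (metis surj_pair)
    note less = returns_LESS[of "(i, j)" "k"]
    show ?thesis
    proof (cases "(i, j) < k")
      case True
      then show ?thesis
        using IH[unfolded returns_def] m[unfolded returns_def] less[unfolded returns_def] Cons o' k
        by (simp add: returns_iff body_nth drain_body_def run_simps Let_def algebra_simps
            del: less_prod_simp)
    next
      case False
      then show ?thesis
        using IH[unfolded returns_def] m[unfolded returns_def] less[unfolded returns_def] Cons o' k
        by (simp add: returns_iff body_nth drain_body_def run_simps Let_def algebra_simps
            del: less_prod_simp)
    qed
  qed
qed

lemma computes_demand_graph: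
  assumes build: "returns BUILD (PairV hv (edges_val [])) (edges_val es) t1"
    and phases: "returns PHASES (PairV (edges_val es) (NatV 1)) (edges_val es') t2"
    and load: "returns LOAD (PairV (edges_val es') (heap_val Leaf)) (heap_val h) t3"
    and drain: "returns DRAIN (PairV (heap_val h) (list_val (map out_val []))) w t4"
  shows "\<exists>t \<le> t1 + t2 + t3 + t4 + 50. computes demand_graph_program (PairV nv (PairV wv hv)) w t"
proof -
  obtain t where "exec [PairV nv (PairV wv hv)] (CallE 0 (VarE 0)) = Some (w, t)"
    and "t \<le> t1 + t2 + t3 + t4 + 50"
    using assms[unfolded returns_def]
    by (simp add: run_simps fval_eq[of 0] ftime_eq[of 0] body_nth main_body_def)
  then show ?thesis
    unfolding computes_def run_eq_Some by blast
qed

section \<open>Routing arcs by flows\<close>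

text \<open>Hyperedges are nodes of their own: the flow \<open>Y\<close> is regarded as a flow on the bipartite
  incidence graph, so that hyperedges and vertices can be bypassed in the same way.\<close>

datatype node = V nat | HE "nat set"

type_synonym arc = "node \<times> node \<times> real"

definition nodes :: "hypergraph \<Rightarrow> node set" where
  "nodes G = range V \<union> HE ` hedges G"

text \<open>A positive \<open>Z h i\<close> runs from the vertex \<open>i\<close> into the hyperedge
  \<open>h\<close>, hence the opposite sign at hyperedges.\<close>

definition divergence :: "hypergraph \<Rightarrow> hflow \<Rightarrow> node \<Rightarrow> real" where
  "divergence G Z n = (case n of V v \<Rightarrow> dem G Z v | HE h \<Rightarrow> - (\<Sum>i\<in>h. Z h i))"

lemma divergence_add:
  "divergence G (\<lambda>h i. Z h i + Z' h i) n = divergence G Z n + divergence G Z' n"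
  by (simp add: divergence_def dem_def sum.distrib split: node.split)

lemma divergence_scale: "divergence G (\<lambda>h i. c * Z h i) n = c * divergence G Z n"
  by (simp add: divergence_def dem_def sum_distrib_left split: node.split)

fun carries :: "hypergraph \<Rightarrow> arc \<times> hflow \<Rightarrow> bool" where
  "carries G ((a, b, x), Z) \<longleftrightarrow>
    (\<forall>n\<in>nodes G. divergence G Z n = x * (of_bool (n = a) - of_bool (n = b)))"

text \<open>The bound is kept coordinate by coordinate against \<open>\<bar>Y h i\<bar>\<close> and
  not in the dual norms. In this form it can be maintained locally by the triangle inequality, and
  monotonicity of the norms turns it into the congestion bound at the very end.\<close>

definition routes :: "hypergraph \<Rightarrow> hflow \<Rightarrow> arc multiset \<Rightarrow> bool" where
  "routes G Y M \<longleftrightarrow> (\<exists>P. image_mset fst P = M \<and> (\<forall>p\<in>#P. carries G p) \<and>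
     (\<forall>h\<in>hedges G. \<forall>i\<in>h. (\<Sum>p\<in>#P. \<bar>snd p h i\<bar>) \<le> \<bar>Y h i\<bar>))"

definition net :: "arc multiset \<Rightarrow> node \<Rightarrow> real" where
  "net M n = (\<Sum>(a, b, x)\<in>#M. x * (of_bool (n = a) - of_bool (n = b)))"

lemma net_add_mset [simp]:
  "net (add_mset (a, b, x) M) n = x * (of_bool (n = a) - of_bool (n = b)) + net M n"
  by (simp add: net_def)

lemma net_union [simp]: "net (M + N) n = net M n + net N n"
  by (simp add: net_def)

text \<open>Preserving the net weight of every vertex is what yields the degrees at the end, when
  all arcs at a vertex point the same way.\<close>

definition routed :: "hypergraph \<Rightarrow> hflow \<Rightarrow> arc multiset \<Rightarrow> bool" where
  "routed G Y M \<longleftrightarrow> routes G Y M \<and> (\<forall>v. net M (V v) = dem G Y v)"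

text \<open>Modifications are local: the arcs \<open>A\<close> are exchanged for \<open>B\<close>,
  whose flows need only fit below those of \<open>A\<close>, while the other arcs keep their
  flows.\<close>

lemma routes_replace:
  assumes "routes G Y (A + M)"
    and repl: "\<And>P. image_mset fst P = A \<Longrightarrow> \<forall>p\<in>#P. carries G p \<Longrightarrow>
      \<exists>Q. image_mset fst Q = B \<and> (\<forall>q\<in>#Q. carries G q) \<and>
        (\<forall>h i. (\<Sum>q\<in>#Q. \<bar>snd q h i\<bar>) \<le> (\<Sum>p\<in>#P. \<bar>snd p h i\<bar>))"
  shows "routes G Y (B + M)"
proof -
  obtain P where P: "image_mset fst P = A + M" "\<forall>p\<in>#P. carries G p"
    "\<forall>h\<in>hedges G. \<forall>i\<in>h. (\<Sum>p\<in>#P. \<bar>snd p h i\<bar>) \<le> \<bar>Y h i\<bar>"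
    using assms(1) by (auto simp: routes_def)
  from P(1) obtain PA PM where PAM: "P = PA + PM" "image_mset fst PA = A" "image_mset fst PM = M"
    by (metis image_mset_eq_plusD)
  then obtain Q where Q: "image_mset fst Q = B" "\<forall>q\<in>#Q. carries G q"
    "\<And>h i. (\<Sum>q\<in>#Q. \<bar>snd q h i\<bar>) \<le> (\<Sum>p\<in>#PA. \<bar>snd p h i\<bar>)"
    using repl[of PA] P(2) by auto
  have "(\<Sum>p\<in>#Q + PM. \<bar>snd p h i\<bar>) \<le> \<bar>Y h i\<bar>" if "h \<in> hedges G" "i \<in> h" for h i
    using P(3) that Q(3)[of h i] PAM(1) by fastforce
  then show ?thesis
    unfolding routes_def using Q PAM P(2) by (intro exI[of _ "Q + PM"]) auto
qed

lemma image_fst_add_msetD: "image_mset fst P = add_mset e M \<Longrightarrow>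
    \<exists>Z P'. P = add_mset (e, Z) P' \<and> image_mset fst P' = M"
  using msed_map_invR[of fst P e M] by (metis prod.collapse)

lemma image_fst_singletonD: "image_mset fst P = {#e#} \<Longrightarrow> \<exists>Z. P = {#(e, Z)#}"
  using image_fst_add_msetD[of P e "{#}"] by auto

lemma image_fst_pairD: "image_mset fst P = {#e, f#} \<Longrightarrow> \<exists>Z Z'. P = {#(e, Z), (f, Z')#}"
  by (drule image_fst_add_msetD) (auto dest!: image_fst_singletonD)

lemma routed_split:
  assumes "routed G Y (add_mset (a, b, x + y) M)" "0 < x" "0 < y"
  shows "routed G Y (add_mset (a, b, x) (add_mset (a, b, y) M))"
proof -
  have "routes G Y ({#(a, b, x), (a, b, y)#} + M)"
  proof (rule routes_replace)
    show "routes G Y ({#(a, b, x + y)#} + M)" using assms by (simp add: routed_def)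
  next
    fix P assume P: "image_mset fst P = {#(a, b, x + y)#}" "\<forall>p\<in>#P. carries G p"
    then obtain Z where Z: "P = {#((a, b, x + y), Z)#}" using image_fst_singletonD[OF P(1)] by auto
    \<comment> \<open>The flow is shared out in proportion to the two amounts. Both coefficients are
      positive and add up to 1, so the absolute values add up exactly.\<close>
    define c d where "c = x / (x + y)" and "d = y / (x + y)"
    have cd: "c * (x + y) = x" "d * (x + y) = y" "c + d = 1" "0 < c" "0 < d"
      using assms(2,3) by (simp_all add: c_def d_def flip: add_divide_distrib)
    define Q where "Q = {#((a, b, x), \<lambda>h i. c * Z h i), ((a, b, y), \<lambda>h i. d * Z h i)#}"
    have "\<forall>q\<in>#Q. carries G q"
      using P(2) by (simp add: Q_def Z divergence_scale cd flip: mult.assoc)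
    moreover have "(\<Sum>q\<in>#Q. \<bar>snd q h i\<bar>) \<le> (\<Sum>p\<in>#P. \<bar>snd p h i\<bar>)" for h i
    proof -
      have "(\<Sum>q\<in>#Q. \<bar>snd q h i\<bar>) = (c + d) * \<bar>Z h i\<bar>"
        using cd(4,5) unfolding Q_def by (simp add: abs_mult distrib_right)
      then show ?thesis by (simp add: Z cd)
    qed
    ultimately show "\<exists>Q. image_mset fst Q = {#(a, b, x), (a, b, y)#} \<and> (\<forall>q\<in>#Q. carries G q) \<and>
        (\<forall>h i. (\<Sum>q\<in>#Q. \<bar>snd q h i\<bar>) \<le> (\<Sum>p\<in>#P. \<bar>snd p h i\<bar>))"
      by (intro exI[of _ Q]) (auto simp: Q_def)
  qed
  moreover have "net (add_mset (a, b, x) (add_mset (a, b, y) M)) = net (add_mset (a, b, x + y) M)"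
    by (rule ext) (simp add: distrib_right)
  ultimately show ?thesis using assms(1) by (simp add: routed_def del: net_add_mset)
qed

lemma routed_join:
  assumes "routed G Y (add_mset (a, b, x) (add_mset (a, b, y) M))"
  shows "routed G Y (add_mset (a, b, x + y) M)"
proof -
  have "routes G Y ({#(a, b, x + y)#} + M)"
  proof (rule routes_replace)
    show "routes G Y ({#(a, b, x), (a, b, y)#} + M)" using assms by (simp add: routed_def)
  next
    fix P assume P: "image_mset fst P = {#(a, b, x), (a, b, y)#}" "\<forall>p\<in>#P. carries G p"
    then obtain Z Z' where Z: "P = {#((a, b, x), Z), ((a, b, y), Z')#}" using image_fst_pairD[OF P(1)] by auto
    show "\<exists>Q. image_mset fst Q = {#(a, b, x + y)#} \<and> (\<forall>q\<in>#Q. carries G q) \<and>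
        (\<forall>h i. (\<Sum>q\<in>#Q. \<bar>snd q h i\<bar>) \<le> (\<Sum>p\<in>#P. \<bar>snd p h i\<bar>))"
      using P(2) by (intro exI[of _ "{#((a, b, x + y), \<lambda>h i. Z h i + Z' h i)#}"])
        (simp add: Z divergence_add distrib_right abs_triangle_ineq)
  qed
  moreover have "net (add_mset (a, b, x) (add_mset (a, b, y) M)) = net (add_mset (a, b, x + y) M)"
    by (rule ext) (simp add: distrib_right)
  ultimately show ?thesis using assms(1) by (simp add: routed_def del: net_add_mset)
qed

text \<open>At \<open>u\<close> the two divergences cancel, so the sum of the two flows carries the
  combined arc, and the triangle inequality bounds its absolute values.\<close>

lemma routed_bypass:
  assumes "routed G Y (add_mset (a, u, x) (add_mset (u, b, x) M))"
  shows "routed G Y (add_mset (a, b, x) M)"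
proof -
  have "routes G Y ({#(a, b, x)#} + M)"
  proof (rule routes_replace)
    show "routes G Y ({#(a, u, x), (u, b, x)#} + M)" using assms by (simp add: routed_def)
  next
    fix P assume P: "image_mset fst P = {#(a, u, x), (u, b, x)#}" "\<forall>p\<in>#P. carries G p"
    then obtain Z Z' where Z: "P = {#((a, u, x), Z), ((u, b, x), Z')#}" using image_fst_pairD[OF P(1)] by auto
    show "\<exists>Q. image_mset fst Q = {#(a, b, x)#} \<and> (\<forall>q\<in>#Q. carries G q) \<and>
        (\<forall>h i. (\<Sum>q\<in>#Q. \<bar>snd q h i\<bar>) \<le> (\<Sum>p\<in>#P. \<bar>snd p h i\<bar>))"
      using P(2) by (intro exI[of _ "{#((a, b, x), \<lambda>h i. Z h i + Z' h i)#}"])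
        (simp add: Z divergence_add abs_triangle_ineq add_diff_eq flip: distrib_left)
  qed
  moreover have "net (add_mset (a, u, x) (add_mset (u, b, x) M)) = net (add_mset (a, b, x) M)"
    by (rule ext) (simp add: algebra_simps)
  ultimately show ?thesis using assms(1) by (simp add: routed_def del: net_add_mset)
qed

lemma routed_drop_loop:
  assumes "routed G Y (add_mset (a, a, x) M)"
  shows "routed G Y M"
proof -
  have "routes G Y ({#} + M)"
  proof (rule routes_replace)
    show "routes G Y ({#(a, a, x)#} + M)" using assms by (simp add: routed_def)
  next
    fix P :: "(arc \<times> hflow) multiset"
    have "0 \<le> (\<Sum>p\<in>#P. \<bar>snd p h i\<bar>)" for h i
      by (induction P) auto
    then     show "\<exists>Q. image_mset fst Q = {#} \<and> (\<forall>q\<in>#Q. carries G q) \<and>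
        (\<forall>h i. (\<Sum>q\<in>#Q. \<bar>snd q h i\<bar>) \<le> (\<Sum>p\<in>#P. \<bar>snd p h i\<bar>))"
      by (intro exI[of _ "{#}"]) auto
  qed
  then show ?thesis using assms(1) by (simp add: routed_def)
qed

section \<open>The north-west corner rule at one node\<close>

fun arc_of :: "(endpoint \<Rightarrow> node) \<Rightarrow> edge \<Rightarrow> arc" where
  "arc_of \<alpha> (a, b, x) = (\<alpha> a, \<alpha> b, x)"

abbreviation into :: "endpoint \<Rightarrow> (endpoint \<times> real) list \<Rightarrow> edge multiset" where
  "into t is \<equiv> mset (map (\<lambda>(a, x). (a, t, x)) is)"

abbreviation out_of :: "endpoint \<Rightarrow> (endpoint \<times> real) list \<Rightarrow> edge multiset" where
  "out_of t os \<equiv> mset (map (\<lambda>(b, y). (t, b, y)) os)"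

text \<open>Of the two front arcs the larger is split at the amount of the smaller, and the equal
  pieces bypass \<open>t\<close>. The meaning \<open>\<alpha>\<close> of the labels stays open
  because the rule serves both hyperedges and vertices.\<close>

lemma routed_match:
  assumes "routed G Y (image_mset (arc_of \<alpha>) (into t is + out_of t os + mset acc) + M)"
    and "\<forall>(a, x)\<in>set is. 0 < x" "\<forall>(b, y)\<in>set os. 0 < y"
  shows "routed G Y (image_mset (arc_of \<alpha>) (mset (match is os t acc)) + M)"
  using assms
proof (induction "is" os t acc rule: match.induct)
  case (1 a x "is" b y os t acc)
  define N where "N = image_mset (arc_of \<alpha>) (into t is + out_of t os + mset acc) + M"
  have prem: "routed G Y (add_mset (\<alpha> a, \<alpha> t, x) (add_mset (\<alpha> t, \<alpha> b, y) N))"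
    using "1.prems"(1) by (simp add: N_def ac_simps)
  consider "x < y" | "y < x" | "x = y" by linarith
  then show ?case
  proof cases
    assume c: "x < y"
    have "routed G Y (add_mset (\<alpha> t, \<alpha> b, x) (add_mset (\<alpha> t, \<alpha> b, y - x) (add_mset (\<alpha> a, \<alpha> t, x) N)))"
      using prem c "1.prems" by (intro routed_split) (auto simp: add_mset_commute)
    then have "routed G Y (add_mset (\<alpha> a, \<alpha> t, x) (add_mset (\<alpha> t, \<alpha> b, x) (add_mset (\<alpha> t, \<alpha> b, y - x) N)))"
      by (simp add: add_mset_commute)
    from routed_bypass[OF this] have "routed G Y (image_mset (arc_of \<alpha>)
        (into t is + out_of t ((b, y - x) # os) + mset ((a, b, x) # acc)) + M)"
      by (simp add: N_def ac_simps add_mset_commute)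
    with c "1.prems" show ?thesis
      using "1.IH"(1) by simp
  next
    assume c: "y < x"
    have "routed G Y (add_mset (\<alpha> a, \<alpha> t, y) (add_mset (\<alpha> a, \<alpha> t, x - y) (add_mset (\<alpha> t, \<alpha> b, y) N)))"
      using prem c "1.prems" by (intro routed_split) (auto simp: add_mset_commute)
    then have "routed G Y (add_mset (\<alpha> a, \<alpha> t, y) (add_mset (\<alpha> t, \<alpha> b, y) (add_mset (\<alpha> a, \<alpha> t, x - y) N)))"
      by (simp add: add_mset_commute)
    from routed_bypass[OF this] have "routed G Y (image_mset (arc_of \<alpha>)
        (into t ((a, x - y) # is) + out_of t os + mset ((a, b, y) # acc)) + M)"
      by (simp add: N_def ac_simps add_mset_commute)
    with c "1.prems" show ?thesis
      using "1.IH"(2) by simp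
  next
    assume c: "x = y"
    from prem c have "routed G Y (add_mset (\<alpha> a, \<alpha> b, x) N)"
      using routed_bypass by blast
    then have "routed G Y (image_mset (arc_of \<alpha>)
        (into t is + out_of t os + mset ((a, b, x) # acc)) + M)"
      by (simp add: N_def ac_simps add_mset_commute)
    with c "1.prems" show ?thesis
      using "1.IH"(3) by simp
  qed
qed (auto simp: ac_simps)

abbreviation srcs :: "edge multiset \<Rightarrow> endpoint multiset" where
  "srcs M \<equiv> image_mset fst M"

abbreviation dsts :: "edge multiset \<Rightarrow> endpoint multiset" where
  "dsts M \<equiv> image_mset (\<lambda>e. fst (snd e)) M"

lemma match_positive:
  assumes "\<forall>(a, x)\<in>set is. 0 < x" "\<forall>(b, y)\<in>set os. 0 < y" "\<forall>(a, b, x)\<in>set acc. 0 < x"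
  shows "\<forall>(a, b, x)\<in>set (match is os t acc). 0 < x"
  using assms by (induction "is" os t acc rule: match.induct) auto

lemma srcs_match_subset:
  "set_mset (srcs (mset (match is os t acc))) \<subseteq> insert t (fst ` set is \<union> fst ` set acc)"
  by (induction "is" os t acc rule: match.induct) auto

lemma dsts_match_subset:
  "set_mset (dsts (mset (match is os t acc))) \<subseteq> insert t (fst ` set os \<union> (\<lambda>e. fst (snd e)) ` set acc)"
  by (induction "is" os t acc rule: match.induct) auto

text \<open>The far end of each half-arc survives in at least one new arc. Together with the
  analogue for heads, this is why a bypass lowers the degree of no other vertex.\<close>

lemma count_srcs_match:
  "count (mset (map fst is)) e + count (srcs (mset acc)) e \<le> count (srcs (mset (match is os t acc))) e"
proof (induction "is" os t acc rule: match.induct)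
  case (1 a x "is" b y os t acc)
  consider "x < y" | "y < x" | "x = y" by linarith
  then show ?case
  proof cases
    assume c: "x < y"
    then show ?thesis using 1(1)[OF c] by (simp split: if_splits)
  next
    assume c: "y < x"
    then show ?thesis using 1(2)[OF _ c] by (simp split: if_splits)
  next
    assume c: "x = y"
    then show ?thesis using 1(3) by (simp split: if_splits)
  qed
next
  case (2 a x "is" t acc)
  then show ?case by (simp split: if_splits)
next
  case (3 b y os t acc)
  then show ?case by (simp split: if_splits)
next
  case (4 t acc)
  then show ?case by simp
qed

lemma count_dsts_match:
  "count (mset (map fst os)) e + count (dsts (mset acc)) e \<le> count (dsts (mset (match is os t acc))) e"
proof (induction "is" os t acc rule: match.induct)
  case (1 a x "is" b y os t acc)
  consider "x < y" | "y < x" | "x = y" by linarith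
  then show ?case
  proof cases
    assume c: "x < y"
    then show ?thesis using 1(1)[OF c] by (simp split: if_splits)
  next
    assume c: "y < x"
    then show ?thesis using 1(2)[OF _ c] by (simp split: if_splits)
  next
    assume c: "x = y"
    then show ?thesis using 1(3) by (simp split: if_splits)
  qed
next
  case (2 a x "is" t acc)
  then show ?case by (simp split: if_splits)
next
  case (3 b y os t acc)
  then show ?case by (simp split: if_splits)
next
  case (4 t acc)
  then show ?case by simp
qed

lemma match_Nil_right: "match is [] t acc = rev (map (\<lambda>(a, x). (a, t, x)) is) @ acc"
  by (induction "is" arbitrary: acc) auto

lemma match_Nil_left: "match [] os t acc = rev (map (\<lambda>(b, y). (t, b, y)) os) @ acc"
  by (induction os arbitrary: acc) auto

text \<open>The label \<open>t\<close> comes into use only when one list is exhausted, and from then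
  on it always stands at the same end of the new arcs.\<close>

lemma match_leftover_one_sided:
  assumes "t \<notin> fst ` set is" "t \<notin> fst ` set os"
    and "t \<notin># srcs (mset acc)" "t \<notin># dsts (mset acc)"
  shows "t \<notin># srcs (mset (match is os t acc)) \<or> t \<notin># dsts (mset (match is os t acc))"
  using assms
proof (induction "is" os t acc rule: match.induct)
  case (2 a x "is" t acc)
  then show ?case
    by (auto simp: match_Nil_right image_iff)
next
  case (3 b y os t acc)
  then show ?case
    by (auto simp: match_Nil_left image_iff)
qed auto

text \<open>Every round takes the same amount from both sums, so they stay equal. A leftover
  half-arc would be a positive sum facing an empty one.\<close>

lemma match_balanced:
  assumes "(\<Sum>(a, x)\<leftarrow>is. x) = (\<Sum>(b, y)\<leftarrow>os. y)"
    and "\<forall>(a, x)\<in>set is. 0 < x" "\<forall>(b, y)\<in>set os. 0 < y"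
    and "t \<notin> fst ` set is" "t \<notin> fst ` set os"
    and "t \<notin># srcs (mset acc)" "t \<notin># dsts (mset acc)"
  shows "t \<notin># srcs (mset (match is os t acc)) \<and> t \<notin># dsts (mset (match is os t acc))"
  using assms
proof (induction "is" os t acc rule: match.induct)
  case (1 a x "is" b y os t acc)
  consider "x < y" | "y < x" | "x = y" by linarith
  then show ?case
  proof cases
    assume c: "x < y"
    then show ?thesis using 1(1)[OF c] "1.prems" by simp
  next
    assume c: "y < x"
    then show ?thesis using 1(2)[OF _ c] "1.prems" by simp
  next
    assume c: "x = y"
    then show ?thesis using 1(3) "1.prems" by simp
  qed
next
  case (2 a x "is" t acc)
  have "0 \<le> (\<Sum>(a, x)\<leftarrow>is. x)" using "2.prems"(2) by (intro sum_list_nonneg) auto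
  then show ?case using "2.prems"(1,2) by simp
next
  case (3 b y os t acc)
  have "0 \<le> (\<Sum>(b, y)\<leftarrow>os. y)" using "3.prems"(3) by (intro sum_list_nonneg) auto
  then show ?case using "3.prems"(1,3) by simp
next
  case (4 t acc)
  then show ?case by simp
qed

section \<open>Bypassing the hyperedges\<close>

fun incidence_arc :: "hflow \<Rightarrow> nat set \<times> nat \<Rightarrow> arc" where
  "incidence_arc Y (h, i) = (if 0 < Y h i then (V i, HE h, Y h i) else (HE h, V i, - Y h i))"

fun incidence_flow :: "hflow \<Rightarrow> nat set \<times> nat \<Rightarrow> hflow" where
  "incidence_flow Y (h, i) = (\<lambda>h' i'. if h' = h \<and> i' = i then Y h i else 0)"

definition incidences :: "hypergraph \<Rightarrow> hflow \<Rightarrow> (nat set \<times> nat) set" where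
  "incidences G Y = {(h, i). h \<in> hedges G \<and> i \<in> h \<and> Y h i \<noteq> 0}"

lemma carries_incidence:
  assumes "finite (hedges G)" "\<forall>h\<in>hedges G. finite h" "h \<in> hedges G" "i \<in> h"
  shows "carries G (incidence_arc Y (h, i), incidence_flow Y (h, i))"
proof -
  have "divergence G (incidence_flow Y (h, i)) (V v) = (if v = i then Y h i else 0)" for v
  proof -
    have "dem G (incidence_flow Y (h, i)) v =
        (\<Sum>h'\<in>{h' \<in> hedges G. v \<in> h'}. if h' = h then if v = i then Y h i else 0 else 0)"
      unfolding dem_def by (intro sum.cong) auto
    then show ?thesis using assms by (simp add: divergence_def)
  qed
  moreover have "divergence G (incidence_flow Y (h, i)) (HE h') = (if h' = h then - Y h i else 0)"
    if "h' \<in> hedges G" for h'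
  proof -
    have "(\<Sum>i'\<in>h'. incidence_flow Y (h, i) h' i') = (\<Sum>i'\<in>h'. if i' = i then if h' = h then Y h i else 0 else 0)"
      by (intro sum.cong) auto
    then show ?thesis using assms that by (auto simp: divergence_def)
  qed
  ultimately show ?thesis by (auto simp: nodes_def simp del: incidence_flow.simps split: if_splits)
qed

lemma finite_incidences:
  assumes "finite (hedges G)" "\<forall>h\<in>hedges G. finite h"
  shows "finite (incidences G Y)"
  by (rule finite_subset[of _ "Sigma (hedges G) (\<lambda>h. h)"]) (use assms in \<open>auto simp: incidences_def\<close>)

text \<open>The starting point: each nonzero \<open>Y h i\<close> becomes an arc between
  \<open>i\<close> and \<open>h\<close>, carried by that single coordinate of
  \<open>Y\<close>.\<close>

lemma routed_incidences:
  assumes fin: "finite (hedges G)" "\<forall>h\<in>hedges G. finite h"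
  shows "routed G Y (image_mset (incidence_arc Y) (mset_set (incidences G Y)))"
proof -
  note finS = finite_incidences[OF fin, of Y]
  let ?P = "image_mset (\<lambda>q. (incidence_arc Y q, incidence_flow Y q)) (mset_set (incidences G Y))"
  have "carries G p" if "p \<in># ?P" for p
    using that finS carries_incidence[OF fin] by (auto simp: incidences_def)
  moreover have "(\<Sum>p\<in>#?P. \<bar>snd p h i\<bar>) \<le> \<bar>Y h i\<bar>" for h i
  proof -
    have "(\<Sum>p\<in>#?P. \<bar>snd p h i\<bar>) = (\<Sum>q\<in>incidences G Y. \<bar>incidence_flow Y q h i\<bar>)"
      by (simp add: multiset.map_comp comp_def sum_unfold_sum_mset)
    also have "\<dots> = (\<Sum>q\<in>incidences G Y. if q = (h, i) then \<bar>Y h i\<bar> else 0)"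
      by (intro sum.cong) (auto split: if_splits)
    also have "\<dots> \<le> \<bar>Y h i\<bar>" using finS by simp
    finally show ?thesis .
  qed
  ultimately have "routes G Y (image_mset (incidence_arc Y) (mset_set (incidences G Y)))"
    unfolding routes_def by (intro exI[of _ ?P]) (auto simp: multiset.map_comp comp_def)
  moreover have "net (image_mset (incidence_arc Y) (mset_set (incidences G Y))) (V v) = dem G Y v" for v
  proof -
    have "net (image_mset (incidence_arc Y) (mset_set (incidences G Y))) (V v) =
      (\<Sum>q\<in>incidences G Y. case incidence_arc Y q of
         (a, b, x) \<Rightarrow> x * (of_bool (V v = a) - of_bool (V v = b)))"
      by (simp add: net_def multiset.map_comp comp_def sum_unfold_sum_mset)
    also have "\<dots> = (\<Sum>q\<in>incidences G Y. if snd q = v then Y (fst q) v else 0)"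
      by (intro sum.cong) auto
    also have "\<dots> = (\<Sum>q\<in>{q \<in> incidences G Y. snd q = v}. Y (fst q) v)"
      using finS by (simp add: sum.inter_filter)
    also have "\<dots> = (\<Sum>h\<in>{h \<in> hedges G. v \<in> h \<and> Y h v \<noteq> 0}. Y h v)"
      by (rule sum.reindex_bij_witness[of _ "\<lambda>h. (h, v)" fst]) (auto simp: incidences_def)
    also have "\<dots> = dem G Y v"
      unfolding dem_def using fin by (intro sum.mono_neutral_left) auto
    finally show ?thesis .
  qed
  ultimately show ?thesis by (simp add: routed_def)
qed

text \<open>\<open>Inner i\<close> and \<open>Term i\<close> are the same vertex of the graph and
  differ only in their state in the algorithm.\<close>

definition vertex :: "endpoint \<Rightarrow> node" where
  "vertex a = V (endpoint_index a)"

text \<open>While the hyperedge \<open>h\<close> is bypassed, \<open>Term 0\<close> stands for \<open>h\<close> itself; it does not survive because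
  \<open>h\<close> is balanced.\<close>

definition in_hedge :: "nat set \<Rightarrow> endpoint \<Rightarrow> node" where
  "in_hedge h a = (case a of Inner i \<Rightarrow> V i | Term _ \<Rightarrow> HE h)"

lemma arcs_signs:
  "image_mset (arc_of (in_hedge h))
     (into (Term 0) (fst (signs (map (\<lambda>i. (i, Y h i)) xs) is os)) +
      out_of (Term 0) (snd (signs (map (\<lambda>i. (i, Y h i)) xs) is os))) =
   image_mset (incidence_arc Y) (filter_mset (\<lambda>(h, i). Y h i \<noteq> 0) (mset (map (Pair h) xs))) +
   image_mset (arc_of (in_hedge h)) (into (Term 0) is + out_of (Term 0) os)"
  by (induction xs arbitrary: "is" os) (auto simp: in_hedge_def)

lemma sum_signs:
  "(\<Sum>(a, x)\<leftarrow>fst (signs ys is os). x) - (\<Sum>(b, y)\<leftarrow>snd (signs ys is os). y) =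
   (\<Sum>(i, y)\<leftarrow>ys. y) + (\<Sum>(a, x)\<leftarrow>is. x) - (\<Sum>(b, y)\<leftarrow>os. y)"
  by (induction ys "is" os rule: signs.induct) auto

lemma signs_positive:
  assumes "\<forall>(a, x)\<in>set is. 0 < x" "\<forall>(b, y)\<in>set os. 0 < y"
  shows "(\<forall>(a, x)\<in>set (fst (signs ys is os)). 0 < x) \<and> (\<forall>(b, y)\<in>set (snd (signs ys is os)). 0 < y)"
  using assms by (induction ys "is" os rule: signs.induct) auto

lemma signs_Inner:
  assumes "fst ` set is \<subseteq> range Inner" "fst ` set os \<subseteq> range Inner"
  shows "fst ` set (fst (signs ys is os)) \<subseteq> range Inner \<and> fst ` set (snd (signs ys is os)) \<subseteq> range Inner"
  using assms by (induction ys "is" os rule: signs.induct) auto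

definition inner_edges :: "edge list \<Rightarrow> bool" where
  "inner_edges es \<longleftrightarrow> (\<forall>(a, b, x)\<in>set es. a \<in> range Inner \<and> b \<in> range Inner \<and> 0 < x)"

lemma arc_of_in_hedge:
  "inner_edges es \<Longrightarrow> image_mset (arc_of (in_hedge h)) (mset es) = image_mset (arc_of vertex) (mset es)"
  by (intro image_mset_cong) (auto simp: inner_edges_def in_hedge_def vertex_def)

text \<open>Hyperedges not yet treated remain as incidence arcs beside the arcs between vertices in
  \<open>acc\<close>. As \<open>Term 0\<close> is reused for each hyperedge in turn, the induction
  has to show that it never survives.\<close>

lemma routed_build:
  assumes "routed G Y (image_mset (incidence_arc Y) (filter_mset (\<lambda>(h, i). Y h i \<noteq> 0)
      (mset (concat (map (\<lambda>xs. map (Pair (set xs)) xs) hs)))) + image_mset (arc_of vertex) (mset acc))"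
    and "inner_edges acc"
    and "\<forall>xs\<in>set hs. (\<Sum>i\<leftarrow>xs. Y (set xs) i) = 0"
  shows "routed G Y (image_mset (arc_of vertex)
      (mset (build (map (\<lambda>xs. (w xs, map (\<lambda>i. (i, Y (set xs) i)) xs)) hs) acc))) \<and>
    inner_edges (build (map (\<lambda>xs. (w xs, map (\<lambda>i. (i, Y (set xs) i)) xs)) hs) acc)"
  using assms
proof (induction hs arbitrary: acc)
  case (Cons xs hs)
  define ins outs where "ins = fst (signs (map (\<lambda>i. (i, Y (set xs) i)) xs) [] [])"
    and "outs = snd (signs (map (\<lambda>i. (i, Y (set xs) i)) xs) [] [])"
  define acc' where "acc' = match ins outs (Term 0) acc"
  define R where "R = image_mset (incidence_arc Y) (filter_mset (\<lambda>(h, i). Y h i \<noteq> 0)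
      (mset (concat (map (\<lambda>xs. map (Pair (set xs)) xs) hs))))"
  have pos: "\<forall>(a, x)\<in>set ins. 0 < x" "\<forall>(b, y)\<in>set outs. 0 < y"
    unfolding ins_def outs_def using signs_positive[of "[]" "[]"] by auto
  have inner: "fst ` set ins \<subseteq> range Inner" "fst ` set outs \<subseteq> range Inner"
    unfolding ins_def outs_def using signs_Inner[of "[]" "[]"] by auto
  have acc: "Term 0 \<notin># srcs (mset acc)" "Term 0 \<notin># dsts (mset acc)"
    "fst ` set acc \<subseteq> range Inner" "(\<lambda>e. fst (snd e)) ` set acc \<subseteq> range Inner"
    "\<forall>(a, b, x)\<in>set acc. 0 < x"
    using Cons.prems(2) by (auto simp: inner_edges_def)
  have "(\<Sum>(a, x)\<leftarrow>ins. x) = (\<Sum>(b, y)\<leftarrow>outs. y)"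
    using sum_signs[of "map (\<lambda>i. (i, Y (set xs) i)) xs" "[]" "[]"] Cons.prems(3)
    by (simp add: ins_def outs_def comp_def)
  then have no_term: "Term 0 \<notin># srcs (mset acc') \<and> Term 0 \<notin># dsts (mset acc')"
    unfolding acc'_def using inner acc pos by (intro match_balanced) auto
  have "set_mset (srcs (mset acc')) \<subseteq> insert (Term 0) (range Inner)"
    using srcs_match_subset[of ins outs "Term 0" acc] inner(1) acc(3) unfolding acc'_def by blast
  moreover have "set_mset (dsts (mset acc')) \<subseteq> insert (Term 0) (range Inner)"
    using dsts_match_subset[of ins outs "Term 0" acc] inner(2) acc(4) unfolding acc'_def by blast
  moreover have "\<forall>(a, b, x)\<in>set acc'. 0 < x"
    unfolding acc'_def using pos acc by (intro match_positive) auto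
  moreover have "a \<in># srcs (mset acc')" "b \<in># dsts (mset acc')" if "(a, b, x) \<in> set acc'" for a b x
    using that by (metis (no_types, lifting) fst_conv snd_conv image_eqI set_image_mset set_mset_mset)+
  ultimately have inner': "inner_edges acc'"
    unfolding inner_edges_def using no_term by (clarify, intro conjI) blast+
  have "routed G Y (image_mset (arc_of (in_hedge (set xs)))
      (into (Term 0) ins + out_of (Term 0) outs + mset acc) + R)"
    using Cons.prems(1,2) arcs_signs[of "set xs" Y xs "[]" "[]"] arc_of_in_hedge[of acc "set xs"]
    by (simp add: ins_def outs_def R_def ac_simps)
  from routed_match[OF this pos] have "routed G Y (R + image_mset (arc_of vertex) (mset acc'))"
    using arc_of_in_hedge[OF inner'] by (simp add: acc'_def ac_simps)
  then show ?case
    using Cons.IH[of acc'] inner' Cons.prems(3) by (simp add: R_def acc'_def ins_def outs_def)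
qed simp

section \<open>Bypassing the vertices\<close>

abbreviation labels :: "edge multiset \<Rightarrow> endpoint multiset" where
  "labels M \<equiv> srcs M + dsts M"

definition one_sided :: "edge multiset \<Rightarrow> bool" where
  "one_sided M \<longleftrightarrow> (\<forall>n. (Term n \<notin># srcs M \<or> Term n \<notin># dsts M) \<and>
     (Term n \<in># labels M \<longrightarrow> Inner n \<notin># labels M))"

definition sound :: "hypergraph \<Rightarrow> hflow \<Rightarrow> edge multiset \<Rightarrow> bool" where
  "sound G Y M \<longleftrightarrow> routed G Y (image_mset (arc_of vertex) M) \<and>
     (\<forall>(a, b, x)\<in>#M. 0 < x) \<and> one_sided M"

lemma split_accumulates:
  assumes "\<forall>(a, b, x)\<in>set es. a = Inner v \<or> b = Inner v"
  shows "mset es + into (Inner v) is + out_of (Inner v) os =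
    filter_mset (\<lambda>(a, b, x). a = Inner v \<and> b = Inner v) (mset es) +
    into (Inner v) (fst (split v es is os)) + out_of (Inner v) (snd (split v es is os))"
  using assms by (induction v es "is" os rule: split.induct) auto

lemma split_avoids:
  assumes "Inner v \<notin> fst ` set is" "Inner v \<notin> fst ` set os"
  shows "Inner v \<notin> fst ` set (fst (split v es is os)) \<and> Inner v \<notin> fst ` set (snd (split v es is os))"
  using assms by (induction v es "is" os rule: split.induct) auto

lemma routed_drop_loops:
  assumes "routed G Y (image_mset (arc_of \<alpha>) L + M)" "\<forall>(a, b, x)\<in>#L. \<alpha> a = \<alpha> b"
  shows "routed G Y M"
  using assms
proof (induction L)
  case (add e L)
  obtain a b x where "e = (a, b, x)" by (metis surj_pair)
  then show ?case using add routed_drop_loop by fastforce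
qed simp

text \<open>The scan relies on all four conclusions: the invariant, the disappearance of
  \<open>v\<close>, degrees of skipped vertices that do not fall, and no inner vertex coming
  back.\<close>

lemma bypass_correct:
  assumes sound: "sound G Y (mset es + M)"
    and inc: "\<forall>(a, b, x)\<in>set es. a = Inner v \<or> b = Inner v"
    and out: "Inner v \<notin># labels M"
  shows "sound G Y (mset (bypass v es) + M)"
    and "Inner v \<notin># labels (mset (bypass v es))"
    and "\<And>w. w \<noteq> v \<Longrightarrow>
      count (labels (mset es)) (Inner w) \<le> count (labels (mset (bypass v es))) (Inner w)"
    and "set_mset (labels (mset (bypass v es))) \<subseteq> insert (Term v) (set_mset (labels (mset es)))"
proof -
  define ins outs where "ins = fst (split v es [] [])" and "outs = snd (split v es [] [])"
  define L where "L = filter_mset (\<lambda>(a, b, x). a = Inner v \<and> b = Inner v) (mset es)"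
  define B where "B = bypass v es"
  have B: "B = match ins outs (Term v) []"
    by (simp add: B_def bypass_def ins_def outs_def)
  have es: "mset es = L + into (Inner v) ins + out_of (Inner v) outs"
    using split_accumulates[OF inc, of "[]" "[]"] by (simp add: L_def ins_def outs_def)
  have avoid: "Inner v \<notin> fst ` set ins" "Inner v \<notin> fst ` set outs"
    using split_avoids[of v "[]" "[]" es] by (auto simp: ins_def outs_def)
  have pos_es: "\<forall>(a, b, x)\<in>#mset es. 0 < x" and pos_M: "\<forall>(a, b, x)\<in>#M. 0 < x"
    using sound by (auto simp: sound_def)
  have pos: "\<forall>(a, x)\<in>set ins. 0 < x" "\<forall>(b, y)\<in>set outs. 0 < y"
    using pos_es unfolding es by fastforce+
  have srcs_ins: "srcs (into (Inner v) ins) = mset (map fst ins)"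
    and dsts_outs: "dsts (out_of (Inner v) outs) = mset (map fst outs)"
    by (simp_all add: multiset.map_comp comp_def case_prod_beta)
  have ins_srcs: "fst ` set ins \<subseteq> set_mset (srcs (mset es))"
    unfolding es image_mset_union srcs_ins by auto
  have outs_dsts: "fst ` set outs \<subseteq> set_mset (dsts (mset es))"
    unfolding es image_mset_union dsts_outs by auto
  have srcs_B: "set_mset (srcs (mset B)) \<subseteq> insert (Term v) (fst ` set ins)"
    using srcs_match_subset[of ins outs "Term v" "[]"] by (auto simp: B)
  have dsts_B: "set_mset (dsts (mset B)) \<subseteq> insert (Term v) (fst ` set outs)"
    using dsts_match_subset[of ins outs "Term v" "[]"] by (auto simp: B)
  show no_v: "Inner v \<notin># labels (mset (bypass v es))"
    using srcs_B dsts_B avoid unfolding B_def[symmetric] by auto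
  show "set_mset (labels (mset (bypass v es))) \<subseteq> insert (Term v) (set_mset (labels (mset es)))"
    using srcs_B dsts_B ins_srcs outs_dsts unfolding B_def[symmetric] set_mset_union by blast
  show "count (labels (mset es)) (Inner w) \<le> count (labels (mset (bypass v es))) (Inner w)"
    if "w \<noteq> v" for w
  proof -
    have "count (srcs L) (Inner w) = 0" "count (dsts L) (Inner w) = 0"
      using that by (auto simp: L_def count_eq_zero_iff)
    moreover have "count (srcs (out_of (Inner v) outs)) (Inner w) = 0"
      "count (dsts (into (Inner v) ins)) (Inner w) = 0"
      using that by (auto simp: count_eq_zero_iff)
    ultimately have "count (labels (mset es)) (Inner w) =
        count (mset (map fst ins)) (Inner w) + count (mset (map fst outs)) (Inner w)"
      unfolding es image_mset_union count_union srcs_ins dsts_outs by simp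
    then show ?thesis
      using count_srcs_match[of ins "Inner w" "[]" outs "Term v"]
        count_dsts_match[of outs "Inner w" "[]" ins "Term v"]
      unfolding B_def[symmetric] B by simp
  qed
  \<comment> \<open>Under \<open>vertex\<close> the labels \<open>Inner v\<close> and
    \<open>Term v\<close> agree, so the half-arcs may be regarded as attached to
    \<open>Term v\<close> before they are matched.\<close>
  have "routed G Y (image_mset (arc_of vertex) L +
      (image_mset (arc_of vertex) (into (Term v) ins + out_of (Term v) outs + mset []) +
       image_mset (arc_of vertex) M))"
  proof -
    have "image_mset (arc_of vertex) (into (Inner v) ins) = image_mset (arc_of vertex) (into (Term v) ins)"
      "image_mset (arc_of vertex) (out_of (Inner v) outs) = image_mset (arc_of vertex) (out_of (Term v) outs)"
      by (auto simp: multiset.map_comp vertex_def intro!: image_mset_cong)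
    then show ?thesis using sound unfolding sound_def es by (simp add: ac_simps)
  qed
  then have "routed G Y (image_mset (arc_of vertex) (into (Term v) ins + out_of (Term v) outs + mset []) +
       image_mset (arc_of vertex) M)"
    by (rule routed_drop_loops) (auto simp: L_def)
  then have "routed G Y (image_mset (arc_of vertex) (mset B + M))"
    using routed_match pos unfolding B image_mset_union by blast
  moreover have "\<forall>(a, b, x)\<in>#mset B + M. 0 < x"
    using match_positive[OF pos, of "[]" "Term v"] pos_M by (auto simp: B)
  moreover have "one_sided (mset B + M)"
  \<comment> \<open>Without arcs at \<open>v\<close> nothing excludes that \<open>Term v\<close> is
    already in use, but then nothing is created either.\<close>
  proof (cases "es = []")
    case True
    then have "B = []" by (simp add: B ins_def outs_def)
    then show ?thesis using sound True by (simp add: sound_def)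
  next
    case False
    have one: "one_sided (mset es + M)" using sound by (simp add: sound_def)
    have "Inner v \<in># labels (mset es)"
      using False inc by (cases es) auto
    then have no_term: "Term v \<notin># labels (mset es + M)"
      using one unfolding one_sided_def by (metis image_mset_union union_iff)
    then have "Term v \<notin># srcs (mset B) \<or> Term v \<notin># dsts (mset B)"
      unfolding B using ins_srcs outs_dsts by (intro match_leftover_one_sided) auto
    then have "Term n \<notin># srcs (mset B + M) \<or> Term n \<notin># dsts (mset B + M)" for n
    proof (cases "n = v")
      case False
      then have "Term n \<noteq> Term v" by simp
      then show ?thesis
        using one srcs_B dsts_B ins_srcs outs_dsts
        unfolding one_sided_def image_mset_union set_mset_union by blast
    qed (use no_term in auto)
    moreover have "Inner n \<notin># labels (mset B + M)" if "Term n \<in># labels (mset B + M)" for n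
    proof (cases "n = v")
      case True
      then show ?thesis using no_v out by (auto simp: B_def)
    next
      case False
      then have "Term n \<in># labels (mset es + M)"
        using that srcs_B dsts_B ins_srcs outs_dsts unfolding image_mset_union set_mset_union by blast
      then have "Inner n \<notin># labels (mset es + M)"
        using one unfolding one_sided_def by blast
      then show ?thesis
        using srcs_B dsts_B ins_srcs outs_dsts unfolding image_mset_union set_mset_union by blast
    qed
    ultimately show ?thesis unfolding one_sided_def by blast
  qed
  ultimately show "sound G Y (mset (bypass v es) + M)"
    by (simp add: sound_def B_def)
qed

section \<open>The queue during a scan\<close>

lemma next_key_SomeD:
  assumes "next_key lo (a, b, x) = Some n"
  shows "lo \<le> n" "Inner n = a \<or> Inner n = b"
    and "Inner m = a \<or> Inner m = b \<Longrightarrow> lo \<le> m \<Longrightarrow> n \<le> m"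
  using assms by (cases a; cases b; auto split: if_splits)+

lemma next_key_eq_None:
  "next_key lo (a, b, x) = None \<longleftrightarrow> (\<forall>m. Inner m = a \<or> Inner m = b \<longrightarrow> m < lo)"
  by (cases a; cases b) auto

text \<open>Entries left in the heap keep valid keys when the scan advances, as long as it does not
  pass them; only collected arcs have to be queued anew.\<close>

lemma next_key_raise:
  "next_key lo e = Some n \<Longrightarrow> lo \<le> lo' \<Longrightarrow> lo' \<le> n \<Longrightarrow> next_key lo' e = Some n"
  by (cases e; cases "fst e"; cases "fst (snd e)") (auto split: if_splits)

lemma next_key_None_raise: "next_key lo e = None \<Longrightarrow> lo \<le> lo' \<Longrightarrow> next_key lo' e = None"
  by (cases e; cases "fst e"; cases "fst (snd e)") (auto split: if_splits)

lemma collect_correct: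
  assumes "heap_ok h" "collect v h acc d = (acc', d', h')"
  shows "heap_ok h' \<and>
    mset acc' = image_mset snd (filter_mset (\<lambda>e. fst (fst e) \<le> v) (heap_mset h)) + mset acc \<and>
    heap_mset h' = filter_mset (\<lambda>e. v < fst (fst e)) (heap_mset h) \<and>
    d' = d - (length acc' - length acc) \<and> length acc \<le> length acc'"
  using assms
proof (induction v h acc d arbitrary: acc' d' h' rule: collect.induct)
  case (2 v n e l r acc d)
  show ?case
  proof (cases "v < fst (fst e)")
    case True
    have "fst (fst e) \<le> fst (fst e')" if "e' \<in># heap_mset l + heap_mset r" for e'
    proof -
      have "fst e \<le> fst e'" using that "2.prems"(1) by auto
      then show ?thesis by (auto simp: less_eq_prod_def)
    qed
    then have "v < fst (fst e')" if "e' \<in># heap_mset (Node n e l r)" for e'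
      using that True by fastforce
    then have "filter_mset (\<lambda>e. fst (fst e) \<le> v) (heap_mset (Node n e l r)) =
        filter_mset (\<lambda>_. False) (heap_mset (Node n e l r))"
      "filter_mset (\<lambda>e. v < fst (fst e)) (heap_mset (Node n e l r)) =
        filter_mset (\<lambda>_. True) (heap_mset (Node n e l r))"
      by (intro filter_mset_cong; fastforce)+
    moreover have "h' = Node n e l r" "acc' = acc" "d' = d"
      using "2.prems"(2) True by auto
    ultimately show ?thesis using "2.prems"(1) by (simp del: heap_mset.simps)
  next
    case False
    have "heap_ok (merge l r)" using "2.prems"(1) by (simp add: heap_ok_merge)
    moreover have "collect v (merge l r) (snd e # acc) (d - 1) = (acc', d', h')"
      using "2.prems"(2) False by simp
    ultimately show ?thesis
      using "2.IH"[OF False, of acc' d' h'] False by auto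
  qed
qed simp

lemma place_correct:
  assumes "heap_ok h" "place lo es h q = (h', q')"
  shows "heap_ok h' \<and>
    image_mset snd (heap_mset h') + mset q' = image_mset snd (heap_mset h) + mset q + mset es \<and>
    (\<forall>(k, e)\<in>#heap_mset h'. (k, e) \<in># heap_mset h \<or> (\<exists>n. k = (n, 0) \<and> next_key lo e = Some n)) \<and>
    (\<forall>e\<in>set q'. e \<in> set q \<or> next_key lo e = None)"
  using assms
proof (induction lo es h q rule: place.induct)
  case (1 lo h q)
  then show ?case by (auto simp del: heap_mset.simps)
next
  case (2 lo e es h q)
  show ?case
  proof (cases "next_key lo e")
    case None
    then show ?thesis using 2(1)[OF None] "2.prems" by fastforce
  next
    case (Some k)
    have "heap_ok (merge (Node 1 ((k, 0), e) Leaf Leaf) h)"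
      using "2.prems" by (intro heap_ok_merge) auto
    moreover have "place lo es (merge (Node 1 ((k, 0), e) Leaf Leaf) h) q = (h', q')"
      using "2.prems" Some by simp
    ultimately show ?thesis using 2(2)[OF Some] Some by fastforce
  qed
qed

declare next_key.simps [simp del]

abbreviation stored :: "heap \<Rightarrow> edge list \<Rightarrow> edge multiset" where
  "stored h q \<equiv> image_mset snd (heap_mset h) + mset q"

definition queued :: "nat \<Rightarrow> heap \<Rightarrow> edge list \<Rightarrow> bool" where
  "queued lo h q \<longleftrightarrow> heap_ok h \<and>
     (\<forall>(k, e)\<in>#heap_mset h. \<exists>n. k = (n, 0) \<and> next_key lo e = Some n) \<and>
     (\<forall>e\<in>set q. next_key lo e = None)"

definition pending :: "nat \<Rightarrow> edge multiset \<Rightarrow> nat set" where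
  "pending lo M = {n. lo \<le> n \<and> Inner n \<in># labels M}"

text \<open>The potential of a phase: the number of arc ends that the scan has yet to meet. An arc
  that is never replaced is collected at most once per such end.\<close>

definition load_of :: "nat \<Rightarrow> edge multiset \<Rightarrow> nat" where
  "load_of lo M = size (filter_mset (later lo) (labels M))"

lemma load_of_union [simp]: "load_of lo (M + N) = load_of lo M + load_of lo N"
  by (simp add: load_of_def)

lemma load_of_le: "load_of lo M \<le> 2 * size M"
proof -
  have "load_of lo M \<le> size (labels M)"
    unfolding load_of_def by (rule size_filter_mset_lesseq)
  then show ?thesis by simp
qed

lemma later_antimono: "later lo' a \<Longrightarrow> lo \<le> lo' \<Longrightarrow> later lo a"
  by (cases a) auto

lemma load_of_antimono: "lo \<le> lo' \<Longrightarrow> load_of lo' M \<le> load_of lo M"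
proof -
  assume "lo \<le> lo'"
  then have "size (filter_mset (later lo') N) \<le> size (filter_mset (later lo) N)" for N
    by (induction N) (auto dest: later_antimono)
  then show ?thesis by (simp add: load_of_def add_mono)
qed

lemma finite_pending: "finite (pending lo M)"
  by (rule finite_subset[of _ "endpoint_index ` set_mset (labels M)"])
    (force simp: pending_def image_iff)+

lemma load_of_Suc:
  assumes "\<forall>(a, b, x)\<in>#M. a = Inner v \<or> b = Inner v" "lo \<le> v"
  shows "load_of (Suc v) M + size M \<le> load_of lo M"
  using assms(1)
proof (induction M)
  case empty
  then show ?case by (simp add: load_of_def)
next
  case (add e M)
  obtain a b x where e: "e = (a, b, x)" by (metis surj_pair)
  have "later (Suc v) a \<Longrightarrow> later lo a" "later (Suc v) b \<Longrightarrow> later lo b"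
    using assms(2) by (auto intro: later_antimono)
  then show ?case using add assms(2) by (auto simp: load_of_def e)
qed

lemma count_labels_ge_size:
  assumes "\<forall>(a, b, x)\<in>#M. a = Inner v \<or> b = Inner v"
  shows "size M \<le> count (labels M) (Inner v)"
  using assms
proof (induction M)
  case (add e M)
  then show ?case by (cases e) auto
qed simp

text \<open>The accounting of one round: \<open>x\<close> is the cost of the collected arcs,
  \<open>z\<close> and \<open>y\<close> are the scaled loads before and after, \<open>e\<close> is
  the largest raise by a bypass, and \<open>q\<close>, \<open>p\<close> count the pending vertices
  before and after.\<close>

lemma add_charge:
  fixes x y z e p q :: nat
  assumes "x + y \<le> z + e" "p < q"
  shows "x + 400 + (y + (e + 400) * p + 20) \<le> z + (e + 400) * q + 20"
proof -
  have "(e + 400) * (p + 1) \<le> (e + 400) * q"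
    using assms(2) by (intro mult_le_mono2) simp
  then have "(e + 400) * p + (e + 400) \<le> (e + 400) * q" by simp
  then show ?thesis using assms(1) by linarith
qed

text \<open>Skipping \<open>v\<close> is paid for by the load, which drops by the number of collected edges; bypassing \<open>v\<close>
  may raise the load by at most \<open>2 * D\<close> and is charged to \<open>v\<close> as a pending vertex.\<close>

lemma returns_LOOP:
  assumes "queued lo h q" "sound G Y (stored h q)" "size (stored h q) < 2 ^ L" "0 < D"
    and "\<forall>w<lo. count (labels (stored h q)) (Inner w) = 0 \<or> D < count (labels (stored h q)) (Inner w)"
  shows "\<exists>q'. returns LOOP (PairV (heap_val h) (PairV (edges_val q) (NatV D))) (edges_val q')
      ((600 * L + 1200) * load_of lo (stored h q) +
       ((600 * L + 1200) * (2 * D) + 400) * card (pending lo (stored h q)) + 20) \<and>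
    sound G Y (mset q') \<and> length q' \<le> size (stored h q) \<and>
    (\<forall>w. count (labels (mset q')) (Inner w) = 0 \<or> D < count (labels (mset q')) (Inner w))"
  using assms
\<comment> \<open>A round adds no pending vertex and passes \<open>v\<close> for good, so their
  number decreases.\<close>
proof (induction "card (pending lo (stored h q))" arbitrary: lo h q rule: less_induct)
  case less
  show ?case
  proof (cases h)
    case Leaf
    have large: "count (labels (mset q)) (Inner w) = 0" if "lo \<le> w" for w
    proof -
      have "\<forall>(a, b, x)\<in>set q. a \<noteq> Inner w \<and> b \<noteq> Inner w"
        using less.prems(1) that unfolding queued_def
        by (clarify, metis next_key_eq_None not_le)
      then have "Inner w \<notin># labels (mset q)" by auto
      then show ?thesis by (simp only: count_eq_zero_iff simp_thms)
    qed
    have "\<forall>w. count (labels (mset q)) (Inner w) = 0 \<or> D < count (labels (mset q)) (Inner w)"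
    proof (intro allI)
      fix w
      show "count (labels (mset q)) (Inner w) = 0 \<or> D < count (labels (mset q)) (Inner w)"
        using less.prems(5)[rule_format, of w] Leaf large[of w]
        by (cases "w < lo") simp_all
    qed
    then show ?thesis
      using less.prems(2) Leaf
      by (intro exI[of _ q]) (auto intro: returns_mono[OF returns_LOOP_Leaf, simplified])
  next
    case (Node n entry l r)
    have ok: "heap_ok h"
      and keys: "\<And>k e. (k, e) \<in># heap_mset h \<Longrightarrow> \<exists>n. k = (n, 0) \<and> next_key lo e = Some n"
      and pile: "\<And>e. e \<in> set q \<Longrightarrow> next_key lo e = None"
      using less.prems(1) unfolding queued_def by blast+
    obtain k0 e0 where entry: "entry = (k0, e0)" by (cases entry)
    then obtain v where k0: "k0 = (v, 0)" "next_key lo e0 = Some v"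
      using keys[of k0 e0] Node by auto
    have lo_v: "lo \<le> v" using k0(2) next_key_SomeD(1) by (cases e0) blast
    have min: "v \<le> fst (fst e)" if "e \<in># heap_mset h" for e
    proof -
      have "fst entry \<le> fst e" using that ok Node by auto
      then show ?thesis using entry k0 by (auto simp: less_eq_prod_def)
    qed
    obtain acc d h' where c: "collect v h [] (D + 1) = (acc, d, h')"
      by (metis surj_pair)
    note cc = collect_correct[OF ok c]
    have acc: "mset acc = image_mset snd (filter_mset (\<lambda>e. fst (fst e) \<le> v) (heap_mset h))"
      and h': "heap_mset h' = filter_mset (\<lambda>e. v < fst (fst e)) (heap_mset h)" "heap_ok h'"
      and d: "d = D + 1 - length acc"
      using cc by auto
    define R where "R = stored h' q"
    have stored_eq: "stored h q = mset acc + R"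
    proof -
      have "heap_mset h = filter_mset (\<lambda>e. fst (fst e) \<le> v) (heap_mset h) + heap_mset h'"
        unfolding h'(1) using multiset_partition[of "heap_mset h" "\<lambda>e. fst (fst e) \<le> v"]
        by (simp add: not_le)
      from arg_cong[OF this, of "image_mset snd"] show ?thesis
        unfolding R_def acc image_mset_union by (simp add: add.assoc)
    qed
    \<comment> \<open>The collected keys are at most \<open>v\<close>, which is the least key in the
      heap, so all of them equal \<open>v\<close>.\<close>
    have inc: "\<forall>(a, b, x)\<in>set acc. a = Inner v \<or> b = Inner v"
    proof safe
      fix a b x
      assume e: "(a, b, x) \<in> set acc" "b \<noteq> Inner v"
      then have "(a, b, x) \<in># mset acc" by simp
      then obtain k where k: "(k, a, b, x) \<in># heap_mset h" "fst k \<le> v"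
        unfolding acc by auto
      obtain m where m: "k = (m, 0)" "next_key lo (a, b, x) = Some m"
        using keys[OF k(1)] by blast
      then have "next_key lo (a, b, x) = Some v"
        using min[OF k(1)] k(2) by simp
      then show "a = Inner v" using next_key_SomeD(2) e(2) by blast
    qed
    have R_keys: "next_key lo e = None \<or> (\<exists>n>v. next_key lo e = Some n)" if e_R: "e \<in># R" for e
    proof (cases "e \<in> set q")
      case False
      then obtain k where "(k, e) \<in># heap_mset h" "v < fst k"
        using e_R unfolding R_def h'(1) by auto
      then show ?thesis using keys[of k e] by auto
    qed (use pile in blast)
    \<comment> \<open>No arc at \<open>v\<close> was missed: an arc with an end between
      \<open>lo\<close> and \<open>v\<close> has a key at most \<open>v\<close>, so it was
      collected.\<close>
    have R_free: "Inner w \<notin># labels R" if "lo \<le> w" "w \<le> v" for w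
    proof
      assume "Inner w \<in># labels R"
      then obtain a b x where e: "(a, b, x) \<in># R" "Inner w = a \<or> Inner w = b"
        by auto
      from R_keys[OF e(1)] show False
      proof
        assume "next_key lo (a, b, x) = None"
        then have "w < lo" using e(2) unfolding next_key_eq_None by blast
        then show False using that(1) by simp
      next
        assume "\<exists>n>v. next_key lo (a, b, x) = Some n"
        then obtain n where n: "v < n" "next_key lo (a, b, x) = Some n" by blast
        from next_key_SomeD(3)[OF n(2) e(2) that(1)] show False using n(1) that(2) by simp
      qed
    qed
    define es where "es = (if d = 0 then acc else bypass v acc)"
    obtain h2 q2 where p: "place (v + 1) es h' q = (h2, q2)"
      by (metis surj_pair)
    note pc = place_correct[OF h'(2) p]
    have stored2: "stored h2 q2 = mset es + R"
      using pc by (simp add: R_def ac_simps)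
    have len_es: "length es \<le> length acc"
      unfolding es_def using length_bypass by auto
    have v_in: "v \<in> pending lo (stored h q)"
    proof -
      obtain a b x where e0: "e0 = (a, b, x)" by (metis surj_pair)
      have "Inner v = a \<or> Inner v = b" using next_key_SomeD(2) k0(2) e0 by blast
      then show ?thesis using lo_v Node entry e0 by (auto simp: pending_def)
    qed
    have es_labels: "set_mset (labels (mset es)) \<subseteq> insert (Term v) (set_mset (labels (mset acc)))"
      and es_sound: "sound G Y (mset es + R)"
      and es_count: "\<And>w. w \<noteq> v \<Longrightarrow>
        count (labels (mset acc)) (Inner w) \<le> count (labels (mset es)) (Inner w)"
      and es_v: "d \<noteq> 0 \<Longrightarrow> Inner v \<notin># labels (mset es)"
      using bypass_correct[of G Y acc R v] inc R_free[OF lo_v order_refl] less.prems(2)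
      unfolding stored_eq es_def by (auto split: if_splits)
    have queued2: "queued (Suc v) h2 q2"
      unfolding queued_def
    proof (intro conjI)
      show "heap_ok h2" using pc by blast
      show "\<forall>(k, e)\<in>#heap_mset h2. \<exists>n. k = (n, 0) \<and> next_key (Suc v) e = Some n"
      proof safe
        fix i j a b x
        assume "((i, j), a, b, x) \<in># heap_mset h2"
        then consider "((i, j), a, b, x) \<in># heap_mset h'"
          | "\<exists>n. (i, j) = (n, 0) \<and> next_key (Suc v) (a, b, x) = Some n"
          using pc by fastforce
        then show "\<exists>n. (i, j) = (n, 0) \<and> next_key (Suc v) (a, b, x) = Some n"
        proof cases
          case 1
          then have "((i, j), a, b, x) \<in># heap_mset h" "v < i" unfolding h'(1) by auto
          then show ?thesis
            using keys next_key_raise[of lo "(a, b, x)" i "Suc v"] lo_v by fastforce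
        qed
      qed
      show "\<forall>e\<in>set q2. next_key (Suc v) e = None"
      proof
        fix e assume "e \<in> set q2"
        then have "e \<in> set q \<or> next_key (Suc v) e = None" using pc by simp
        then show "next_key (Suc v) e = None"
          using pile[of e] next_key_None_raise[of lo e "Suc v"] le_SucI[OF lo_v] by blast
      qed
    qed
    have pending2: "pending (Suc v) (stored h2 q2) \<subseteq> pending lo (stored h q) - {v}"
    proof
      fix w assume "w \<in> pending (Suc v) (stored h2 q2)"
      then have w: "Suc v \<le> w" "Inner w \<in># labels (mset es + R)"
        unfolding pending_def stored2 by auto
      then have "Inner w \<in># labels (mset acc + R)"
        using es_labels unfolding image_mset_union set_mset_union by blast
      then show "w \<in> pending lo (stored h q) - {v}"
        using w(1) lo_v unfolding pending_def stored_eq by simp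
    qed
    have card_less: "card (pending (Suc v) (stored h2 q2)) < card (pending lo (stored h q))"
      using pending2 v_in finite_pending by (intro psubset_card_mono) auto
    have size2: "size (stored h2 q2) \<le> size (stored h q)"
      unfolding stored2 stored_eq using len_es by simp
    \<comment> \<open>Below \<open>lo\<close>, degrees do not fall and zero stays zero. The vertex
      \<open>v\<close> was either bypassed or had more than \<open>D\<close> arcs collected. A
      vertex strictly between has no arcs at all, \<open>v\<close> being the least key;
      \<open>lo\<close> itself falls under this case if it differs from \<open>v\<close>.\<close>
    have deg2: "count (labels (stored h2 q2)) (Inner w) = 0 \<or> D < count (labels (stored h2 q2)) (Inner w)"
      if "w < Suc v" for w
    proof (cases "w < lo")
      case True
      then have "w \<noteq> v" using lo_v by simp
      have "count (labels (stored h q)) (Inner w) \<le> count (labels (stored h2 q2)) (Inner w)"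
        using es_count[OF \<open>w \<noteq> v\<close>] unfolding stored2 stored_eq image_mset_union count_union by linarith
      moreover have "count (labels (stored h2 q2)) (Inner w) = 0"
        if "count (labels (stored h q)) (Inner w) = 0"
        using that es_labels unfolding stored2 stored_eq image_mset_union set_mset_union
          count_eq_zero_iff union_iff by blast
      ultimately show ?thesis using less.prems(5) True by fastforce
    next
      case False
      then have R0: "Inner w \<notin># labels R" using R_free that by simp
      show ?thesis
      proof (cases "w = v")
        case True
        show ?thesis
        proof (cases "d = 0")
          case d0: True
          then have "D < size (mset acc)" using d by simp
          also have "\<dots> \<le> count (labels (mset acc)) (Inner v)"
            using inc by (intro count_labels_ge_size) simp
          finally show ?thesis
            using d0 True unfolding stored2 es_def image_mset_union count_union by simp
        next
          case False
          then have "Inner v \<notin># labels (mset es + R)"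
            using es_v R0 True by simp
          then show ?thesis
            using True unfolding stored2 by (simp only: count_eq_zero_iff simp_thms)
        qed
      next
        case wv: False
        have "Inner w \<notin># labels (mset acc)"
        proof
          assume "Inner w \<in># labels (mset acc)"
          then obtain a b x where e: "(a, b, x) \<in># mset acc" "Inner w = a \<or> Inner w = b"
            by auto
          then obtain k where k: "(k, a, b, x) \<in># heap_mset h" "fst k \<le> v"
            unfolding acc by auto
          obtain m where m: "k = (m, 0)" "next_key lo (a, b, x) = Some m"
            using keys[OF k(1)] by blast
          then have "next_key lo (a, b, x) = Some v"
            using min[OF k(1)] k(2) by simp
          then show False
            using next_key_SomeD(3)[of lo a b x v w] e(2) False that wv by simp
        qed
        then have "Inner w \<notin># labels (mset es + R)"
          using R0 es_labels unfolding image_mset_union set_mset_union union_iff by blast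
        then show ?thesis
          unfolding stored2 by (simp only: count_eq_zero_iff simp_thms)
      qed
    qed
    obtain q' where q': "returns LOOP (PairV (heap_val h2) (PairV (edges_val q2) (NatV D))) (edges_val q')
        ((600 * L + 1200) * load_of (Suc v) (stored h2 q2) +
         ((600 * L + 1200) * (2 * D) + 400) * card (pending (Suc v) (stored h2 q2)) + 20)"
      "sound G Y (mset q')" "length q' \<le> size (stored h2 q2)"
      "\<forall>w. count (labels (mset q')) (Inner w) = 0 \<or> D < count (labels (mset q')) (Inner w)"
      using less.hyps[OF card_less queued2] es_sound size2 less.prems(3,4) deg2
      unfolding stored2 by auto
    have heap_size: "size (heap_mset h) < 2 ^ L" "size (heap_mset h') + length es < 2 ^ L"
    proof -
      show "size (heap_mset h) < 2 ^ L" using less.prems(3) by simp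
      have "size (stored h q) = length acc + size (heap_mset h') + length q"
        unfolding stored_eq R_def by simp
      then show "size (heap_mset h') + length es < 2 ^ L"
        using less.prems(3) len_es by linarith
    qed
    have step: "returns LOOP (PairV (heap_val h) (PairV (edges_val q) (NatV D))) (edges_val q')
      ((600 * L + 1200) * length acc + 400 +
       ((600 * L + 1200) * load_of (Suc v) (stored h2 q2) +
         ((600 * L + 1200) * (2 * D) + 400) * card (pending (Suc v) (stored h2 q2)) + 20))"
      using Node entry k0(1) by (intro returns_LOOP_Node[OF _ ok heap_size(1) c es_def p h'(2) heap_size(2) q'(1)]) simp
    have load_acc: "load_of (Suc v) (mset acc) + length acc \<le> load_of lo (mset acc)"
      using load_of_Suc[of "mset acc" v lo] inc lo_v by simp
    have load_R: "load_of (Suc v) R \<le> load_of lo R"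
      using lo_v by (intro load_of_antimono) simp
    have bound: "length acc + load_of (Suc v) (stored h2 q2) \<le> load_of lo (stored h q) + 2 * D"
    proof (cases "d = 0")
      case True
      then show ?thesis
        using load_acc load_R unfolding stored2 stored_eq es_def load_of_union by simp
    next
      case False
      then have "length acc \<le> D" using d by simp
      moreover have "load_of (Suc v) (mset es) \<le> 2 * length acc"
        using load_of_le[of "Suc v" "mset es"] len_es by simp
      ultimately show ?thesis
        using load_acc load_R unfolding stored2 stored_eq load_of_union by linarith
    qed
    have "(600 * L + 1200) * length acc + (600 * L + 1200) * load_of (Suc v) (stored h2 q2)
        \<le> (600 * L + 1200) * load_of lo (stored h q) + (600 * L + 1200) * (2 * D)"
      using mult_le_mono2[OF bound, of "600 * L + 1200"] unfolding distrib_left .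
    from add_charge[OF this card_less]
    have "(600 * L + 1200) * length acc + 400 +
       ((600 * L + 1200) * load_of (Suc v) (stored h2 q2) +
         ((600 * L + 1200) * (2 * D) + 400) * card (pending (Suc v) (stored h2 q2)) + 20)
      \<le> (600 * L + 1200) * load_of lo (stored h q) +
       ((600 * L + 1200) * (2 * D) + 400) * card (pending lo (stored h q)) + 20" .
    from returns_mono[OF step this] show ?thesis
      using q'(2-4) size2 by (intro exI[of _ q']) auto
  qed
qed

section \<open>Doubling the threshold\<close>

lemma sum_count_Inner_le:
  assumes "finite W"
  shows "(\<Sum>w\<in>W. count M (Inner w)) \<le> size M"
proof -
  have "(\<Sum>w\<in>W. count M (Inner w)) = (\<Sum>a\<in>Inner ` W. count M a)"
    by (simp add: sum.reindex inj_on_def)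
  also have "\<dots> \<le> (\<Sum>a\<in>Inner ` W \<union> set_mset M. count M a)"
    using assms by (intro sum_mono2) auto
  also have "\<dots> = (\<Sum>a\<in>set_mset M. count M a)"
    using assms by (intro sum.mono_neutral_right) (auto simp: count_eq_zero_iff)
  also have "\<dots> = size M" by (simp add: size_multiset_overloaded_eq)
  finally show ?thesis .
qed

definition all_terminal :: "edge list \<Rightarrow> bool" where
  "all_terminal es \<longleftrightarrow> (\<forall>(a, b, x)\<in>set es. (\<exists>i. a = Term i) \<and> (\<exists>j. b = Term j))"

lemma all_terminalI:
  assumes "\<forall>e\<in>set es. next_key 0 e = None"
  shows "all_terminal es"
  unfolding all_terminal_def
proof (clarify, intro conjI)
  fix a b x
  assume "(a, b, x) \<in> set es"
  then have "\<forall>m. \<not> (Inner m = a \<or> Inner m = b)"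
    using assms next_key_eq_None[of 0 a b x] by auto
  then show "\<exists>i. a = Term i" "\<exists>j. b = Term j" by (metis endpoint.exhaust)+
qed

text \<open>Every nonzero degree after a phase exceeds its threshold, which is the fifth premise for
  the doubled one. The number \<open>k\<close> bounds the phases left until \<open>D\<close>
  outgrows \<open>4 * m\<close>, twice the largest possible number of arc ends.\<close>

lemma returns_PHASES:
  assumes "sound G Y (mset es)" "length es \<le> m" "m < 2 ^ L" "0 < D"
    and "\<forall>w. count (labels (mset es)) (Inner w) = 0 \<or> D \<le> 2 * count (labels (mset es)) (Inner w)"
    and "4 * m < D * 2 ^ k"
  shows "\<exists>es'. returns PHASES (PairV (edges_val es) (NatV D)) (edges_val es')
      ((k + 1) * ((6200 * L + 14100) * m + 120)) \<and>
    sound G Y (mset es') \<and> length es' \<le> m \<and> all_terminal es'"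
  using assms
proof (induction k arbitrary: es D)
  case 0
  \<comment> \<open>A nonzero degree would be at least \<open>D / 2\<close>, which is more than the
    at most \<open>2 * m\<close> arc ends.\<close>
  have zero: "count (labels (mset es)) (Inner w) = 0" for w
  proof -
    have "count (labels (mset es)) (Inner w) \<le> size (labels (mset es))"
      by (rule count_le_size)
    then show ?thesis using 0(5)[rule_format, of w] 0(2,6) by simp
  qed
  have none: "next_key 0 e = None" if "e \<in> set es" for e
  proof (cases "next_key 0 e")
    case (Some n)
    obtain a b x where e: "e = (a, b, x)" by (metis surj_pair)
    then have "Inner n = a \<or> Inner n = b" using next_key_SomeD(2) Some by blast
    then have "Inner n \<in># labels (mset es)" using that e by force
    then have "count (labels (mset es)) (Inner n) \<noteq> 0" by (simp only: count_eq_zero_iff not_not)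
    with zero[of n] show ?thesis by simp
  qed
  have "fst (place 0 es Leaf q) = Leaf" for q
    using none by (induction es arbitrary: q) auto
  then have "returns PHASES (PairV (edges_val es) (NatV D)) (edges_val es) ((200 * L + 500) * length es + 100)"
    using 0 by (intro returns_PHASES_Leaf) auto
  moreover have "(200 * L + 500) * length es + 100 \<le> (0 + 1) * ((6200 * L + 14100) * m + 120)"
  proof -
    have "(200 * L + 500) * length es \<le> (6200 * L + 14100) * m"
      using 0(2) by (intro mult_le_mono) auto
    then show ?thesis by simp
  qed
  ultimately show ?case
    using 0 none all_terminalI by (intro exI[of _ es]) (auto intro: returns_mono)
next
  case (Suc k)
  obtain h q where p: "place 0 es Leaf [] = (h, q)" by (metis surj_pair)
  have pc: "heap_ok h" "stored h q = mset es"
    "\<forall>(k, e)\<in>#heap_mset h. \<exists>n. k = (n, 0) \<and> next_key 0 e = Some n"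
    "\<forall>e\<in>set q. next_key 0 e = None"
    using place_correct[OF _ p] by auto
  have short: "length es < 2 ^ L" using Suc.prems(2,3) by simp
  have place_time: "(200 * L + 500) * length es \<le> (200 * L + 500) * m"
    using Suc.prems(2) by (intro mult_le_mono) auto
  show ?case
  proof (cases "h = Leaf")
    case True
    have "returns PHASES (PairV (edges_val es) (NatV D)) (edges_val es) ((200 * L + 500) * length es + 100)"
      using short True p by (intro returns_PHASES_Leaf) auto
    moreover have "(200 * L + 500) * length es + 100 \<le> (Suc k + 1) * ((6200 * L + 14100) * m + 120)"
    proof -
      have "(200 * L + 500) * length es \<le> (6200 * L + 14100) * m"
        using Suc.prems(2) by (intro mult_le_mono) auto
      from add_mono[OF this, of 100 120]
      have "(200 * L + 500) * length es + 100 \<le> 1 * ((6200 * L + 14100) * m + 120)"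
        by simp
      also have "\<dots> \<le> (Suc k + 1) * ((6200 * L + 14100) * m + 120)"
        by (intro mult_le_mono1) simp
      finally show ?thesis .
    qed
    moreover have "all_terminal es"
    proof (rule all_terminalI)
      have "set es = set q" using pc(2) True by (metis add_0 heap_mset.simps(1) image_mset_empty set_mset_mset)
      then show "\<forall>e\<in>set es. next_key 0 e = None" using pc(4) by simp
    qed
    ultimately show ?thesis
      using Suc.prems by (intro exI[of _ es]) (auto intro: returns_mono)
  next
    case False
    have queued: "queued 0 h q" using pc unfolding queued_def by blast
    have "\<exists>q'. returns LOOP (PairV (heap_val h) (PairV (edges_val q) (NatV D))) (edges_val q')
        ((600 * L + 1200) * load_of 0 (stored h q) +
         ((600 * L + 1200) * (2 * D) + 400) * card (pending 0 (stored h q)) + 20) \<and>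
      sound G Y (mset q') \<and> length q' \<le> size (stored h q) \<and>
      (\<forall>w. count (labels (mset q')) (Inner w) = 0 \<or> D < count (labels (mset q')) (Inner w))"
    proof (rule returns_LOOP[OF queued _ _ Suc.prems(4)])
      show "sound G Y (stored h q)" "size (stored h q) < 2 ^ L"
        unfolding pc(2) using Suc.prems(1) short by simp_all
    qed simp
    then obtain q' where q': "returns LOOP (PairV (heap_val h) (PairV (edges_val q) (NatV D))) (edges_val q')
        ((600 * L + 1200) * load_of 0 (mset es) +
         ((600 * L + 1200) * (2 * D) + 400) * card (pending 0 (mset es)) + 20)"
      "sound G Y (mset q')" "length q' \<le> length es"
      "\<And>w. count (labels (mset q')) (Inner w) = 0 \<or> D < count (labels (mset q')) (Inner w)"
      unfolding pc(2) size_mset by blast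
    have "\<exists>es'. returns PHASES (PairV (edges_val q') (NatV (D + D))) (edges_val es')
        ((k + 1) * ((6200 * L + 14100) * m + 120)) \<and>
      sound G Y (mset es') \<and> length es' \<le> m \<and> all_terminal es'"
    proof (rule Suc.IH)
      show "\<forall>w. count (labels (mset q')) (Inner w) = 0 \<or>
          D + D \<le> 2 * count (labels (mset q')) (Inner w)"
      proof
        fix w
        show "count (labels (mset q')) (Inner w) = 0 \<or> D + D \<le> 2 * count (labels (mset q')) (Inner w)"
          using q'(4)[of w] by linarith
      qed
      show "4 * m < (D + D) * 2 ^ k" using Suc.prems(6) by (simp add: algebra_simps)
    qed (use q' Suc.prems in auto)
    then obtain es' where es': "returns PHASES (PairV (edges_val q') (NatV (D + D))) (edges_val es')
        ((k + 1) * ((6200 * L + 14100) * m + 120))"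
      "sound G Y (mset es')" "length es' \<le> m" "all_terminal es'" by blast
    let ?c = "card (pending 0 (mset es))"
    \<comment> \<open>Handshake argument: each pending vertex has degree at least
      \<open>D / 2\<close>, and all degrees together are at most \<open>2 * m\<close>.\<close>
    have "?c * D = (\<Sum>w\<in>pending 0 (mset es). D)" by simp
    also have "\<dots> \<le> (\<Sum>w\<in>pending 0 (mset es). 2 * count (labels (mset es)) (Inner w))"
    proof (rule sum_mono)
      fix w assume "w \<in> pending 0 (mset es)"
      then have "Inner w \<in># labels (mset es)" by (simp add: pending_def)
      then have "0 < count (labels (mset es)) (Inner w)" by (simp only: count_greater_zero_iff)
      then show "D \<le> 2 * count (labels (mset es)) (Inner w)" using Suc.prems(5)[rule_format, of w] by linarith
    qed
    also have "\<dots> \<le> 2 * size (labels (mset es))"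
      unfolding sum_distrib_left[symmetric]
      using sum_count_Inner_le[OF finite_pending, of "labels (mset es)" 0 "mset es"] by simp
    also have "\<dots> \<le> 4 * m" using Suc.prems(2) by simp
    finally have cD: "?c * D \<le> 4 * m" .
    moreover have "?c * 1 \<le> ?c * D" using Suc.prems(4) by (intro mult_le_mono) auto
    ultimately have c: "?c \<le> 4 * m" by linarith
    have "(600 * L + 1200) * load_of 0 (mset es) \<le> (600 * L + 1200) * (2 * m)"
      using load_of_le[of 0 "mset es"] Suc.prems(2) by (intro mult_le_mono) auto
    moreover have "(600 * L + 1200) * (2 * (?c * D)) \<le> (600 * L + 1200) * (2 * (4 * m))"
      by (intro mult_le_mono2 cD)
    \<comment> \<open>Here \<open>10 * m\<close> is \<open>2 * m\<close> for the initial load plus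
      \<open>8 * m\<close> for bypasses, at \<open>2 * D\<close> for each pending vertex. With the
      cost of queueing all arcs this gives \<open>6200 = 10 * 600 + 200\<close> and
      \<open>14100 = 10 * 1200 + 4 * 400 + 500\<close>.\<close>
    ultimately have loop_time: "(600 * L + 1200) * load_of 0 (mset es) +
         ((600 * L + 1200) * (2 * D) + 400) * ?c + 20 \<le> (600 * L + 1200) * (10 * m) + 400 * (4 * m) + 20"
      using c by (simp add: algebra_simps)
    have "returns PHASES (PairV (edges_val es) (NatV D)) (edges_val es')
      ((200 * L + 500) * length es + 100 +
       ((600 * L + 1200) * load_of 0 (mset es) + ((600 * L + 1200) * (2 * D) + 400) * ?c + 20) +
       (k + 1) * ((6200 * L + 14100) * m + 120))"
      by (rule returns_PHASES_Node[OF short p False q'(1) es'(1)])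
    moreover have "(200 * L + 500) * length es + 100 +
       ((600 * L + 1200) * load_of 0 (mset es) + ((600 * L + 1200) * (2 * D) + 400) * ?c + 20) +
       (k + 1) * ((6200 * L + 14100) * m + 120) \<le> (Suc k + 1) * ((6200 * L + 14100) * m + 120)"
      using loop_time place_time by (simp add: algebra_simps)
    ultimately show ?thesis
      using es' by (intro exI[of _ es']) (blast intro: returns_mono)
  qed
qed

section \<open>Merging parallel edges\<close>

abbreviation out_arcs :: "(nat \<times> nat \<times> real) list \<Rightarrow> arc multiset" where
  "out_arcs out \<equiv> mset (map (\<lambda>(i, j, w). (V i, V j, w)) out)"

abbreviation out_keys :: "(nat \<times> nat \<times> real) list \<Rightarrow> (nat \<times> nat) list" where
  "out_keys \<equiv> map (\<lambda>(i, j, w). (i, j))"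

lemma out_keys_add_out: "set (out_keys (add_out k x acc)) \<subseteq> insert k (set (out_keys acc))"
proof (cases acc)
  case (Cons o1 acc1)
  then show ?thesis by (cases o1) (simp, blast)
qed simp

definition terminal_heap :: "heap \<Rightarrow> bool" where
  "terminal_heap h \<longleftrightarrow> (\<forall>(k, a, b, x)\<in>#heap_mset h.
     a = Term (fst k) \<and> b = Term (snd k) \<and> 0 < x)"

lemma vertex_Term [simp]: "vertex (Term i) = V i"
  by (simp add: vertex_def)

text \<open>The output is strictly decreasing and none of its keys exceeds a key in the heap. Hence
  only its head can share a key with the next arc, and strictness later makes the pairs
  distinct.\<close>

lemma drain_correct:
  assumes "heap_ok h" "terminal_heap h"
    and "routed G Y (image_mset (arc_of vertex) (image_mset snd (heap_mset h)) + out_arcs acc)"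
    and "sorted_wrt (>) (out_keys acc)"
    and "\<forall>k\<in>set (out_keys acc). \<forall>e\<in>#heap_mset h. k \<le> fst e"
    and "\<forall>(i, j, w)\<in>set acc. 0 < w"
  shows "routed G Y (out_arcs (drain h acc)) \<and> sorted_wrt (>) (out_keys (drain h acc)) \<and>
    (\<forall>(i, j, w)\<in>set (drain h acc). 0 < w) \<and>
    set (out_keys (drain h acc)) \<subseteq> fst ` set_mset (heap_mset h) \<union> set (out_keys acc)"
  using assms
proof (induction h acc rule: drain.induct)
  case (2 n k a b x l r acc)
  obtain i j where k: "k = (i, j)" by (metis surj_pair)
  have abx: "a = Term i" "b = Term j" "0 < x"
    using "2.prems"(2) by (auto simp: terminal_heap_def k)
  define acc' where "acc' = add_out k x acc"
  have keys': "set (out_keys acc') \<subseteq> insert k (set (out_keys acc))"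
    unfolding acc'_def by (rule out_keys_add_out)
  have k_le: "k \<le> fst e" if "e \<in># heap_mset (merge l r)" for e
    using that "2.prems"(1) by auto
  have acc_le: "k' \<le> k" if "k' \<in> set (out_keys acc)" for k'
    using that "2.prems"(5) by fastforce
  have acc'_props: "routed G Y (image_mset (arc_of vertex) (image_mset snd (heap_mset (merge l r))) + out_arcs acc') \<and>
    sorted_wrt (>) (out_keys acc') \<and> (\<forall>(i, j, w)\<in>set acc'. 0 < w)"
  proof (cases acc)
    case Nil
    then show ?thesis
      using "2.prems"(3) abx by (simp add: acc'_def k ac_simps)
  next
    case (Cons o1 acc1)
    obtain i1 j1 w1 where o1: "o1 = (i1, j1, w1)" by (metis surj_pair)
    have le: "(i1, j1) \<le> (i, j)" using acc_le[of "(i1, j1)"] Cons o1 k by simp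
    show ?thesis
    proof (cases "(i1, j1) < k")
      case True
      then have acc': "acc' = (i, j, x) # acc" by (simp add: acc'_def Cons o1 k)
      have "k' < k" if "k' \<in> set (out_keys acc)" for k'
      proof -
        have "k' \<le> (i1, j1)" using that "2.prems"(4) Cons o1 by fastforce
        then show ?thesis using True by (rule le_less_trans)
      qed
      then have "sorted_wrt (>) (out_keys acc')"
        unfolding acc' using "2.prems"(4) by (simp add: k)
      then show ?thesis
        using "2.prems"(3,6) abx unfolding acc' by (simp add: ac_simps)
    next
      case False
      then have eq: "(i1, j1) = (i, j)" using le k by simp
      then have acc': "acc' = (i, j, w1 + x) # acc1" using False by (simp add: acc'_def Cons o1 k)
      define N where "N = image_mset (arc_of vertex) (image_mset snd (heap_mset (merge l r))) + out_arcs acc1"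
      have "routed G Y (add_mset (V i, V j, w1) (add_mset (V i, V j, x) N))"
        using "2.prems"(3) abx eq by (simp add: N_def Cons o1 ac_simps add_mset_commute)
      from routed_join[OF this] show ?thesis
        using "2.prems"(4,6) abx eq by (simp add: N_def acc' Cons o1 ac_simps)
    qed
  qed
  have "routed G Y (out_arcs (drain (merge l r) acc')) \<and> sorted_wrt (>) (out_keys (drain (merge l r) acc')) \<and>
    (\<forall>(i, j, w)\<in>set (drain (merge l r) acc'). 0 < w) \<and>
    set (out_keys (drain (merge l r) acc')) \<subseteq> fst ` set_mset (heap_mset (merge l r)) \<union> set (out_keys acc')"
    unfolding acc'_def
  proof (rule "2.IH", fold acc'_def)
    show "heap_ok (merge l r)" using "2.prems"(1) by (auto intro: heap_ok_merge)
    show "terminal_heap (merge l r)" using "2.prems"(2) by (auto simp: terminal_heap_def)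
    show "\<forall>k\<in>set (out_keys acc'). \<forall>e\<in>#heap_mset (merge l r). k \<le> fst e"
    proof (intro ballI)
      fix k' e assume "k' \<in> set (out_keys acc')" "e \<in># heap_mset (merge l r)"
      then have "k' = k \<or> k' \<in> set (out_keys acc)" "k \<le> fst e"
        using keys' k_le by blast+
      then show "k' \<le> fst e" using acc_le order_trans by blast
    qed
  qed (use acc'_props in blast)+
  moreover have "fst ` set_mset (heap_mset (merge l r)) \<subseteq> fst ` set_mset (heap_mset (Node n (k, a, b, x) l r))"
    and "k \<in> fst ` set_mset (heap_mset (Node n (k, a, b, x) l r))"
    by auto
  ultimately show ?case
    using keys' unfolding drain.simps acc'_def[symmetric] by blast
qed simp

lemma load_correct:
  assumes "heap_ok h" "terminal_heap h" "all_terminal es" "\<forall>(a, b, x)\<in>set es. 0 < x"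
  shows "heap_ok (load es h) \<and> terminal_heap (load es h) \<and>
    image_mset snd (heap_mset (load es h)) = mset es + image_mset snd (heap_mset h)"
  using assms
proof (induction es h rule: load.induct)
  case (2 a b x es h)
  obtain i j where ab: "a = Term i" "b = Term j"
    using "2.prems"(3) by (auto simp: all_terminal_def)
  let ?h = "merge (Node 1 ((endpoint_index a, endpoint_index b), a, b, x) Leaf Leaf) h"
  have "heap_ok ?h" using "2.prems"(1) by (intro heap_ok_merge) auto
  moreover have "terminal_heap ?h" using "2.prems"(2,4) by (simp add: terminal_heap_def ab)
  ultimately show ?case
    using "2.IH" "2.prems"(3,4) by (simp add: all_terminal_def)
qed simp

section \<open>Dual norms\<close>

text \<open>In the greedy sum the largest entry of \<open>\<bar>x\<bar>\<close> is weighted by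
  \<open>F\<close> of a singleton, and the other terms are nonnegative since \<open>F\<close> is
  monotone. Which singleton it is depends on \<open>x\<close>.\<close>

lemma submod_norm_ge:
  assumes "finite h" "monotone_submodular h F" "i \<in> h"
  shows "\<exists>j\<in>h. F {j} * \<bar>x i\<bar> \<le> submod_norm h F x"
proof -
  define xs where "xs = sort_key (\<lambda>i. - \<bar>x i\<bar>) (sorted_list_of_set h)"
  have set_xs: "set xs = h" using assms(1) by (simp add: xs_def)
  then obtain k where k: "k < length xs" "xs ! k = i"
    using assms(3) by (metis in_set_conv_nth)
  have mono: "F A \<le> F B" if "A \<subseteq> B" "B \<subseteq> h" for A B
    using assms(2) that by (simp add: monotone_submodular_def)
  let ?f = "\<lambda>k. \<bar>x (xs ! k)\<bar> * (F (set (take (Suc k) xs)) - F (set (take k xs)))"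
  have norm: "submod_norm h F x = (\<Sum>k<length xs. ?f k)"
    by (simp add: submod_norm_def lovasz_extension_def xs_def Let_def)
  have "?f 0 \<le> (\<Sum>k<length xs. ?f k)"
  proof (rule member_le_sum)
    fix k
    have "F (set (take k xs)) \<le> F (set (take (Suc k) xs))"
      using set_xs set_take_subset_set_take[of k "Suc k" xs] by (intro mono) (auto dest: in_set_takeD)
    then show "0 \<le> ?f k" by simp
  qed (use k in auto)
  moreover have "?f 0 = \<bar>x (xs ! 0)\<bar> * F {xs ! 0}"
    using k assms(2) by (cases xs) (auto simp: monotone_submodular_def)
  moreover have "\<bar>x i\<bar> \<le> \<bar>x (xs ! 0)\<bar>"
  proof -
    have "sorted (map (\<lambda>i. - \<bar>x i\<bar>) xs)" by (simp add: xs_def)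
    moreover have "0 < length xs" using k(1) by linarith
    ultimately show ?thesis using sorted_nth_mono[of "map (\<lambda>i. - \<bar>x i\<bar>) xs" 0 k] k by simp
  qed
  moreover have first: "xs ! 0 \<in> h" using k set_xs by (metis gr_zeroI length_pos_if_in_set nth_mem not_less_zero)
  moreover have "0 < F {xs ! 0}" using assms(2) first by (simp add: monotone_submodular_def)
  ultimately have "F {xs ! 0} * \<bar>x i\<bar> \<le> submod_norm h F x"
    unfolding norm by (smt (verit) mult.commute mult_left_mono)
  then show ?thesis using first by blast
qed

text \<open>A real \<open>Sup\<close> can be reasoned about only for a bounded set. Positivity on
  singletons bounds each \<open>\<bar>x i\<bar>\<close> on the unit ball by \<open>1 / m\<close>,
  where \<open>m\<close> is the least value on a singleton.\<close>

lemma bdd_above_dual_norm: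
  assumes "finite h" "monotone_submodular h F"
  shows "bdd_above {(\<Sum>i\<in>h. y i * x i) | x. submod_norm h F x \<le> 1}"
proof (cases "h = {}")
  case False
  define m where "m = Min ((\<lambda>i. F {i}) ` h)"
  have m: "0 < m" "\<And>j. j \<in> h \<Longrightarrow> m \<le> F {j}"
    using assms False by (auto simp: m_def monotone_submodular_def)
  show ?thesis
  proof (rule bdd_aboveI)
    fix s assume "s \<in> {(\<Sum>i\<in>h. y i * x i) | x. submod_norm h F x \<le> 1}"
    then obtain x where x: "s = (\<Sum>i\<in>h. y i * x i)" "submod_norm h F x \<le> 1" by blast
    have "\<bar>x i\<bar> \<le> 1 / m" if i: "i \<in> h" for i
    proof -
      obtain j where j: "j \<in> h" "F {j} * \<bar>x i\<bar> \<le> 1"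
        using submod_norm_ge[OF assms i, of x] x(2) by force
      have "m * \<bar>x i\<bar> \<le> F {j} * \<bar>x i\<bar>" using m(2)[OF j(1)] by (intro mult_right_mono) auto
      then show ?thesis using j(2) m(1) by (simp add: field_simps)
    qed
    then have "y i * x i \<le> \<bar>y i\<bar> * (1 / m)" if "i \<in> h" for i
      using that by (metis abs_ge_self abs_ge_zero abs_mult mult_left_mono order_trans)
    then show "s \<le> (\<Sum>i\<in>h. \<bar>y i\<bar> * (1 / m))"
      unfolding x(1) by (rule sum_mono)
  qed
qed simp

text \<open>The norm sees only absolute values, so the signs of \<open>x\<close> can be chosen to agree with \<open>y\<close>.\<close>

lemma dual_norm_mono:
  assumes "finite h" "monotone_submodular h F" "\<And>i. i \<in> h \<Longrightarrow> \<bar>z i\<bar> \<le> \<bar>y i\<bar>"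
  shows "dual_norm h F z \<le> dual_norm h F y"
  unfolding dual_norm_def
proof (rule cSup_mono[OF _ bdd_above_dual_norm[OF assms(1,2)]])
  have "submod_norm h F (\<lambda>i. 0) \<le> 1"
    by (simp add: submod_norm_def lovasz_extension_def Let_def)
  then show "{(\<Sum>i\<in>h. z i * x i) | x. submod_norm h F x \<le> 1} \<noteq> {}" by blast
next
  fix s assume "s \<in> {(\<Sum>i\<in>h. z i * x i) | x. submod_norm h F x \<le> 1}"
  then obtain x where x: "s = (\<Sum>i\<in>h. z i * x i)" "submod_norm h F x \<le> 1" by blast
  define x' where "x' i = (if 0 \<le> y i then \<bar>x i\<bar> else - \<bar>x i\<bar>)" for i
  have "(\<lambda>i. \<bar>x' i\<bar>) = (\<lambda>i. \<bar>x i\<bar>)" by (auto simp: x'_def)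
  then have "submod_norm h F x' \<le> 1" using x(2) by (simp add: submod_norm_def)
  moreover have "s \<le> (\<Sum>i\<in>h. y i * x' i)"
    unfolding x(1)
  proof (rule sum_mono)
    fix i assume "i \<in> h"
    have "z i * x i \<le> \<bar>z i\<bar> * \<bar>x i\<bar>" by (metis abs_ge_self abs_mult)
    also have "\<dots> \<le> \<bar>y i\<bar> * \<bar>x i\<bar>" using assms(3)[OF \<open>i \<in> h\<close>] by (intro mult_right_mono) auto
    also have "\<dots> = y i * x' i" by (simp add: x'_def)
    finally show "z i * x i \<le> y i * x' i" .
  qed
  ultimately show "\<exists>a\<in>{(\<Sum>i\<in>h. y i * x i) | x. submod_norm h F x \<le> 1}. s \<le> a" by blast
qed

lemma dual_norm_le_congestion:
  assumes "finite (hedges G)" "h \<in> hedges G" "0 < hweight G h"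
  shows "dual_norm h (F h) (Y h) \<le> congestion G F Y * hweight G h"
proof -
  have "hedge_cong G F Y h \<le> congestion G F Y"
    unfolding congestion_def using assms(1,2) by (intro Max_ge) auto
  then show ?thesis using assms(3) by (simp add: hedge_cong_def pos_divide_le_eq)
qed

section \<open>The demand graph\<close>

text \<open>Lists the carried arcs in the order of the output, so that the flow of an edge can be
  named by its position.\<close>

lemma list_of_image_mset:
  "image_mset fst P = mset xs \<Longrightarrow> \<exists>ps. mset ps = P \<and> map fst ps = xs"
proof (induction xs arbitrary: P)
  case (Cons x xs)
  then obtain Z P' where P: "P = add_mset (x, Z) P'" "image_mset fst P' = mset xs"
    using image_fst_add_msetD[of P x "mset xs"] by auto
  then obtain ps where "mset ps = P'" "map fst ps = xs" using Cons.IH by blast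
  then show ?case using P by (intro exI[of _ "(x, Z) # ps"]) auto
qed simp

lemma nonzero_dem_in_verts:
  assumes "weighted_hypergraph G" "dem G Y v \<noteq> 0"
  shows "v \<in> verts G"
proof -
  have "{h \<in> hedges G. v \<in> h} \<noteq> {}" using assms(2) unfolding dem_def by (metis sum.empty)
  then show ?thesis using assms(1) by (auto simp: weighted_hypergraph_def)
qed

text \<open>As no vertex is both a tail and a head, nothing cancels in its net weight: the degree is
  the absolute demand, and the sign of the demand tells the side. For the same reason distinct
  ordered pairs remain distinct as unordered edges.\<close>

lemma graph_of_arcs:
  fixes out :: "(nat \<times> nat \<times> real) list"
  assumes wh: "weighted_hypergraph G" and cuts: "monotone_submodular_cuts G F \<delta>"
    and fin: "finite (hedges G)"
    and routed: "routed G Y (out_arcs out)" and distinct: "distinct (out_keys out)"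
    and pos: "\<forall>(i, j, w)\<in>set out. 0 < w"
    and sides: "\<forall>(i, j, w)\<in>set out. \<forall>(i', j', w')\<in>set out. i \<noteq> j'"
  shows "\<exists>H. represents_graph (list_val (map out_val out)) H \<and> weighted_graph_on (verts G) H \<and>
    embeds H (congestion G F Y) G F \<and>
    bipartite_over H {i \<in> verts G. dem G Y i \<ge> 0} {i \<in> verts G. dem G Y i < 0} \<and>
    (\<forall>i\<in>verts G. wdegree H i = \<bar>dem G Y i\<bar>)"
proof -
  define n where "n = length out"
  define I J W where "I k = fst (out ! k)" and "J k = fst (snd (out ! k))"
    and "W k = snd (snd (out ! k))" for k
  have out_nth: "out ! k = (I k, J k, W k)" for k by (simp add: I_def J_def W_def)
  have in_out: "(I k, J k, W k) \<in> set out" if "k < n" for k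
    using that nth_mem[of k out] by (simp add: out_nth n_def)
  have W_pos: "0 < W k" if "k < n" for k using pos in_out[OF that] by auto
  have IJ: "I k \<noteq> J k'" if "k < n" "k' < n" for k k'
    using sides in_out[OF that(1)] in_out[OF that(2)] by auto
  define e where "e k = {I k, J k}" for k
  have inj: "inj_on e {..<n}"
  proof (rule inj_onI)
    fix k k' assume k: "k \<in> {..<n}" "k' \<in> {..<n}" "e k = e k'"
    then have "I k = I k'" "J k = J k'"
      using IJ[of k k'] IJ[of k' k] by (auto simp: e_def doubleton_eq_iff)
    then show "k = k'"
      using nth_eq_iff_index_eq[OF distinct, of k k'] k(1,2) by (simp add: n_def out_nth)
  qed
  \<comment> \<open>Weights and flows are indexed by positions in the list, whereas a graph and an
    embedding index them by edges.\<close>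
  define idx where "idx d = inv_into {..<n} e d" for d
  have idx: "idx (e k) = k" if "k < n" for k
    unfolding idx_def using inv_into_f_f[OF inj] that by simp
  define H where "H = \<lparr>gedges = e ` {..<n}, gweight = \<lambda>d. W (idx d)\<rparr>"
  have gedges: "gedges H = e ` {..<n}" and gw: "\<And>k. k < n \<Longrightarrow> gweight H (e k) = W k"
    by (simp_all add: H_def idx)
  have edge_cases: "\<exists>k<n. d = e k" if "d \<in> gedges H" for d
    using that by (auto simp: gedges)

  have net: "(\<Sum>k<n. W k * (of_bool (v = I k) - of_bool (v = J k))) = dem G Y v" for v
  proof -
    have "dem G Y v = net (out_arcs out) (V v)" using routed by (simp add: routed_def)
    also have "\<dots> = (\<Sum>(i, j, w)\<leftarrow>out. w * (of_bool (v = i) - of_bool (v = j)))"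
      by (simp add: net_def multiset.map_comp comp_def case_prod_unfold sum_mset_sum_list[symmetric] flip: mset_map)
    also have "\<dots> = (\<Sum>k<n. W k * (of_bool (v = I k) - of_bool (v = J k)))"
      by (simp add: sum_list_sum_nth atLeast0LessThan n_def out_nth)
    finally show ?thesis ..
  qed
  have source: "dem G Y (I k) > 0" if k: "k < n" for k
  proof -
    have "W k \<le> (\<Sum>k'<n. W k' * (of_bool (I k = I k') - of_bool (I k = J k')))"
      using member_le_sum[of k "{..<n}" "\<lambda>k'. W k' * (of_bool (I k = I k') - of_bool (I k = J k'))"]
        k IJ W_pos by (auto simp: less_imp_le)
    then show ?thesis using W_pos[OF k] net[of "I k"] by simp
  qed
  have sink: "dem G Y (J k) < 0" if k: "k < n" for k
  proof -
    have JI: "J k \<noteq> I k'" if "k' < n" for k' using IJ[OF that k] by simp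
    have "W k \<le> (\<Sum>k'<n. - (W k' * (of_bool (J k = I k') - of_bool (J k = J k'))))"
      using member_le_sum[of k "{..<n}" "\<lambda>k'. - (W k' * (of_bool (J k = I k') - of_bool (J k = J k')))"]
        k JI W_pos by (auto simp: less_imp_le)
    then show ?thesis using W_pos[OF k] net[of "J k"] by (simp add: sum_negf)
  qed
  have verts: "I k \<in> verts G" "J k \<in> verts G" if "k < n" for k
    using nonzero_dem_in_verts[OF wh, of Y] source[OF that] sink[OF that] by force+

  have "represents_graph (list_val (map out_val out)) H"
    unfolding represents_graph_def
  proof (intro exI conjI)
    let ?es = "map (\<lambda>(i, j, w). (i, j)) out"
    have map_e: "map (\<lambda>(i, j). {i, j}) ?es = map e [0..<n]"
      by (intro nth_equalityI) (auto simp: n_def out_nth e_def)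
    show "distinct (map (\<lambda>(i, j). {i, j}) ?es)"
      unfolding map_e using inj by (simp add: distinct_map atLeast0LessThan)
    show "set (map (\<lambda>(i, j). {i, j}) ?es) = gedges H"
      unfolding map_e gedges by (simp add: atLeast0LessThan)
    have "map out_val out = map (\<lambda>(i, j). PairV (NatV i) (PairV (NatV j) (RealV (gweight H {i, j})))) ?es"
      using gw by (intro nth_equalityI) (auto simp: n_def out_nth e_def)
    then show "list_val (map out_val out) =
      list_val (map (\<lambda>(i, j). PairV (NatV i) (PairV (NatV j) (RealV (gweight H {i, j})))) ?es)"
      by (simp only:)
  qed
  moreover have "weighted_graph_on (verts G) H"
    unfolding weighted_graph_on_def gedges
  proof safe
    fix k assume k: "k < n"
    show "\<exists>i\<in>verts G. \<exists>j\<in>verts G. i \<noteq> j \<and> e k = {i, j}"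
      using verts[OF k] IJ[OF k k] unfolding e_def by blast
    show "0 < gweight H (e k)" using gw W_pos k by simp
  qed
  moreover have "bipartite_over H {i \<in> verts G. dem G Y i \<ge> 0} {i \<in> verts G. dem G Y i < 0}"
    unfolding bipartite_over_def gedges
  proof safe
    fix k assume k: "k < n"
    show "\<exists>i\<in>{i \<in> verts G. dem G Y i \<ge> 0}. \<exists>j\<in>{i \<in> verts G. dem G Y i < 0}. e k = {i, j}"
      using verts[OF k] source[OF k] sink[OF k] unfolding e_def
      by (intro bexI[of _ "I k"] bexI[of _ "J k"]) auto
  qed
  moreover have "wdegree H v = \<bar>dem G Y v\<bar>" for v
  proof -
    have "wdegree H v = (\<Sum>d\<in>e ` {..<n}. if v \<in> d then gweight H d else 0)"
      unfolding wdegree_def gedges by (simp add: sum.inter_filter)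
    also have "\<dots> = (\<Sum>k<n. if v \<in> e k then W k else 0)"
      by (subst sum.reindex[OF inj]) (auto simp: gw intro: sum.cong)
    finally have deg: "wdegree H v = (\<Sum>k<n. if v \<in> e k then W k else 0)" .
    show ?thesis
    proof (cases "\<exists>k<n. v = J k")
      case True
      then obtain k0 where k0: "k0 < n" "v = J k0" by blast
      have "wdegree H v = (\<Sum>k<n. - (W k * (of_bool (v = I k) - of_bool (v = J k))))"
        unfolding deg
      proof (intro sum.cong refl)
        fix k assume "k \<in> {..<n}"
        then have "v \<noteq> I k" using IJ[of k k0] k0 by auto
        then show "(if v \<in> e k then W k else 0) = - (W k * (of_bool (v = I k) - of_bool (v = J k)))"
          by (auto simp: e_def)
      qed
      also have "\<dots> = - dem G Y v" by (simp add: sum_negf net)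
      finally show ?thesis using sink[OF k0(1)] k0(2) by simp
    next
      \<comment> \<open>Without incoming arcs all contributions are nonnegative; this includes the
        vertices of degree zero.\<close>
      case False
      then have "wdegree H v = (\<Sum>k<n. W k * (of_bool (v = I k) - of_bool (v = J k)))"
        unfolding deg by (intro sum.cong) (auto simp: e_def)
      also have "\<dots> = dem G Y v" by (rule net)
      finally have eq: "wdegree H v = dem G Y v" .
      have "0 \<le> wdegree H v"
        unfolding deg using W_pos by (intro sum_nonneg) (auto simp: less_imp_le)
      then show ?thesis using eq by simp
    qed
  qed
  moreover have "embeds H (congestion G F Y) G F"
  proof -
    obtain P where P: "image_mset fst P = out_arcs out" "\<forall>p\<in>#P. carries G p"
      "\<forall>h\<in>hedges G. \<forall>i\<in>h. (\<Sum>p\<in>#P. \<bar>snd p h i\<bar>) \<le> \<bar>Y h i\<bar>"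
      using routed by (auto simp: routed_def routes_def)
    obtain ps where ps: "mset ps = P" "map fst ps = map (\<lambda>(i, j, w). (V i, V j, w)) out"
      using list_of_image_mset[OF P(1)] by blast
    have len: "length ps = n" using ps(2) by (metis length_map n_def)
    define Z where "Z k = snd (ps ! k)" for k
    have carry: "carries G ((V (I k), V (J k), W k), Z k)" if k: "k < n" for k
    proof -
      have "fst (ps ! k) = (V (I k), V (J k), W k)"
        using arg_cong[OF ps(2), of "\<lambda>xs. xs ! k"] k len by (simp add: n_def out_nth)
      then have "ps ! k = ((V (I k), V (J k), W k), Z k)" by (simp add: prod_eq_iff Z_def)
      moreover have "ps ! k \<in># P" using k len by (simp flip: ps(1))
      ultimately show ?thesis using P(2) by fastforce
    qed
    have sum_le: "(\<Sum>k<n. \<bar>Z k h i\<bar>) \<le> \<bar>Y h i\<bar>" if "h \<in> hedges G" "i \<in> h" for h i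
    proof -
      have "(\<Sum>p\<in>#P. \<bar>snd p h i\<bar>) = (\<Sum>p\<leftarrow>ps. \<bar>snd p h i\<bar>)"
        by (simp flip: ps(1) sum_mset_sum_list)
      also have "\<dots> = (\<Sum>k<n. \<bar>Z k h i\<bar>)"
        by (simp add: sum_list_sum_nth atLeast0LessThan len Z_def)
      finally show ?thesis using P(3) that by fastforce
    qed
    show ?thesis
      unfolding embeds_def
    proof (intro exI[of _ "\<lambda>d. Z (idx d)"] conjI ballI allI impI)
      fix d assume "d \<in> gedges H"
      then obtain k where k: "k < n" "d = e k" using edge_cases by blast
      have "(\<Sum>i\<in>h. Z k h i) = 0" if "h \<in> hedges G" for h
        using carry[OF k(1)] that by (force simp: nodes_def divergence_def)
      then show "hypergraph_flow G (Z (idx d))"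
        using idx k by (simp add: hypergraph_flow_def)
    next
      fix i j v assume "{i, j} \<in> gedges H"
      then obtain k where k: "k < n" "{i, j} = e k" using edge_cases by blast
      have "dem G (Z k) v = W k * (of_bool (v = I k) - of_bool (v = J k))"
      proof -
        have "divergence G (Z k) (V v) = W k * (of_bool (V v = V (I k)) - of_bool (V v = V (J k)))"
          using carry[OF k(1)] unfolding carries.simps nodes_def by blast
        then show ?thesis by (simp add: divergence_def)
      qed
      then have "\<bar>dem G (Z k) v\<bar> = W k * (of_bool (v = I k) + of_bool (v = J k))"
        using IJ[OF k(1) k(1)] W_pos[OF k(1)] by auto
      moreover have "(indicator {i} v + indicator {j} v :: real) = of_bool (v = I k) + of_bool (v = J k)"
        using k(2) by (auto simp: e_def doubleton_eq_iff indicator_def)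
      ultimately show "\<bar>dem G (Z (idx {i, j})) v\<bar> = gweight H {i, j} * (indicator {i} v + indicator {j} v)"
        using k idx gw by simp
    next
      fix h assume h: "h \<in> hedges G"
      have "(\<Sum>d\<in>gedges H. \<bar>Z (idx d) h i\<bar>) = (\<Sum>k<n. \<bar>Z k h i\<bar>)" for i
        unfolding gedges by (subst sum.reindex[OF inj]) (simp add: idx)
      moreover have "finite h"
        using h wh unfolding weighted_hypergraph_def
        by (meson Pow_iff finite_lessThan finite_subset subsetD)
      ultimately have "dual_norm h (F h) (\<lambda>i. \<Sum>d\<in>gedges H. \<bar>Z (idx d) h i\<bar>) \<le> dual_norm h (F h) (Y h)"
        using h wh cuts sum_le
        by (intro dual_norm_mono)
          (auto simp: monotone_submodular_cuts_def sum_nonneg)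
      also have "\<dots> \<le> congestion G F Y * hweight G h"
        using fin h wh by (intro dual_norm_le_congestion) (auto simp: weighted_hypergraph_def)
      finally show "dual_norm h (F h) (\<lambda>i. \<Sum>d\<in>gedges H. \<bar>Z (idx d) h i\<bar>) \<le> congestion G F Y * hweight G h" .
    qed
  qed
  ultimately show ?thesis by blast
qed

section \<open>Size estimates and the time bound\<close>

lemma sorted_wrt_greater_distinct: "sorted_wrt (>) xs \<Longrightarrow> distinct (xs :: 'a::linorder list)"
  by (induction xs) auto

lemma power_of_two_above: "\<exists>L. s < 2 ^ L \<and> 2 ^ L \<le> 2 * s + (2::nat)"
proof (induction s)
  case 0
  show ?case by (intro exI[of _ 0]) auto
next
  case (Suc s)
  then obtain L where L: "s < 2 ^ L" "2 ^ L \<le> 2 * s + (2::nat)" by blast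
  show ?case
  proof (cases "Suc s < 2 ^ L")
    case True
    then show ?thesis using L by (intro exI[of _ L]) auto
  next
    case False
    then show ?thesis using L by (intro exI[of _ "Suc L"]) auto
  qed
qed

lemma distinct_incidence_list:
  assumes "\<forall>xs\<in>set hs. distinct xs" "distinct (map set hs)"
  shows "distinct (concat (map (\<lambda>xs. map (Pair (set xs)) xs) hs))"
  using assms by (induction hs) (auto simp: distinct_map inj_on_def)

lemma enumerates_hedges_finite:
  assumes "enumerates_hedges G hs"
  shows "finite (hedges G)"
proof -
  have "set (map set hs) = hedges G" using assms by (simp add: enumerates_hedges_def)
  then show ?thesis using List.finite_set[of "map set hs"] by simp
qed

lemma sum_list_hedges:
  assumes "enumerates_hedges G hs"
  shows "(\<Sum>xs\<leftarrow>hs. length xs) = sparsity G"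
proof -
  have "(\<Sum>xs\<leftarrow>hs. length xs) = (\<Sum>h\<leftarrow>map set hs. card h)"
    using assms unfolding enumerates_hedges_def map_map comp_def
    by (intro arg_cong[where f = sum_list] map_cong) (auto simp: distinct_card)
  also have "\<dots> = (\<Sum>h\<in>set (map set hs). card h)"
    using assms by (intro sum_list_distinct_conv_sum_set) (simp add: enumerates_hedges_def)
  finally show ?thesis using assms by (simp add: enumerates_hedges_def sparsity_def)
qed

text \<open>An empty hyperedge takes time to read but adds nothing to the sparsity. Hyperedges form
  a set, so there is at most one.\<close>

lemma length_hedges:
  assumes "enumerates_hedges G hs"
  shows "length hs \<le> sparsity G + 1"
proof -
  have "length hs = card (hedges G)"
    using assms unfolding enumerates_hedges_def by (metis distinct_card length_map)
  also have "\<dots> \<le> card (hedges G - {{}}) + 1"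
    by (simp add: card_Diff_singleton_if) linarith
  also have "card (hedges G - {{}}) \<le> (\<Sum>h\<in>hedges G - {{}}. card h)"
  proof -
    have "\<forall>h\<in>set (map set hs). finite h" by simp
    then have "finite h" if "h \<in> hedges G" for h
      using assms that unfolding enumerates_hedges_def by blast
    then have "(\<Sum>h\<in>hedges G - {{}}. 1) \<le> (\<Sum>h\<in>hedges G - {{}}. card h)"
      by (intro sum_mono) (auto simp: Suc_le_eq card_gt_0_iff)
    then show ?thesis by simp
  qed
  also have "\<dots> \<le> sparsity G"
    unfolding sparsity_def using enumerates_hedges_finite[OF assms] by (intro sum_mono2) auto
  finally show ?thesis by simp
qed

text \<open>The last factor dominates \<open>L + 3\<close>, where
  \<open>2 ^ L \<le> 2 * s + 2\<close>. The additive constants keep the bound valid for sparsity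
  zero, where the program still takes some steps.\<close>

definition time_bound :: "nat \<Rightarrow> real" where
  "time_bound s = 10000 * (real s + 1) * (2 * ln (real s + 1) + 4) ^ 2"

lemma soft_linear_time_bound: "soft_linear time_bound"
  unfolding soft_linear_def
\<comment> \<open>The factor 2 comes from \<open>s + 1 \<le> 2 * s\<close> and 64 from
  \<open>2 * ln (s + 1) + 4 \<le> 8 * ln s\<close>; both hold from \<open>s = 3\<close> on, where
  \<open>ln s\<close> is at least 1.\<close>
proof (intro exI[of _ 2] bigoI[where c = "10000 * 2 * 64"])
  show "\<forall>\<^sub>F s in sequentially.
    norm (time_bound s) \<le> 10000 * 2 * 64 * norm (real s * ln (real s) ^ 2)"
    using eventually_ge_at_top[of 3]
  proof eventually_elim
    case (elim s)
    have "exp 1 \<le> real s" using exp_le elim by linarith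
    then have ln1: "1 \<le> ln (real s)" using elim by (simp add: ln_ge_iff)
    have "3 * real s \<le> real s * real s"
      using elim by (intro mult_right_mono) auto
    then have "real s + 1 \<le> real s * real s"
      using elim by linarith
    then have "ln (real s + 1) \<le> ln (real s * real s)"
      using elim by simp
    then have "ln (real s + 1) \<le> 2 * ln (real s)"
      using elim by (simp add: ln_mult)
    then have "2 * ln (real s + 1) + 4 \<le> 8 * ln (real s)" using ln1 by linarith
    moreover have "0 \<le> ln (real s + 1)" by simp
    ultimately have "(2 * ln (real s + 1) + 4) ^ 2 \<le> (8 * ln (real s)) ^ 2"
      by (intro power_mono) auto
    then have "10000 * (real s + 1) * (2 * ln (real s + 1) + 4) ^ 2 \<le>
        10000 * (2 * real s) * (8 * ln (real s)) ^ 2"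
      using elim by (intro mult_mono) auto
    then show ?case by (simp add: time_bound_def power_mult_distrib abs_mult)
  qed
qed

lemma total_time_le:
  assumes "m \<le> s" "2 ^ L \<le> 2 * s + (2::nat)" "n \<le> s + 1"
    and "t \<le> (400 * s + 200 * n + 20) + (L + 2 + 1) * ((6200 * L + 14100) * m + 120) +
      ((200 * L + 400) * m + 20) + ((400 * L + 300) * m + 20) + 50"
  shows "real t \<le> time_bound s"
proof -
  \<comment> \<open>Bounds for the nonlinear monomials of the expanded products; given these, the
    comparison is linear.\<close>
  have "m * (L * L) \<le> (s + 1) * (L * L)" "m * L \<le> (s + 1) * L" "1 * L \<le> (s + 1) * L"
    using assms(1) by (intro mult_le_mono1; simp)+
  then have "t \<le> 10000 * (s + 1) * (L + 3) ^ 2"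
    using assms(1,3,4) by (simp add: algebra_simps power2_eq_square)
  then have "real t \<le> real (10000 * (s + 1) * (L + 3) ^ 2)" by (rule of_nat_mono)
  also have "\<dots> = 10000 * (real s + 1) * (real L + 3) ^ 2" by (simp add: algebra_simps)
  also have "\<dots> \<le> time_bound s"
  proof -
    have "(2::real) ^ L \<le> 2 * (real s + 1)"
      using of_nat_mono[OF assms(2), where 'a = real] by simp
    then have "ln ((2::real) ^ L) \<le> ln (2 * (real s + 1))" by simp
    moreover have "ln (2 * (real s + 1)) = ln 2 + ln (real s + 1)" by (subst ln_mult) auto
    ultimately have log_le: "real L * ln 2 \<le> ln 2 + ln (real s + 1)"
      by (simp only: ln_realpow)
    \<comment> \<open>Equivalent to \<open>ln (1 / 2) \<le> 1 / 2 - 1\<close>.\<close>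
    have half: "1 / 2 \<le> ln (2::real)"
      using ln_le_minus_one[of "1 / 2 :: real"] by (simp add: ln_div)
    have nonneg: "0 \<le> ln (real s + 1)" by simp
    have split: "real L * ln 2 = (real L - 1) * ln 2 + ln 2" by (simp add: algebra_simps)
    have "real L \<le> 2 * ln (real s + 1) + 1"
    proof (cases "1 \<le> L")
      case True
      have "(real L - 1) * (1 / 2) \<le> (real L - 1) * ln 2"
        using half True by (intro mult_left_mono) auto
      also have "(real L - 1) * ln 2 \<le> ln (real s + 1)" using log_le split by simp
      finally show ?thesis by simp
    next
      case False
      then have "L = 0" by simp
      then show ?thesis using nonneg by simp
    qed
    then show ?thesis
      unfolding time_bound_def by (intro mult_left_mono power_mono) auto
  qed
  finally show ?thesis .
qed

section \<open>Assembling the construction\<close>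

lemma one_sided_inner_edges:
  assumes "inner_edges es"
  shows "one_sided (mset es)"
proof -
  have "Term n \<notin># srcs (mset es)" "Term n \<notin># dsts (mset es)" for n
    using assms by (auto simp: inner_edges_def)
  then show ?thesis unfolding one_sided_def set_mset_union by blast
qed

lemma sound_build:
  assumes "weighted_hypergraph G" "hypergraph_flow G Y" and en: "enumerates_hedges G hs"
  shows "sound G Y (mset (build (map (\<lambda>xs. (hweight G (set xs), map (\<lambda>i. (i, Y (set xs) i)) xs)) hs) []))"
proof -
  let ?q = "concat (map (\<lambda>xs. map (Pair (set xs)) xs) hs)"
  have hs: "\<forall>xs\<in>set hs. distinct xs" "distinct (map set hs)" "set (map set hs) = hedges G"
    using en by (auto simp: enumerates_hedges_def)
  have fin: "finite (hedges G)" "\<forall>h\<in>hedges G. finite h"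
    unfolding hs(3)[symmetric] by auto
  have "filter_mset (\<lambda>(h, i). Y h i \<noteq> 0) (mset ?q) = mset (filter (\<lambda>(h, i). Y h i \<noteq> 0) ?q)"
    by simp
  also have "\<dots> = mset_set (set (filter (\<lambda>(h, i). Y h i \<noteq> 0) ?q))"
    using distinct_incidence_list[OF hs(1,2)] by (intro mset_set_set[symmetric] distinct_filter)
  also have "set (filter (\<lambda>(h, i). Y h i \<noteq> 0) ?q) = incidences G Y"
    unfolding incidences_def hs(3)[symmetric] by auto
  finally have inc: "filter_mset (\<lambda>(h, i). Y h i \<noteq> 0) (mset ?q) = mset_set (incidences G Y)" .
  have zero: "\<forall>xs\<in>set hs. (\<Sum>i\<leftarrow>xs. Y (set xs) i) = 0"
    using assms(2) hs by (auto simp: hypergraph_flow_def sum_list_distinct_conv_sum_set)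
  have "routed G Y (image_mset (incidence_arc Y) (filter_mset (\<lambda>(h, i). Y h i \<noteq> 0) (mset ?q)) +
      image_mset (arc_of vertex) (mset []))"
    unfolding inc using routed_incidences[OF fin] by simp
  from routed_build[OF this _ zero, of "\<lambda>xs. hweight G (set xs)"] show ?thesis
    unfolding sound_def using one_sided_inner_edges by (auto simp: inner_edges_def)
qed

theorem mainTheorem7:
  shows "\<exists>(p :: program) (T :: nat \<Rightarrow> real). soft_linear T \<and>
    (\<forall>(G :: hypergraph) (F :: nat set \<Rightarrow> nat set \<Rightarrow> real)
       (\<delta> :: nat set \<Rightarrow> nat set \<Rightarrow> real) (Y :: hflow) (hs :: nat list list).
       weighted_hypergraph G \<longrightarrow>
       monotone_submodular_cuts G F \<delta> \<longrightarrow>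
       hypergraph_flow G Y \<longrightarrow>
       enumerates_hedges G hs \<longrightarrow>
       (\<exists>result t H.
          computes p (input_val G Y hs) result t \<and>
          real t \<le> T (sparsity G) \<and>
          represents_graph result H \<and>
          weighted_graph_on (verts G) H \<and>
          embeds H (congestion G F Y) G F \<and>
          bipartite_over H {i\<in>verts G. dem G Y i \<ge> 0} {i\<in>verts G. dem G Y i < 0} \<and>
          (\<forall>i\<in>verts G. wdegree H i = \<bar>dem G Y i\<bar>)))"
proof (intro exI[of _ demand_graph_program] exI[of _ time_bound] conjI allI impI)
  show "soft_linear time_bound" by (rule soft_linear_time_bound)
next
  fix G :: hypergraph and F \<delta> :: "nat set \<Rightarrow> nat set \<Rightarrow> real" and Y :: hflow and hs :: "nat list list"
  assume wh: "weighted_hypergraph G" and cuts: "monotone_submodular_cuts G F \<delta>"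
    and flow: "hypergraph_flow G Y" and en: "enumerates_hedges G hs"
  define hs' where "hs' = map (\<lambda>xs. (hweight G (set xs), map (\<lambda>i. (i, Y (set xs) i)) xs)) hs"
  define es where "es = build hs' []"
  have total: "(\<Sum>h\<leftarrow>hs'. length (snd h)) = sparsity G"
    using sum_list_hedges[OF en] by (simp add: hs'_def comp_def)
  note fin = enumerates_hedges_finite[OF en]
  obtain L where L: "sparsity G < 2 ^ L" "2 ^ L \<le> 2 * sparsity G + (2::nat)"
    using power_of_two_above by blast
  define m where "m = length es"
  have m: "m \<le> sparsity G" using length_build[of hs' "[]"] by (simp add: m_def es_def total)
  have sound: "sound G Y (mset es)"
    using sound_build[OF wh flow en] by (simp add: es_def hs'_def)
  have build: "returns BUILD (PairV (list_val (map hedge_val hs')) (edges_val [])) (edges_val es)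
      (400 * sparsity G + 200 * length hs + 20)"
    using returns_BUILD[of hs' "[]"] total by (simp add: es_def hs'_def)
  \<comment> \<open>Since \<open>m < 2 ^ L\<close>, a threshold that starts at 1 exceeds
    \<open>4 * m\<close> after \<open>L + 2\<close> doublings.\<close>
  have "\<exists>es'. returns PHASES (PairV (edges_val es) (NatV 1)) (edges_val es')
      ((L + 2 + 1) * ((6200 * L + 14100) * m + 120)) \<and>
    sound G Y (mset es') \<and> length es' \<le> m \<and> all_terminal es'"
  proof (rule returns_PHASES[OF sound])
    show "\<forall>w. count (labels (mset es)) (Inner w) = 0 \<or> 1 \<le> 2 * count (labels (mset es)) (Inner w)"
      by auto
  qed (use m L in \<open>auto simp: m_def\<close>)
  then obtain es' where es': "returns PHASES (PairV (edges_val es) (NatV 1)) (edges_val es')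
      ((L + 2 + 1) * ((6200 * L + 14100) * m + 120))"
    "sound G Y (mset es')" "length es' \<le> m" "all_terminal es'" by blast
  have pos: "\<forall>(a, b, x)\<in>set es'. 0 < x" using es'(2) by (simp add: sound_def)
  define h where "h = load es' Leaf"
  have h: "heap_ok h" "terminal_heap h" "image_mset snd (heap_mset h) = mset es'"
    using load_correct[of Leaf es'] es'(4) pos by (auto simp: h_def terminal_heap_def)
  have size_h: "size (heap_mset h) = length es'"
    using arg_cong[OF h(3), of size] by simp
  have short: "length es' < 2 ^ L" using es'(3) m L(1) by linarith
  have load: "returns LOAD (PairV (edges_val es') (heap_val Leaf)) (heap_val h) ((200 * L + 400) * m + 20)"
  proof (rule returns_mono)
    show "returns LOAD (PairV (edges_val es') (heap_val Leaf)) (heap_val h) ((200 * L + 400) * length es' + 20)"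
      unfolding h_def using short es'(4) by (intro returns_LOAD) (auto simp: all_terminal_def)
  qed (use es'(3) in simp)
  define out where "out = drain h []"
  have drain: "returns DRAIN (PairV (heap_val h) (list_val (map out_val []))) (list_val (map out_val out))
      ((400 * L + 300) * m + 20)"
  proof (rule returns_mono)
    show "returns DRAIN (PairV (heap_val h) (list_val (map out_val []))) (list_val (map out_val out))
        ((400 * L + 300) * size (heap_mset h) + 20)"
      unfolding out_def using short h(1) size_h by (intro returns_DRAIN) auto
  qed (use es'(3) size_h in simp)
  obtain t where t: "computes demand_graph_program (input_val G Y hs) (list_val (map out_val out)) t"
    "t \<le> (400 * sparsity G + 200 * length hs + 20) + (L + 2 + 1) * ((6200 * L + 14100) * m + 120) +
      ((200 * L + 400) * m + 20) + ((400 * L + 300) * m + 20) + 50"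
    using computes_demand_graph[OF build es'(1) load drain]
    by (auto simp: input_val_def hs'_def comp_def)
  have time: "real t \<le> time_bound (sparsity G)"
    using total_time_le[OF m L(2) length_hedges[OF en] t(2)] .
  have dr: "routed G Y (out_arcs out)" "sorted_wrt (>) (out_keys out)"
    "\<forall>(i, j, w)\<in>set out. 0 < w" "set (out_keys out) \<subseteq> fst ` set_mset (heap_mset h)"
    using drain_correct[OF h(1,2), of G Y "[]"] es'(2) h(3) by (auto simp: out_def sound_def)
  have distinct: "distinct (out_keys out)"
    using dr(2) by (rule sorted_wrt_greater_distinct)
  \<comment> \<open>A vertex that is a tail and a head would make its terminal copy both a source
    and a sink.\<close>
  have sides: "\<forall>(i, j, w)\<in>set out. \<forall>(i', j', w')\<in>set out. i \<noteq> j'"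
  proof (clarify)
    fix i j w i' w'
    assume "(i, j, w) \<in> set out" "(i', i, w') \<in> set out"
    then have "(i, j) \<in> fst ` set_mset (heap_mset h)" "(i', i) \<in> fst ` set_mset (heap_mset h)"
      using dr(4) by force+
    then obtain e e' where e: "((i, j), e) \<in># heap_mset h" "((i', i), e') \<in># heap_mset h" by auto
    from e have "e \<in># mset es'" "e' \<in># mset es'"
      unfolding h(3)[symmetric] by force+
    moreover have "fst e = Term i" "fst (snd e') = Term i"
      using e h(2) unfolding terminal_heap_def by (force simp: case_prod_unfold)+
    ultimately have "Term i \<in># srcs (mset es')" "Term i \<in># dsts (mset es')"
      unfolding set_image_mset by (metis image_eqI)+
    then show False using es'(2) unfolding sound_def one_sided_def by blast
  qed
  show "\<exists>result t H. computes demand_graph_program (input_val G Y hs) result t \<and>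
      real t \<le> time_bound (sparsity G) \<and> represents_graph result H \<and> weighted_graph_on (verts G) H \<and>
      embeds H (congestion G F Y) G F \<and>
      bipartite_over H {i\<in>verts G. dem G Y i \<ge> 0} {i\<in>verts G. dem G Y i < 0} \<and>
      (\<forall>i\<in>verts G. wdegree H i = \<bar>dem G Y i\<bar>)"
  proof -
    obtain H where "represents_graph (list_val (map out_val out)) H" "weighted_graph_on (verts G) H"
      "embeds H (congestion G F Y) G F"
      "bipartite_over H {i\<in>verts G. dem G Y i \<ge> 0} {i\<in>verts G. dem G Y i < 0}"
      "\<forall>i\<in>verts G. wdegree H i = \<bar>dem G Y i\<bar>"
      using graph_of_arcs[OF wh cuts fin dr(1) distinct dr(3) sides] by blast
    then show ?thesis
      using t(1) time by (intro exI[of _ "list_val (map out_val out)"] exI[of _ t] exI[of _ H] conjI)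
  qed
qed

end
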